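(* Let $(V_1, V_2)$ be a compact normal pair on $\mathcal{H}$ and let $k := \dim E_1 \in \{0,1,2,\dots\}\cup\{\infty\}$. Then there exist closed $(V_1,V_2)$-reducing subspaces $\mathcal{H}_i$, $i \in \{0\}\cup\{i\in\mathbb{N}: i \le k\}$, such that $\mathcal{H} = \bigoplus_{i} \mathcal{H}_i$ (orthogonal direct sum), and, writing $(V_{1,i}, V_{2,i}) = (V_1|_{\mathcal{H}_i}, V_2|_{\mathcal{H}_i})$: (1) $(V_{1,0}, V_{2,0})$ on $\mathcal{H}_0$ is a shift-unitary pair; (2) for each $i \ge 1$, $(V_{1,i}, V_{2,i})$ on $\mathcal{H}_i$ is irreducible and is unitarily equivalent to one of the following: (a) $(M_z, M_w)$ on $H^2(\mathbb{D}^2)$; (b) $(M_z, \alpha M_z)$ on $H^2(\mathbb{D})$ for some unimodular constant $\alpha$; (c) $(\gamma M_z|_{\mathcal{S}_{\lambda}}, M_w|_{\mathcal{S}_{\lambda}})$ on $\mathcal{S}_\lambda$, where for some $\lambda\in(0,1)$, some unimodular constant $\gamma$, and some inner function $\varphi\in H^\infty(\mathbb{D}^2)$, the space \[ \mathcal{S}_{\lambda} = \varphi \Big(H^2(\mathbb{D}^2) \oplus \overline{\operatorname{span}}\Big\{ z^j \frac{\bar{w}}{1 - \lambda z \bar{w}} : j \ge 0\Big\}\Big)\subseteq L^2(\mathbb{T}^2) \] is a closed subspace of $H^2(\mathbb{D}^2)$ invariant under $M_z$ and $M_w$.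
   Context: All Hilbert spaces are complex and separable. An isometric pair is a pair $(V_1,V_2)$ of commuting isometries on a Hilbert space $\mathcal{H}$. An isometry $V$ is a shift if $V^{*m}\to 0$ in the strong operator topology. A BCL pair is an isometric pair with $V_1V_2$ a shift. The cross-commutator is $[V_2^*,V_1] := V_2^*V_1 - V_1V_2^*$. A compact normal pair is a BCL pair with $[V_2^*,V_1]$ compact and normal. The defect operator is $C(V_1,V_2) := I - V_1V_1^* - V_2V_2^* + V_1V_2V_1^*V_2^*$ and $E_1 := \ker(C(V_1,V_2) - I)$. A subspace is $(V_1,V_2)$-reducing if invariant under $V_1,V_2,V_1^*,V_2^*$; a pair is irreducible if there is no reducing subspace other than $\{0\}$ and the whole space. A shift-unitary pair is an isometric pair $(V_1,V_2)$ on $\mathcal{K}$ with $[V_2^*,V_1]=0$ such that $\mathcal{K} = \mathcal{K}_{us}\oplus\mathcal{K}_{su}$ with both summands reducing, $V_1$ unitary and $V_2$ a shift on $\mathcal{K}_{us}$, and $V_1$ a shift and $V_2$ unitary on $\mathcal{K}_{su}$ (summands may be zero). $H^2(\mathbb{D})$ and $H^2(\mathbb{D}^2)$ are the Hardy spaces on the disc and bidisc (the latter the closure of polynomials in $z,w$ in $L^2(\mathbb{T}^2)$); $M_z, M_w$ are multiplication by the coordinate functions. An inner function $\varphi\in H^\infty(\mathbb{D}^2)$ is one with unimodular boundary values a.e. on $\mathbb{T}^2$. Pairs $(S_1,S_2)$ on $\mathcal{H}_1$ and $(T_1,T_2)$ on $\mathcal{H}_2$ are unitarily equivalent if $US_i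 = T_iU$, $i=1,2$, for some unitary $U:\mathcal{H}_1\to\mathcal{H}_2$. *)

theory Defs
  imports "HOL-Analysis.Analysis" "HOL-Library.Extended_Nat"
begin

section \<open>Complex inner product spaces (not in the distribution library)\<close>

text \<open>A complex inner product space: a real normed vector space with a complex scalar
  multiplication extending the real one, and a complex inner product (conjugate-linear in the
  first argument) inducing the norm.  Hilbert space = this class plus complete_space.\<close>

class complex_inner = real_normed_vector +
  fixes scaleC :: "complex \<Rightarrow> 'a \<Rightarrow> 'a"
  fixes cinner :: "'a \<Rightarrow> 'a \<Rightarrow> complex"
  assumes scaleC_add_right: "scaleC a (x + y) = scaleC a x + scaleC a y"
    and scaleC_add_left: "scaleC (a + b) x = scaleC a x + scaleC b x"
    and scaleC_scaleC: "scaleC a (scaleC b x) = scaleC (a * b) x"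
    and scaleC_one: "scaleC 1 x = x"
    and scaleR_scaleC: "scaleR r x = scaleC (complex_of_real r) x"
    and cinner_add_left: "cinner (x + y) z = cinner x z + cinner y z"
    and cinner_scaleC_left: "cinner (scaleC a x) y = cnj a * cinner x y"
    and cinner_commute: "cinner x y = cnj (cinner y x)"
    and cinner_self_norm: "cinner x x = complex_of_real ((norm x)\<^sup>2)"

section \<open>Linear algebra and operators on a complex inner product space\<close>

definition csubspace :: "'a::complex_inner set \<Rightarrow> bool" where
  "csubspace S \<longleftrightarrow> 0 \<in> S \<and> (\<forall>x\<in>S. \<forall>y\<in>S. x + y \<in> S) \<and> (\<forall>a. \<forall>x\<in>S. scaleC a x \<in> S)"

definition closed_csubspace :: "'a::complex_inner set \<Rightarrow> bool" where
  "closed_csubspace S \<longleftrightarrow> csubspace S \<and> closed S"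

definition cspan :: "'a::complex_inner set \<Rightarrow> 'a set" where
  "cspan B = {\<Sum>b\<in>F. scaleC (c b) b | F c. finite F \<and> F \<subseteq> B}"

definition cindependent :: "'a::complex_inner set \<Rightarrow> bool" where
  "cindependent B \<longleftrightarrow> (\<forall>F c. finite F \<and> F \<subseteq> B \<and> (\<Sum>b\<in>F. scaleC (c b) b) = 0 \<longrightarrow> (\<forall>b\<in>F. c b = 0))"

text \<open>Hilbert (linear) dimension of a subspace, in {0,1,2,...} \<union> {\<infinity>}:
  supremum of the sizes of finite linearly independent subsets.\<close>
definition hdim :: "'a::complex_inner set \<Rightarrow> enat" where
  "hdim S = Sup {enat (card B) | B. finite B \<and> B \<subseteq> S \<and> cindependent B}"

definition corth :: "'a::complex_inner set \<Rightarrow> 'a set \<Rightarrow> bool" where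
  "corth S T \<longleftrightarrow> (\<forall>x\<in>S. \<forall>y\<in>T. cinner x y = 0)"

definition clinear :: "('a::complex_inner \<Rightarrow> 'a) \<Rightarrow> bool" where
  "clinear f \<longleftrightarrow> (\<forall>x y. f (x + y) = f x + f y) \<and> (\<forall>a x. f (scaleC a x) = scaleC a (f x))"

text \<open>Adjoint of a (bounded) operator.\<close>
definition adj :: "('a::complex_inner \<Rightarrow> 'a) \<Rightarrow> 'a \<Rightarrow> 'a" where
  "adj A = (SOME B. \<forall>x y. cinner (A x) y = cinner x (B y))"

definition isometry :: "('a::complex_inner \<Rightarrow> 'a) \<Rightarrow> bool" where
  "isometry V \<longleftrightarrow> clinear V \<and> (\<forall>x. norm (V x) = norm x)"

text \<open>Shift: V^{*m} \<rightarrow> 0 strongly.\<close>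
definition is_shift :: "('a::complex_inner \<Rightarrow> 'a) \<Rightarrow> bool" where
  "is_shift V \<longleftrightarrow> isometry V \<and> (\<forall>x. (\<lambda>m. (adj V ^^ m) x) \<longlonglongrightarrow> 0)"

definition isometric_pair :: "('a::complex_inner \<Rightarrow> 'a) \<Rightarrow> ('a \<Rightarrow> 'a) \<Rightarrow> bool" where
  "isometric_pair V1 V2 \<longleftrightarrow> isometry V1 \<and> isometry V2 \<and> V1 \<circ> V2 = V2 \<circ> V1"

definition BCL_pair :: "('a::complex_inner \<Rightarrow> 'a) \<Rightarrow> ('a \<Rightarrow> 'a) \<Rightarrow> bool" where
  "BCL_pair V1 V2 \<longleftrightarrow> isometric_pair V1 V2 \<and> is_shift (V1 \<circ> V2)"

text \<open>Cross-commutator [V2^*, V1] = V2^* V1 - V1 V2^*.\<close>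
definition cross_comm :: "('a::complex_inner \<Rightarrow> 'a) \<Rightarrow> ('a \<Rightarrow> 'a) \<Rightarrow> 'a \<Rightarrow> 'a" where
  "cross_comm V1 V2 = (\<lambda>x. adj V2 (V1 x) - V1 (adj V2 x))"

definition compact_op :: "('a::complex_inner \<Rightarrow> 'a) \<Rightarrow> bool" where
  "compact_op T \<longleftrightarrow> clinear T \<and> compact (closure (T ` cball 0 1))"

definition normal_op :: "('a::complex_inner \<Rightarrow> 'a) \<Rightarrow> bool" where
  "normal_op T \<longleftrightarrow> T \<circ> adj T = adj T \<circ> T"

definition compact_normal_pair :: "('a::complex_inner \<Rightarrow> 'a) \<Rightarrow> ('a \<Rightarrow> 'a) \<Rightarrow> bool" where
  "compact_normal_pair V1 V2 \<longleftrightarrow> BCL_pair V1 V2 \<and> compact_op (cross_comm V1 V2) \<and> normal_op (cross_comm V1 V2)"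

text \<open>Defect operator C(V1,V2) = I - V1V1^* - V2V2^* + V1V2V1^*V2^*, and E_1 = ker(C - I).\<close>
definition defect_op :: "('a::complex_inner \<Rightarrow> 'a) \<Rightarrow> ('a \<Rightarrow> 'a) \<Rightarrow> 'a \<Rightarrow> 'a" where
  "defect_op V1 V2 = (\<lambda>x. x - V1 (adj V1 x) - V2 (adj V2 x) + V1 (V2 (adj V1 (adj V2 x))))"

definition E1 :: "('a::complex_inner \<Rightarrow> 'a) \<Rightarrow> ('a \<Rightarrow> 'a) \<Rightarrow> 'a set" where
  "E1 V1 V2 = {x. defect_op V1 V2 x - x = 0}"

text \<open>Closed reducing subspaces.\<close>
definition reducing :: "('a::complex_inner \<Rightarrow> 'a) \<Rightarrow> ('a \<Rightarrow> 'a) \<Rightarrow> 'a set \<Rightarrow> bool" where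
  "reducing V1 V2 S \<longleftrightarrow> closed_csubspace S \<and> V1 ` S \<subseteq> S \<and> V2 ` S \<subseteq> S
      \<and> adj V1 ` S \<subseteq> S \<and> adj V2 ` S \<subseteq> S"

text \<open>Properties of the restriction of operators to a reducing subspace S
  (for reducing S the adjoint of the restriction is the restriction of the adjoint).\<close>
definition unitary_on :: "('a::complex_inner \<Rightarrow> 'a) \<Rightarrow> 'a set \<Rightarrow> bool" where
  "unitary_on V S \<longleftrightarrow> V ` S = S"

definition shift_on :: "('a::complex_inner \<Rightarrow> 'a) \<Rightarrow> 'a set \<Rightarrow> bool" where
  "shift_on V S \<longleftrightarrow> (\<forall>x\<in>S. (\<lambda>m. (adj V ^^ m) x) \<longlonglongrightarrow> 0)"

text \<open>(V1|K, V2|K) is a shift-unitary pair (K reducing for the isometric pair (V1,V2)).\<close>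
definition shift_unitary_on :: "('a::complex_inner \<Rightarrow> 'a) \<Rightarrow> ('a \<Rightarrow> 'a) \<Rightarrow> 'a set \<Rightarrow> bool" where
  "shift_unitary_on V1 V2 K \<longleftrightarrow> (\<forall>x\<in>K. cross_comm V1 V2 x = 0) \<and>
     (\<exists>Kus Ksu. reducing V1 V2 Kus \<and> reducing V1 V2 Ksu \<and> Kus \<subseteq> K \<and> Ksu \<subseteq> K \<and>
        corth Kus Ksu \<and> (\<forall>x\<in>K. \<exists>a\<in>Kus. \<exists>b\<in>Ksu. x = a + b) \<and>
        unitary_on V1 Kus \<and> shift_on V2 Kus \<and> shift_on V1 Ksu \<and> unitary_on V2 Ksu)"

text \<open>(V1|S, V2|S) is irreducible: its reducing subspaces are exactly the reducing subspaces
  of (V1,V2) contained in S.\<close>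
definition irreducible_on :: "('a::complex_inner \<Rightarrow> 'a) \<Rightarrow> ('a \<Rightarrow> 'a) \<Rightarrow> 'a set \<Rightarrow> bool" where
  "irreducible_on V1 V2 S \<longleftrightarrow> (\<forall>M. reducing V1 V2 M \<and> M \<subseteq> S \<longrightarrow> M = {0} \<or> M = S)"

section \<open>L^2 of the circle and torus, Hardy spaces\<close>

definition circle_measure :: "complex measure" where
  "circle_measure = distr (uniform_measure lborel {0..2*pi}) borel cis"

definition torus_measure :: "(complex \<times> complex) measure" where
  "torus_measure = circle_measure \<Otimes>\<^sub>M circle_measure"

definition L2 :: "'t measure \<Rightarrow> ('t \<Rightarrow> complex) set" where
  "L2 M = {f. f \<in> borel_measurable M \<and> integrable M (\<lambda>x. (cmod (f x))\<^sup>2)}"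

definition l2inner :: "'t measure \<Rightarrow> ('t \<Rightarrow> complex) \<Rightarrow> ('t \<Rightarrow> complex) \<Rightarrow> complex" where
  "l2inner M f g = (\<integral>x. cnj (f x) * g x \<partial>M)"

definition l2norm :: "'t measure \<Rightarrow> ('t \<Rightarrow> complex) \<Rightarrow> real" where
  "l2norm M f = sqrt (\<integral>x. (cmod (f x))\<^sup>2 \<partial>M)"

definition fspan :: "('t \<Rightarrow> complex) set \<Rightarrow> ('t \<Rightarrow> complex) set" where
  "fspan A = {(\<lambda>x. \<Sum>a\<in>F. c a * a x) | F c. finite F \<and> F \<subseteq> A}"

text \<open>Closure in L^2 (norm closure; elements are functions, compared up to a.e. equality).\<close>
definition L2_closure :: "'t measure \<Rightarrow> ('t \<Rightarrow> complex) set \<Rightarrow> ('t \<Rightarrow> complex) set" where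
  "L2_closure M A = {f \<in> L2 M. \<forall>e>0. \<exists>g\<in>A. l2norm M (\<lambda>x. f x - g x) < e}"

definition ae_in :: "'t measure \<Rightarrow> ('t \<Rightarrow> complex) \<Rightarrow> ('t \<Rightarrow> complex) set \<Rightarrow> bool" where
  "ae_in M f A \<longleftrightarrow> (\<exists>g\<in>A. AE x in M. f x = g x)"

definition L2_closed :: "'t measure \<Rightarrow> ('t \<Rightarrow> complex) set \<Rightarrow> bool" where
  "L2_closed M A \<longleftrightarrow> A \<subseteq> L2 M \<and>
     (\<forall>f\<in>L2 M. (\<forall>e>0. \<exists>g\<in>A. l2norm M (\<lambda>x. f x - g x) < e) \<longrightarrow> ae_in M f A)"

text \<open>H^2(D): closure of polynomials in z in L^2(T).  H^2(D^2): closure of polynomials in z,w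
  in L^2(T^2).\<close>
definition H2_disc :: "(complex \<Rightarrow> complex) set" where
  "H2_disc = L2_closure circle_measure (fspan {(\<lambda>z. z ^ j) | j. True})"

definition H2_bidisc :: "(complex \<times> complex \<Rightarrow> complex) set" where
  "H2_bidisc = L2_closure torus_measure (fspan {(\<lambda>(z, w). z ^ j * w ^ l) | j l. True})"

text \<open>Inner functions in H^\<infinity>(D^2), identified with their boundary functions on T^2:
  boundary function lies in H^2(D^2) and is unimodular a.e. (hence essentially bounded).\<close>
definition inner_fn :: "(complex \<times> complex \<Rightarrow> complex) \<Rightarrow> bool" where
  "inner_fn \<phi> \<longleftrightarrow> \<phi> \<in> H2_bidisc \<and> (AE x in torus_measure. cmod (\<phi> x) = 1)"

text \<open>closed span{ z^j wbar/(1 - \<lambda> z wbar) : j \<ge> 0 } in L^2(T^2).\<close>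
definition K_lambda :: "real \<Rightarrow> (complex \<times> complex \<Rightarrow> complex) set" where
  "K_lambda lam = L2_closure torus_measure
     (fspan {(\<lambda>(z, w). z ^ j * cnj w / (1 - complex_of_real lam * z * cnj w)) | j. True})"

text \<open>S_\<lambda> = \<phi> (H^2(D^2) \<oplus> K_\<lambda>).\<close>
definition S_lambda :: "(complex \<times> complex \<Rightarrow> complex) \<Rightarrow> real \<Rightarrow> (complex \<times> complex \<Rightarrow> complex) set" where
  "S_lambda \<phi> lam = {(\<lambda>x. \<phi> x * (f x + g x)) | f g. f \<in> H2_bidisc \<and> g \<in> K_lambda lam}"

definition Mz :: "(complex \<times> complex \<Rightarrow> complex) \<Rightarrow> complex \<times> complex \<Rightarrow> complex" where
  "Mz f = (\<lambda>x. fst x * f x)"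

definition Mw :: "(complex \<times> complex \<Rightarrow> complex) \<Rightarrow> complex \<times> complex \<Rightarrow> complex" where
  "Mw f = (\<lambda>x. snd x * f x)"

text \<open>Unitary equivalence of the restricted pair (V1|S, V2|S) with a pair (T1,T2) acting on
  a closed subspace K of L^2(M): a map U from S onto K (modulo a.e. equality) preserving inner
  products (hence linear and isometric) and intertwining.\<close>
definition ueq_L2 :: "'t measure \<Rightarrow> ('a::complex_inner \<Rightarrow> 'a) \<Rightarrow> ('a \<Rightarrow> 'a) \<Rightarrow> 'a set \<Rightarrow>
    (('t \<Rightarrow> complex) \<Rightarrow> 't \<Rightarrow> complex) \<Rightarrow> (('t \<Rightarrow> complex) \<Rightarrow> 't \<Rightarrow> complex) \<Rightarrow>
    ('t \<Rightarrow> complex) set \<Rightarrow> bool" where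
  "ueq_L2 M V1 V2 S T1 T2 K \<longleftrightarrow> (\<exists>U :: 'a \<Rightarrow> 't \<Rightarrow> complex.
      (\<forall>x\<in>S. U x \<in> K) \<and>
      (\<forall>x\<in>S. \<forall>y\<in>S. l2inner M (U x) (U y) = cinner x y) \<and>
      (\<forall>g\<in>K. \<exists>x\<in>S. AE t in M. U x t = g t) \<and>
      (\<forall>x\<in>S. AE t in M. U (V1 x) t = T1 (U x) t) \<and>
      (\<forall>x\<in>S. AE t in M. U (V2 x) t = T2 (U x) t))"

end

(* The cross-commutator T = V2^* V1 - V1 V2^* vanishes on the range of V2 and its adjoint
   vanishes on the range of V1.  Normality makes both vanish on both ranges, so T lives on
   E_1 = ker V1^* \<inter> ker V2^*, where the spectral theorem provides an orthonormal basis of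
   eigenvectors e with T e = \<mu> e.  The vectors V1^m V2^n e span a reducing subspace, and their Gram
   matrix depends on \<mu> only: it is the moment matrix of Lebesgue measure on the torus (\<mu> = 0), of a
   measure on a one-dimensional subtorus (|\<mu>| = 1), or of the density (1 - q^2) / |1 - q z / w|^2
   with q = |\<mu>|, up to a rotation of z.  In the last case e corresponds to a multiple of
   \<phi> / (w - q z), where \<phi> has to be an inner function vanishing on w = q z.  Such a function is
     \<phi> = (1 - q) (w - q z) exp (- sum over N >= 1 of (q^N / N) (z^N + w^N)^2 / (1 - (z w)^N)).
   On the orthogonal complement of all these subspaces T vanishes and E_1 is trivial, so that the Wold
   decompositions of V1 and V2 leave only the shift-unitary part. *)
theory Submission
  imports Defs
begin

section \<open>Complex inner product spaces\<close>

text \<open>The delicate case is 0 < |\<mu>| < 1. The natural copy of the cyclic space is then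
  spanned by z^m w^n / (w - q z), whose poles meet the bidisc; an inner factor vanishing there must
  bring it into H^2. No rational inner function does: the reflection of w - q z is z - q w, which
  also vanishes inside the bidisc, so the analogue of a Blaschke factor is not analytic. Hence w - q
  z is multiplied by a non-rational cofactor with prescribed modulus on the torus. The logarithm of
  that modulus has the frequencies (z/w)^N, which real parts of analytic functions cannot have; each
  is cancelled by a singular correction in powers of z w. Adding 1 to Re (z/w)^N makes all weights
  nonnegative, so that replacing (z w)^N by r (z w)^N in the denominators gives approximants bounded
  uniformly in r < 1; these added constants are the origin of the factor 1 - q. The singularities of
  the terms are dense in the torus, so the limit r -> 1 is taken almost everywhere only.

  A second obstacle is that L^2 functions agree only almost everywhere and linear representations
  are not unique; the unitaries are therefore obtained as closures of linear relations.\<close>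

interpretation cvs: vector_space "scaleC :: complex \<Rightarrow> 'a::complex_inner \<Rightarrow> 'a"
  by unfold_locales (simp_all add: scaleC_add_right scaleC_add_left scaleC_scaleC scaleC_one)

lemma cinner_add_right: "cinner x (y + z) = cinner x y + cinner x z"
  by (metis cinner_add_left cinner_commute complex_cnj_add)

lemma cinner_scaleC_right: "cinner x (scaleC a y) = a * cinner x y"
  by (metis (no_types, lifting) cinner_commute cinner_scaleC_left complex_cnj_cnj complex_cnj_mult)

lemma cinner_zero_left [simp]: "cinner 0 x = 0"
  using cinner_scaleC_left[of 0 0 x] by simp

lemma cinner_zero_right [simp]: "cinner x 0 = 0"
  using cinner_scaleC_right[of x 0 0] by simp

lemma cinner_minus_left: "cinner (- x) y = - cinner x y"
  using cinner_add_left[of x "- x" y] by (simp add: eq_neg_iff_add_eq_0 add.commute)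

lemma cinner_minus_right: "cinner x (- y) = - cinner x y"
  using cinner_add_right[of x y "- y"] by (simp add: eq_neg_iff_add_eq_0 add.commute)

lemma cinner_diff_left: "cinner (x - y) z = cinner x z - cinner y z"
  using cinner_add_left[of x "- y" z] by (simp add: cinner_minus_left)

lemma cinner_diff_right: "cinner x (y - z) = cinner x y - cinner x z"
  using cinner_add_right[of x y "- z"] by (simp add: cinner_minus_right)

lemmas cinner_simps = cinner_add_left cinner_add_right cinner_diff_left cinner_diff_right
  cinner_scaleC_left cinner_scaleC_right cinner_minus_left cinner_minus_right

lemma cinner_sum_right: "cinner y (\<Sum>i\<in>I. f i) = (\<Sum>i\<in>I. cinner y (f i))"
  by (induction I rule: infinite_finite_induct) (simp_all add: cinner_simps)

lemma cinner_self_eq_0 [simp]: "cinner x x = 0 \<longleftrightarrow> x = 0"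
  by (simp add: cinner_self_norm)

lemma cinner_eq_0_commute: "cinner x y = 0 \<longleftrightarrow> cinner y x = 0"
  by (metis cinner_commute complex_cnj_zero)

lemma norm_sq_cinner: "(norm x)\<^sup>2 = Re (cinner x x)"
  by (simp add: cinner_self_norm)

lemma norm_add_sq: "(norm (x + y))\<^sup>2 = (norm x)\<^sup>2 + (norm y)\<^sup>2 + 2 * Re (cinner x y)"
  for x y :: "'a::complex_inner"
proof -
  have "Re (cinner y x) = Re (cinner x y)" by (subst cinner_commute) simp
  then show ?thesis by (simp add: norm_sq_cinner cinner_simps)
qed

lemma norm_diff_sq: "(norm (x - y))\<^sup>2 = (norm x)\<^sup>2 + (norm y)\<^sup>2 - 2 * Re (cinner x y)"
  for x y :: "'a::complex_inner"
  using norm_add_sq[of x "- y"] by (simp add: cinner_simps)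

lemma norm_scaleC: "norm (scaleC a x) = cmod a * norm x"
proof -
  have "cinner (scaleC a x) (scaleC a x) = (a * cnj a) * cinner x x"
    by (simp add: cinner_scaleC_left cinner_scaleC_right)
  also have "\<dots> = complex_of_real ((cmod a * norm x)\<^sup>2)"
    by (simp add: complex_norm_square[symmetric] cinner_self_norm power_mult_distrib)
  finally have "(norm (scaleC a x))\<^sup>2 = (cmod a * norm x)\<^sup>2"
    unfolding cinner_self_norm of_real_eq_iff .
  then show ?thesis by (simp add: power2_eq_iff_nonneg)
qed

lemma cinner_cauchy_schwarz: "cmod (cinner x y) \<le> norm x * norm y"
proof (cases "x = 0")
  case False
  define c where "c = cinner x y"
  \<comment> \<open>\<open>scaleC t x\<close> is the orthogonal projection of \<open>y\<close> onto
    the line through \<open>x\<close>; its coefficient is built from \<open>cinner x y\<close>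
    because the inner product is linear in its second argument.\<close>
  define t where "t = c / complex_of_real ((norm x)\<^sup>2)"
  have ct: "cmod t = cmod c / (norm x)\<^sup>2"
    by (simp add: t_def norm_divide norm_power)
  have nx: "(norm x)\<^sup>2 \<noteq> 0" using False by simp
  have "0 \<le> (norm (y - scaleC t x))\<^sup>2" by simp
  also have "\<dots> = (norm y)\<^sup>2 + (cmod t * norm x)\<^sup>2 - 2 * Re (cinner y (scaleC t x))"
    by (simp add: norm_diff_sq norm_scaleC)
  also have "cinner y (scaleC t x) = complex_of_real ((cmod c)\<^sup>2 / (norm x)\<^sup>2)"
    using complex_norm_square[of c]
    by (simp add: cinner_simps t_def c_def cinner_commute[of y x])
  also have "(cmod t * norm x)\<^sup>2 = (cmod c)\<^sup>2 / (norm x)\<^sup>2"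
    using ct False by (simp add: field_simps power2_eq_square)
  finally have "(cmod c)\<^sup>2 / (norm x)\<^sup>2 \<le> (norm y)\<^sup>2" by simp
  then have "(cmod c)\<^sup>2 \<le> (norm x * norm y)\<^sup>2" using nx
    by (simp add: field_simps power_mult_distrib)
  then show ?thesis unfolding c_def by (simp add: power2_le_iff_abs_le)
qed simp

lemma bounded_bilinear_cinner: "bounded_bilinear (cinner :: 'a::complex_inner \<Rightarrow> 'a \<Rightarrow> complex)"
proof
  show "\<exists>K. \<forall>a b::'a. norm (cinner a b) \<le> norm a * norm b * K"
    by (intro exI[of _ 1]) (simp add: cinner_cauchy_schwarz)
qed (simp_all add: cinner_simps scaleR_scaleC scaleR_conv_of_real)

lemma bounded_bilinear_scaleC: "bounded_bilinear (scaleC :: complex \<Rightarrow> 'a::complex_inner \<Rightarrow> 'a)"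
proof
  show "\<exists>K. \<forall>a. \<forall>b::'a. norm (scaleC a b) \<le> norm a * norm b * K"
    by (intro exI[of _ 1]) (simp add: norm_scaleC)
qed (simp_all add: scaleC_add_left scaleC_add_right scaleR_scaleC scaleC_scaleC scaleR_conv_of_real mult.commute)

lemmas tendsto_cinner = bounded_bilinear.tendsto[OF bounded_bilinear_cinner]
lemmas continuous_on_cinner [continuous_intros] = bounded_bilinear.continuous_on[OF bounded_bilinear_cinner]
lemmas tendsto_scaleC = bounded_bilinear.tendsto[OF bounded_bilinear_scaleC]

lemma scaleC_2: "scaleC 2 x = x + x"
  using scaleC_add_left[of 1 1 x] by (simp add: scaleC_one)

lemma eq_cinner_left_iff: "x = y \<longleftrightarrow> (\<forall>z. cinner z x = cinner z y)"
proof
  assume "\<forall>z. cinner z x = cinner z y"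
  then have "cinner (x - y) (x - y) = 0" by (simp add: cinner_diff_right)
  then show "x = y" by simp
qed simp

lemma cinner_eqI: "(\<And>z. cinner z x = cinner z y) \<Longrightarrow> x = y"
  using eq_cinner_left_iff by blast

section \<open>Closed subspaces and orthogonal projection\<close>

lemma csubspace_add: "csubspace S \<Longrightarrow> x \<in> S \<Longrightarrow> y \<in> S \<Longrightarrow> x + y \<in> S"
  and csubspace_scaleC: "csubspace S \<Longrightarrow> x \<in> S \<Longrightarrow> scaleC a x \<in> S"
  and csubspace_0: "csubspace S \<Longrightarrow> 0 \<in> S"
  by (simp_all add: csubspace_def)

lemma csubspace_neg: "csubspace S \<Longrightarrow> x \<in> S \<Longrightarrow> - x \<in> S"
  using csubspace_scaleC[of S x "-1"] by (simp add: scaleC_one)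

lemma csubspace_diff: "csubspace S \<Longrightarrow> x \<in> S \<Longrightarrow> y \<in> S \<Longrightarrow> x - y \<in> S"
  using csubspace_add[of S x "- y"] csubspace_neg[of S y] by simp

lemma csubspace_iff_subspace: "csubspace S \<longleftrightarrow> cvs.subspace S"
  by (auto simp: csubspace_def cvs.subspace_def)

lemma closed_csubspaceD: "closed_csubspace S \<Longrightarrow> csubspace S" "closed_csubspace S \<Longrightarrow> closed S"
  by (simp_all add: closed_csubspace_def)

lemma cspan_eq_span: "cspan B = cvs.span B"
  unfolding cspan_def cvs.span_explicit by blast

lemma csubspace_cspan: "csubspace (cspan B)"
  by (simp add: cspan_eq_span csubspace_iff_subspace)

lemma csubspace_closure:
  fixes S :: "'a::complex_inner set"
  assumes "csubspace S" shows "csubspace (closure S)"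
  unfolding csubspace_def
proof (intro conjI ballI allI)
  show "0 \<in> closure S" using assms closure_subset csubspace_0 by blast
next
  fix x y assume "x \<in> closure S" "y \<in> closure S"
  then obtain f g where "\<And>n. f n \<in> S" "f \<longlonglongrightarrow> x" "\<And>n. g n \<in> S" "g \<longlonglongrightarrow> y"
    unfolding closure_sequential by blast
  then have "\<forall>n. f n + g n \<in> S" "(\<lambda>n. f n + g n) \<longlonglongrightarrow> x + y"
    using assms by (auto simp: csubspace_add intro: tendsto_add)
  then show "x + y \<in> closure S" unfolding closure_sequential
    by (auto intro!: exI[of _ "\<lambda>n. f n + g n"])
next
  fix a x assume "x \<in> closure S"
  then obtain f where "\<And>n. f n \<in> S" "f \<longlonglongrightarrow> x"
    unfolding closure_sequential by blast
  then have "\<forall>n. scaleC a (f n) \<in> S" "(\<lambda>n. scaleC a (f n)) \<longlonglongrightarrow> scaleC a x"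
    using assms by (auto simp: csubspace_scaleC intro!: tendsto_scaleC)
  then show "scaleC a x \<in> closure S" unfolding closure_sequential
    by (auto intro!: exI[of _ "\<lambda>n. scaleC a (f n)"])
qed

lemma closed_csubspace_closure_cspan: "closed_csubspace (closure (cspan B))"
  by (simp add: closed_csubspace_def csubspace_closure csubspace_cspan)

lemma closure_cspan_least: "closed_csubspace M \<Longrightarrow> B \<subseteq> M \<Longrightarrow> closure (cspan B) \<subseteq> M"
  by (metis cspan_eq_span closed_csubspace_def closure_minimal csubspace_iff_subspace cvs.span_minimal)

lemma closure_cspan_superset: "B \<subseteq> closure (cspan B)"
  by (metis closure_subset cspan_eq_span cvs.span_superset order_trans)

definition orth_complement :: "'a::complex_inner set \<Rightarrow> 'a set" where
  "orth_complement S = {x. \<forall>y\<in>S. cinner y x = 0}"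

lemma closed_csubspace_orth_complement: "closed_csubspace (orth_complement S)"
proof -
  have "orth_complement S = (\<Inter>y\<in>S. {x. cinner y x = 0})" by (auto simp: orth_complement_def)
  moreover have "closed {x. cinner y x = 0}" for y :: 'a
    by (intro closed_Collect_eq continuous_intros)
  ultimately have "closed (orth_complement S)" by auto
  then show ?thesis
    by (auto simp: closed_csubspace_def csubspace_def orth_complement_def cinner_simps)
qed

lemma orth_complement_closure_cspan: "orth_complement (closure (cspan B)) = orth_complement B"
proof
  show "orth_complement (closure (cspan B)) \<subseteq> orth_complement B"
    using closure_cspan_superset[of B] by (auto simp: orth_complement_def)
  show "orth_complement B \<subseteq> orth_complement (closure (cspan B))"
  proof
    fix x assume "x \<in> orth_complement B"
    then have "B \<subseteq> orth_complement {x}" by (auto simp: orth_complement_def cinner_eq_0_commute)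
    then have "closure (cspan B) \<subseteq> orth_complement {x}"
      using closure_cspan_least closed_csubspace_orth_complement by blast
    then show "x \<in> orth_complement (closure (cspan B))"
      by (auto simp: orth_complement_def cinner_eq_0_commute)
  qed
qed

lemma parallelogram_law:
  "(norm (x + y))\<^sup>2 + (norm (x - y))\<^sup>2 = 2 * (norm x)\<^sup>2 + 2 * (norm y)\<^sup>2"
  for x y :: "'a::complex_inner"
  by (simp add: norm_add_sq norm_diff_sq)

text \<open>A minimising sequence for the distance to \<open>M\<close> is Cauchy by the
  parallelogram law, because midpoints stay in \<open>M\<close> and cannot come closer than the
  infimum. The residual at the limit is orthogonal to \<open>M\<close>, since a nonzero inner
  product would permit a shorter residual.\<close>

lemma orthogonal_projection_exists:
  fixes M :: "'a::{complex_inner, complete_space} set"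
  assumes M: "closed_csubspace M"
  obtains m where "m \<in> M" "x - m \<in> orth_complement M"
proof -
  note cs = closed_csubspaceD(1)[OF M]
  have ne: "M \<noteq> {}" using cs csubspace_0 by blast
  define d where "d = infdist x M"
  have d0: "d \<ge> 0" by (simp add: d_def infdist_nonneg)
  have d_le: "d \<le> norm (x - y)" if "y \<in> M" for y
    using infdist_le[OF that, of x] by (simp add: d_def dist_norm)
  have "\<exists>y\<in>M. norm (x - y) < d + 1 / Suc n" for n
  proof (rule ccontr)
    assume "\<not> ?thesis"
    then have "d + 1 / Suc n \<le> infdist x M"
      unfolding infdist_notempty[OF ne] by (intro cINF_greatest) (auto simp: ne dist_norm not_less)
    then show False by (simp add: d_def field_simps)
  qed
  then obtain f where f: "\<And>n. f n \<in> M" "\<And>n. norm (x - f n) < d + 1 / Suc n" by metis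
  have lim: "(\<lambda>n. norm (x - f n)) \<longlonglongrightarrow> d"
  proof (rule tendsto_sandwich[of "\<lambda>_. d" _ _ "\<lambda>n. d + 1 / Suc n"])
    show "(\<lambda>n. d + 1 / real (Suc n)) \<longlonglongrightarrow> d"
      using tendsto_add[OF tendsto_const[of d] LIMSEQ_inverse_real_of_nat] by (simp add: inverse_eq_divide)
  qed (use f d_le in \<open>auto intro!: always_eventually less_imp_le\<close>)
  have par: "(norm (f n - f k))\<^sup>2 \<le> 2 * (norm (x - f n))\<^sup>2 + 2 * (norm (x - f k))\<^sup>2 - 4 * d\<^sup>2" for n k
  proof -
    have mid: "scaleC (1/2) (f n + f k) \<in> M" using f cs by (simp add: csubspace_add csubspace_scaleC)
    have "(x - f n) + (x - f k) = scaleC 2 (x - scaleC (1/2) (f n + f k))"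
      by (simp add: cvs.scale_right_diff_distrib scaleC_scaleC scaleC_one scaleC_2)
    then have "norm ((x - f n) + (x - f k)) = 2 * norm (x - scaleC (1/2) (f n + f k))"
      by (simp add: norm_scaleC)
    then have "2 * d \<le> norm ((x - f n) + (x - f k))" using d_le[OF mid] by simp
    then have "(2 * d)\<^sup>2 \<le> (norm ((x - f n) + (x - f k)))\<^sup>2" using d0 by (intro power_mono) auto
    moreover have "norm ((x - f n) - (x - f k)) = norm (f n - f k)"
      by (simp add: norm_minus_commute)
    ultimately show ?thesis using parallelogram_law[of "x - f n" "x - f k"] by (simp add: power_mult_distrib)
  qed
  have "Cauchy f"
  proof (rule metric_CauchyI)
    fix e :: real assume e: "e > 0"
    have "(\<lambda>n. 2 * (norm (x - f n))\<^sup>2 - 2 * d\<^sup>2) \<longlonglongrightarrow> 2 * d\<^sup>2 - 2 * d\<^sup>2"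
      by (intro tendsto_intros lim)
    then have "eventually (\<lambda>n. 2 * (norm (x - f n))\<^sup>2 - 2 * d\<^sup>2 < e\<^sup>2 / 2) sequentially"
      using e by (intro order_tendstoD) auto
    then obtain N where N: "\<And>n. n \<ge> N \<Longrightarrow> 2 * (norm (x - f n))\<^sup>2 - 2 * d\<^sup>2 < e\<^sup>2 / 2"
      unfolding eventually_sequentially by blast
    have "dist (f n) (f k) < e" if "n \<ge> N" "k \<ge> N" for n k
    proof -
      have "(norm (f n - f k))\<^sup>2 < e\<^sup>2" using par[of n k] N[OF that(1)] N[OF that(2)] by linarith
      then show ?thesis using e by (simp add: dist_norm power_less_imp_less_base)
    qed
    then show "\<exists>N. \<forall>m\<ge>N. \<forall>n\<ge>N. dist (f m) (f n) < e" by blast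
  qed
  then obtain m where m: "f \<longlonglongrightarrow> m" using Cauchy_convergent convergent_def by blast
  have mM: "m \<in> M" using closed_sequentially[OF closed_csubspaceD(2)[OF M]] f(1) m by blast
  have nd: "norm (x - m) = d"
    using LIMSEQ_unique[OF tendsto_norm[OF tendsto_diff[OF tendsto_const m]] lim] .
  have "cinner y (x - m) = 0" if "y \<in> M" for y
  proof (cases "y = 0")
    case False
    define c where "c = cinner y (x - m)"
    \<comment> \<open>The optimal step along \<open>y\<close>: it lowers the squared distance by
      |c|^2 / ||y||^2, which minimality forbids unless \<open>c\<close> is 0.\<close>
    define t where "t = c / complex_of_real ((norm y)\<^sup>2)"
    have ct: "cmod t = cmod c / (norm y)\<^sup>2"
      by (simp add: t_def norm_divide norm_power)
    have "m + scaleC t y \<in> M" using that mM cs by (simp add: csubspace_add csubspace_scaleC)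
    from d_le[OF this] have "d\<^sup>2 \<le> (norm ((x - m) - scaleC t y))\<^sup>2"
      using d0 by (intro power_mono) (auto simp: algebra_simps)
    also have "\<dots> = d\<^sup>2 + (cmod t * norm y)\<^sup>2 - 2 * Re (cinner (x - m) (scaleC t y))"
      by (simp add: norm_diff_sq norm_scaleC nd)
    also have "cinner (x - m) (scaleC t y) = complex_of_real ((cmod c)\<^sup>2 / (norm y)\<^sup>2)"
      using complex_norm_square[of c] cinner_commute[of "x - m" y]
      by (simp add: cinner_scaleC_right t_def c_def)
    also have "(cmod t * norm y)\<^sup>2 = (cmod c)\<^sup>2 / (norm y)\<^sup>2"
        using ct False by (simp add: field_simps power2_eq_square)
    finally have "(cmod c)\<^sup>2 / (norm y)\<^sup>2 \<le> 0" by simp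
    then have "c = 0" using False by (simp add: divide_le_0_iff)
    then show ?thesis by (simp add: c_def)
  qed simp
  then show ?thesis using that mM by (auto simp: orth_complement_def)
qed

lemma closed_csubspace_eq_if_complement_trivial:
  fixes M N :: "'a::{complex_inner, complete_space} set"
  assumes "closed_csubspace M" "csubspace N" "M \<subseteq> N" "\<And>x. x \<in> N \<Longrightarrow> x \<in> orth_complement M \<Longrightarrow> x = 0"
  shows "M = N"
proof
  show "N \<subseteq> M"
  proof
    fix x assume x: "x \<in> N"
    obtain m where m: "m \<in> M" "x - m \<in> orth_complement M"
      using orthogonal_projection_exists[OF assms(1)] by blast
    then have "x - m = 0" using assms x by (meson csubspace_diff subsetD)
    then show "x \<in> M" using m by simp
  qed
qed (rule assms)

section \<open>Isometries and their adjoints\<close>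

lemma clinear_add: "clinear f \<Longrightarrow> f (x + y) = f x + f y"
  and clinear_scaleC: "clinear f \<Longrightarrow> f (scaleC a x) = scaleC a (f x)"
  by (simp_all add: clinear_def)

lemma clinear_0: "clinear f \<Longrightarrow> f 0 = 0"
  using clinear_scaleC[of f 0 0] by simp

lemma clinear_minus: "clinear f \<Longrightarrow> f (- x) = - f x"
  using clinear_scaleC[of f "-1" x] by (simp add: scaleC_one)

lemma clinear_diff: "clinear f \<Longrightarrow> f (x - y) = f x - f y"
  using clinear_add[of f x "- y"] by (simp add: clinear_minus)

lemmas clinear_simps = clinear_add clinear_scaleC clinear_0 clinear_minus clinear_diff

lemma clinear_funpow: "clinear f \<Longrightarrow> clinear (f ^^ n)"
  by (induction n) (auto simp: clinear_def)

lemma clinear_bounded_linear: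
  assumes "clinear f" "\<And>x. norm (f x) \<le> K * norm x"
  shows "bounded_linear f"
  by (rule bounded_linear_intro[of _ K])
    (simp_all add: clinear_simps[OF assms(1)] scaleR_scaleC assms(2) mult.commute)

text \<open>The preimage of \<open>M\<close> is itself a closed subspace, so invariance need only be
  tested on generators.\<close>

lemma clinear_image_closure_cspan:
  assumes f: "clinear f" "bounded_linear f" and M: "closed_csubspace M" and B: "f ` B \<subseteq> M"
  shows "f ` closure (cspan B) \<subseteq> M"
proof -
  have "closed (f -` M)" using f(2) M
    by (intro closed_vimage) (auto simp: closed_csubspace_def linear_continuous_on)
  then have "closed_csubspace (f -` M)"
    using M f(1) by (auto simp: closed_csubspace_def csubspace_def clinear_simps)
  then have "closure (cspan B) \<subseteq> f -` M" using B by (intro closure_cspan_least) auto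
  then show ?thesis by blast
qed

lemma isometry_clinear: "isometry V \<Longrightarrow> clinear V" and isometry_norm: "isometry V \<Longrightarrow> norm (V x) = norm x"
  by (simp_all add: isometry_def)

lemma isometry_bounded_linear: "isometry V \<Longrightarrow> bounded_linear V"
  by (rule clinear_bounded_linear[of _ 1]) (simp_all add: isometry_def)

text \<open>Polarization: norms determine the real part of the inner product, and replacing
  \<open>x\<close> by \<open>scaleC \<i> x\<close> turns the imaginary part into a real one.\<close>

lemma isometry_cinner:
  assumes "isometry V" shows "cinner (V x) (V y) = cinner x y"
proof -
  note V = clinear_simps[OF isometry_clinear[OF assms]]
  have re: "Re (cinner (V x) (V y)) = Re (cinner x y)" for x y
    using norm_add_sq[of "V x" "V y"] norm_add_sq[of x y] isometry_norm[OF assms]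
    by (simp flip: V(1))
  moreover have "Im (cinner (V x) (V y)) = Im (cinner x y)"
    using re[of "scaleC \<i> x" y] by (simp add: V cinner_simps)
  ultimately show ?thesis by (simp add: complex_eq_iff)
qed

lemma isometry_comp: "isometry V \<Longrightarrow> isometry W \<Longrightarrow> isometry (V \<circ> W)"
  by (auto simp: isometry_def clinear_def)

text \<open>\<open>adj\<close> is a Hilbert choice, so it has its defining property only once a
  witness is exhibited; the witness is then unique because inner products separate points.\<close>

lemma adj_eqI:
  assumes "\<And>x y. cinner (A x) y = cinner x (B y)" shows "adj A = B"
proof -
  have "\<forall>x y. cinner (A x) y = cinner x (adj A y)"
    unfolding adj_def by (rule someI[of _ B]) (simp add: assms)
  then show ?thesis by (intro ext cinner_eqI) (metis assms)
qed

text \<open>An isometric image of a complete space is complete. This is what allows projecting onto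
  the range.\<close>

lemma isometry_closed_range:
  fixes V :: "'a::{complex_inner, complete_space} \<Rightarrow> 'a"
  assumes "isometry V" shows "closed_csubspace (range V)"
proof -
  note V = clinear_simps[OF isometry_clinear[OF assms]]
  have "complete (range V)"
    unfolding complete_def
  proof (intro allI impI)
    fix f assume f: "(\<forall>n. f n \<in> range V) \<and> Cauchy f"
    then have "\<forall>n. \<exists>y. f n = V y" by blast
    then obtain g where g: "\<And>n. f n = V (g n)" unfolding choice_iff by blast
    have d: "dist (f m) (f n) = dist (g m) (g n)" for m n
      by (simp add: g dist_norm isometry_norm[OF assms] flip: V(5))
    have "Cauchy g" using f by (auto simp: Cauchy_def d)
    then obtain l where "g \<longlonglongrightarrow> l" using Cauchy_convergent convergent_def by blast
    then have "f \<longlonglongrightarrow> V l"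
      using bounded_linear.tendsto[OF isometry_bounded_linear[OF assms]] by (simp add: g[abs_def])
    then show "\<exists>l\<in>range V. f \<longlonglongrightarrow> l" by blast
  qed
  then have "closed (range V)" by (rule complete_imp_closed)
  moreover have "csubspace (range V)" unfolding csubspace_def
    by (auto simp flip: V(1,2)) (metis V(3) rangeI)
  ultimately show ?thesis by (simp add: closed_csubspace_def)
qed

text \<open>The adjoint is built from the projection onto the range, which spares the Riesz
  representation theorem.\<close>
lemma cinner_adj_isometry:
  fixes V :: "'a::{complex_inner, complete_space} \<Rightarrow> 'a"
  assumes "isometry V" shows "cinner (V x) y = cinner x (adj V y)"
proof -
  have "\<exists>b. \<forall>x. cinner (V x) y = cinner x b" for y
  proof -
    obtain m where m: "m \<in> range V" "y - m \<in> orth_complement (range V)"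
      using orthogonal_projection_exists[OF isometry_closed_range[OF assms]] by blast
    then obtain b where "m = V b" by blast
    then have "cinner (V x) y = cinner x b" for x
      using m(2) isometry_cinner[OF assms, of x b] by (simp add: orth_complement_def cinner_diff_right)
    then show ?thesis by blast
  qed
  then obtain B where B: "\<And>x y. cinner (V x) y = cinner x (B y)" by metis
  then show ?thesis using adj_eqI[of V B] by simp
qed

context
  fixes V :: "'a::{complex_inner, complete_space} \<Rightarrow> 'a"
  assumes V: "isometry V"
begin

lemma cinner_adj_isometry': "cinner (adj V x) y = cinner x (V y)"
  by (metis V cinner_adj_isometry cinner_commute)

lemma adj_isometry_cancel: "adj V (V x) = x"
  by (rule cinner_eqI) (metis V cinner_adj_isometry isometry_cinner)

lemma clinear_adj_isometry: "clinear (adj V)"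
  unfolding clinear_def
  by (intro conjI allI; rule cinner_eqI; simp add: cinner_simps flip: cinner_adj_isometry[OF V])

lemma norm_adj_isometry_sq: "(norm (adj V x))\<^sup>2 = Re (cinner x (V (adj V x)))"
  by (simp add: norm_sq_cinner cinner_adj_isometry')

lemma norm_adj_isometry_le: "norm (adj V x) \<le> norm x"
proof -
  have "(norm (adj V x))\<^sup>2 \<le> norm x * norm (adj V x)"
    unfolding norm_adj_isometry_sq
    using complex_Re_le_cmod[of "cinner x (V (adj V x))"] cinner_cauchy_schwarz[of x "V (adj V x)"]
    by (simp add: isometry_norm[OF V])
  then show ?thesis by (cases "adj V x = 0") (simp_all add: power2_eq_square)
qed

lemma bounded_linear_adj_isometry: "bounded_linear (adj V)"
  by (rule clinear_bounded_linear[of _ 1]) (simp_all add: clinear_adj_isometry norm_adj_isometry_le)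

lemma isometry_funpow: "isometry (V ^^ n)"
proof (induction n)
  case (Suc n)
  then show ?case using isometry_comp[OF V Suc] by (simp only: funpow.simps)
qed (simp add: isometry_def clinear_def)

lemma adj_funpow: "adj (V ^^ n) = adj V ^^ n"
proof (rule adj_eqI)
  show "cinner ((V ^^ n) x) y = cinner x ((adj V ^^ n) y)" for x y
  proof (induction n arbitrary: y)
    case (Suc n)
    then show ?case by (simp add: cinner_adj_isometry[OF V] funpow_swap1[of "adj V"])
  qed simp
qed

end

section \<open>Eigenvectors of compact normal operators\<close>

text \<open>If unit vectors nearly attain the norm s of B, they are nearly eigenvectors of B^2 for
  s^2; compactness makes them converge, and B^2 - s^2 factors.\<close>
lemma compact_selfadjoint_eigenvector:
  fixes B :: "'a::{complex_inner, complete_space} \<Rightarrow> 'a"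
  assumes lin: "clinear B" and bdd: "\<And>x. norm (B x) \<le> K * norm x"
    and M: "closed_csubspace M" "B ` M \<subseteq> M" "\<exists>x\<in>M. x \<noteq> 0"
    and sa: "\<And>x y. x \<in> M \<Longrightarrow> y \<in> M \<Longrightarrow> cinner (B x) y = cinner x (B y)"
    and cpt: "\<And>f::nat \<Rightarrow> 'a. (\<And>n. norm (f n) \<le> 1) \<Longrightarrow> \<exists>r l. strict_mono r \<and> (\<lambda>n. B (f (r n))) \<longlonglongrightarrow> l"
  shows "\<exists>x\<in>M. \<exists>b::real. x \<noteq> 0 \<and> B x = scaleC (complex_of_real b) x"
proof -
  note B = clinear_simps[OF lin]
  note cs = closed_csubspaceD(1)[OF M(1)]
  have bl: "bounded_linear B" by (rule clinear_bounded_linear[OF lin bdd])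
  define U where "U = {x\<in>M. norm x = 1}"
  define s where "s = (SUP x\<in>U. norm (B x))"
  obtain z where z: "z \<in> M" "z \<noteq> 0" using M(3) by blast
  have zU: "scaleC (complex_of_real (1 / norm z)) z \<in> U"
    using z cs by (simp add: U_def csubspace_scaleC norm_scaleC norm_divide)
  have bddU: "bdd_above ((\<lambda>x. norm (B x)) ` U)"
    by (rule bdd_aboveI2[of _ _ K]) (metis (mono_tags, lifting) U_def bdd mem_Collect_eq mult.right_neutral)
  have s_ub: "norm (B x) \<le> s" if "x \<in> U" for x
    unfolding s_def by (rule cSUP_upper[OF that bddU])
  have s0: "0 \<le> s" using s_ub[OF zU] norm_ge_zero order_trans by blast
  have Bs: "norm (B x) \<le> s * norm x" if "x \<in> M" for x
  proof (cases "x = 0")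
    case False
    then have "scaleC (complex_of_real (1 / norm x)) x \<in> U"
      using that cs by (simp add: U_def csubspace_scaleC norm_scaleC norm_divide)
    from s_ub[OF this] show ?thesis using False by (simp add: B norm_scaleC norm_divide field_simps)
  qed (simp add: B)
  show ?thesis
  proof (cases "s = 0")
    case True
    then have "B z = scaleC (complex_of_real 0) z" using Bs[OF z(1)] by simp
    then show ?thesis using z by blast
  next
    case False
    then have sp: "s > 0" using s0 by simp
    have "\<exists>x\<in>U. norm (B x) > s - 1 / Suc n" for n
    proof (rule ccontr)
      assume "\<not> ?thesis"
      then have "s \<le> s - 1 / Suc n" unfolding s_def
        by (intro cSUP_least) (use zU in \<open>auto simp: not_less s_def\<close>)
      then show False by (simp add: field_simps)
    qed
    then obtain f where f: "\<And>n. f n \<in> U" "\<And>n. norm (B (f n)) > s - 1 / Suc n" by metis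
    have fn: "norm (f n) = 1" "f n \<in> M" for n using f(1)[of n] by (auto simp: U_def)
    obtain r l where r: "strict_mono r" and l: "(\<lambda>n. B (f (r n))) \<longlonglongrightarrow> l"
      using cpt[of f] fn by auto
    have "(\<lambda>n. norm (B (f n))) \<longlonglongrightarrow> s"
    proof (rule tendsto_sandwich[of "\<lambda>n. s - 1 / Suc n" _ _ "\<lambda>_. s"])
      show "(\<lambda>n. s - 1 / real (Suc n)) \<longlonglongrightarrow> s"
        using tendsto_diff[OF tendsto_const[of s] LIMSEQ_inverse_real_of_nat] by (simp add: inverse_eq_divide)
    qed (use f s_ub in \<open>auto intro!: always_eventually less_imp_le\<close>)
    then have nl: "(\<lambda>n. norm (B (f (r n)))) \<longlonglongrightarrow> s"
      using LIMSEQ_subseq_LIMSEQ[OF _ r] by (simp add: o_def)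
    \<comment> \<open>In the expanded square the cross term is s^2 ||B f_n||^2 by self-adjointness,
      and ||B B f_n|| is at most s ||B f_n||. The resulting bound tends to 0 because ||B f_n|| tends
      to s.\<close>
    have key: "(norm (B (B (f n)) - scaleC (complex_of_real (s\<^sup>2)) (f n)))\<^sup>2
        \<le> s\<^sup>2 * (s\<^sup>2 - (norm (B (f n)))\<^sup>2)" for n
    proof -
      have BM: "B (f n) \<in> M" using M(2) fn by blast
      have "Re (cinner (B (B (f n))) (scaleC (complex_of_real (s\<^sup>2)) (f n))) = s\<^sup>2 * (norm (B (f n)))\<^sup>2"
        using sa[OF BM fn(2)] by (simp add: cinner_scaleC_right cinner_self_norm)
      moreover have "(norm (B (B (f n))))\<^sup>2 \<le> (s * norm (B (f n)))\<^sup>2"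
        by (intro power_mono Bs BM) simp
      ultimately show ?thesis
        by (simp add: norm_diff_sq norm_scaleC fn(1) norm_power power_mult_distrib algebra_simps flip: power_mult)
    qed
    have "(\<lambda>n. (norm (B (B (f (r n))) - scaleC (complex_of_real (s\<^sup>2)) (f (r n))))\<^sup>2) \<longlonglongrightarrow> 0"
    proof (rule tendsto_sandwich[of "\<lambda>_. 0" _ _ "\<lambda>n. s\<^sup>2 * (s\<^sup>2 - (norm (B (f (r n))))\<^sup>2)"])
      have "(\<lambda>n. s\<^sup>2 * (s\<^sup>2 - (norm (B (f (r n))))\<^sup>2)) \<longlonglongrightarrow> s\<^sup>2 * (s\<^sup>2 - s\<^sup>2)"
        by (intro tendsto_intros nl)
      then show "(\<lambda>n. s\<^sup>2 * (s\<^sup>2 - (norm (B (f (r n))))\<^sup>2)) \<longlonglongrightarrow> 0" by simp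
    qed (use key in auto)
    then have "(\<lambda>n. sqrt ((norm (B (B (f (r n))) - scaleC (complex_of_real (s\<^sup>2)) (f (r n))))\<^sup>2)) \<longlonglongrightarrow> sqrt 0"
      by (rule tendsto_real_sqrt)
    then have "(\<lambda>n. B (B (f (r n))) - scaleC (complex_of_real (s\<^sup>2)) (f (r n))) \<longlonglongrightarrow> 0"
      by (simp add: tendsto_norm_zero_iff)
    with bounded_linear.tendsto[OF bl l]
    have "(\<lambda>n. B (B (f (r n))) - (B (B (f (r n))) - scaleC (complex_of_real (s\<^sup>2)) (f (r n)))) \<longlonglongrightarrow> B l - 0"
      by (rule tendsto_diff)
    then have "(\<lambda>n. scaleC (complex_of_real (s\<^sup>2)) (f (r n))) \<longlonglongrightarrow> B l" by simp
    then have "(\<lambda>n. scaleC (complex_of_real (1 / s\<^sup>2)) (scaleC (complex_of_real (s\<^sup>2)) (f (r n))))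
        \<longlonglongrightarrow> scaleC (complex_of_real (1 / s\<^sup>2)) (B l)"
      by (intro tendsto_scaleC tendsto_const)
    moreover have "complex_of_real (1 / s\<^sup>2) * complex_of_real (s\<^sup>2) = 1" using False by simp
    ultimately have x: "(\<lambda>n. f (r n)) \<longlonglongrightarrow> scaleC (complex_of_real (1 / s\<^sup>2)) (B l)"
      by (simp only: scaleC_scaleC scaleC_one)
    define x where "x = scaleC (complex_of_real (1 / s\<^sup>2)) (B l)"
    have lx: "(\<lambda>n. f (r n)) \<longlonglongrightarrow> x" using x by (simp add: x_def)
    have xM: "x \<in> M" by (rule closed_sequentially[OF closed_csubspaceD(2)[OF M(1)] fn(2) lx])
    have "norm x = 1" using LIMSEQ_unique[OF tendsto_norm[OF lx]] fn by simp
    then have x0: "x \<noteq> 0" by auto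
    have "l = B x" by (rule LIMSEQ_unique[OF l bounded_linear.tendsto[OF bl lx]])
    moreover have "scaleC (complex_of_real (s\<^sup>2)) x = B l"
      using False by (simp add: x_def scaleC_scaleC scaleC_one)
    ultimately have BB: "B (B x) = scaleC (complex_of_real (s\<^sup>2)) x" by simp
    \<comment> \<open>(B - s)(B + s) x = 0: either (B + s) x vanishes and \<open>x\<close> has
      eigenvalue -s, or it is itself an eigenvector for s.\<close>
    define y where "y = B x + scaleC (complex_of_real s) x"
    have yM: "y \<in> M" using xM M(2) cs by (auto simp: y_def csubspace_add csubspace_scaleC)
    show ?thesis
    proof (cases "y = 0")
      case True
      then have "B x = scaleC (complex_of_real (- s)) x"
        by (simp add: y_def eq_neg_iff_add_eq_0)
      then show ?thesis using xM x0 by blast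
    next
      case False
      have "B y = scaleC (complex_of_real s) y"
        by (simp add: y_def B BB scaleC_add_right scaleC_scaleC power2_eq_square add.commute)
      then show ?thesis using yM False by blast
    qed
  qed
qed

text \<open>The real and imaginary parts commute, so the second has an eigenvector inside an eigenspace
  of the first.\<close>
lemma compact_normal_common_eigenvector:
  fixes T :: "'a::{complex_inner, complete_space} \<Rightarrow> 'a"
  assumes lin: "clinear T" "clinear T'" and bdd: "\<And>x. norm (T x) \<le> K * norm x"
    and adj: "\<And>x y. cinner (T x) y = cinner x (T' y)" and normal: "\<And>x. T (T' x) = T' (T x)"
    and M: "closed_csubspace M" "T ` M \<subseteq> M" "T' ` M \<subseteq> M" "\<exists>x\<in>M. x \<noteq> 0"
    and cpt: "\<And>f::nat \<Rightarrow> 'a. (\<And>n. norm (f n) \<le> 1) \<Longrightarrow> \<exists>r l. strict_mono r \<and> (\<lambda>n. T (f (r n))) \<longlonglongrightarrow> l"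
  shows "\<exists>x\<in>M. \<exists>\<mu>. x \<noteq> 0 \<and> T x = scaleC \<mu> x \<and> T' x = scaleC (cnj \<mu>) x"
proof -
  note T = clinear_simps[OF lin(1)] and T' = clinear_simps[OF lin(2)]
  note cs = closed_csubspaceD(1)[OF M(1)]
  have adj': "cinner (T' x) y = cinner x (T y)" for x y by (metis adj cinner_commute)
  have norm_eq: "norm (T' x) = norm (T x)" for x
  proof -
    have "cinner (T' x) (T' x) = cinner (T x) (T x)" by (simp only: adj adj' normal)
    then have "(norm (T' x))\<^sup>2 = (norm (T x))\<^sup>2" unfolding cinner_self_norm of_real_eq_iff .
    then show ?thesis by simp
  qed
  \<comment> \<open>Normality gives ||T' x|| = ||T x||, so a subsequence along which
    \<open>T\<close> converges is Cauchy, hence convergent, under \<open>T'\<close> as well.\<close>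
  have cpt2: "\<exists>r l l'. strict_mono r \<and> (\<lambda>n. T (f (r n))) \<longlonglongrightarrow> l \<and> (\<lambda>n. T' (f (r n))) \<longlonglongrightarrow> l'"
    if f: "\<And>n. norm (f n) \<le> 1" for f :: "nat \<Rightarrow> 'a"
  proof -
    obtain r l where r: "strict_mono r" "(\<lambda>n. T (f (r n))) \<longlonglongrightarrow> l" using cpt[of f] f by blast
    have "dist (T' (f (r m))) (T' (f (r n))) = dist (T (f (r m))) (T (f (r n)))" for m n
      using norm_eq[of "f (r m) - f (r n)"] by (simp add: dist_norm T T')
    then have "Cauchy (\<lambda>n. T' (f (r n)))"
      using LIMSEQ_imp_Cauchy[OF r(2)] by (simp add: Cauchy_def)
    then show ?thesis using r Cauchy_convergent convergent_def by blast
  qed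
  \<comment> \<open>\<open>A\<close> and \<open>C\<close> are twice the real and imaginary parts of
    \<open>T\<close>; the factor 2 is undone when the eigenvalue of \<open>T\<close> is
    reassembled.\<close>
  define A where "A = (\<lambda>x. T x + T' x)"
  define C where "C = (\<lambda>x. scaleC \<i> (T' x - T x))"
  have linA: "clinear A" and linC: "clinear C"
    by (simp_all add: clinear_def A_def C_def T T' scaleC_add_right cvs.scale_right_diff_distrib scaleC_scaleC mult.commute)
  have bdA: "norm (A x) \<le> (2 * K) * norm x" for x
    unfolding A_def using norm_triangle_ineq[of "T x" "T' x"] norm_eq[of x] bdd[of x] by simp
  have bdC: "norm (C x) \<le> (2 * K) * norm x" for x
    unfolding C_def using norm_triangle_ineq4[of "T' x" "T x"] norm_eq[of x] bdd[of x] by (simp add: norm_scaleC)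
  have cA: "\<exists>r l. strict_mono r \<and> (\<lambda>n. A (f (r n))) \<longlonglongrightarrow> l" if "\<And>n. norm (f n) \<le> 1" for f :: "nat \<Rightarrow> 'a"
  proof -
    obtain r l l' where "strict_mono r" "(\<lambda>n. T (f (r n))) \<longlonglongrightarrow> l" "(\<lambda>n. T' (f (r n))) \<longlonglongrightarrow> l'"
      using cpt2[of f] \<open>\<And>n. norm (f n) \<le> 1\<close> by blast
    then show ?thesis unfolding A_def by (intro exI[of _ r] exI[of _ "l + l'"] conjI tendsto_add)
  qed
  have cC: "\<exists>r l. strict_mono r \<and> (\<lambda>n. C (f (r n))) \<longlonglongrightarrow> l" if "\<And>n. norm (f n) \<le> 1" for f :: "nat \<Rightarrow> 'a"
  proof -
    obtain r l l' where "strict_mono r" "(\<lambda>n. T (f (r n))) \<longlonglongrightarrow> l" "(\<lambda>n. T' (f (r n))) \<longlonglongrightarrow> l'"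
      using cpt2[of f] \<open>\<And>n. norm (f n) \<le> 1\<close> by blast
    then show ?thesis unfolding C_def
      by (intro exI[of _ r] exI[of _ "scaleC \<i> (l' - l)"] conjI tendsto_diff tendsto_scaleC tendsto_const)
  qed
  have saA: "cinner (A x) y = cinner x (A y)" and saC: "cinner (C x) y = cinner x (C y)" for x y
    by (simp_all add: A_def C_def cinner_simps adj adj' algebra_simps)
  have AM: "A ` M \<subseteq> M" and CM: "C ` M \<subseteq> M"
    using M cs by (auto simp: A_def C_def intro!: csubspace_add csubspace_scaleC csubspace_diff)
  obtain x a where x: "x \<in> M" "x \<noteq> 0" "A x = scaleC (complex_of_real a) x"
    using compact_selfadjoint_eigenvector[OF linA bdA M(1) AM M(4) saA cA] by blast
  define N where "N = M \<inter> {x. A x = scaleC (complex_of_real a) x}"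
  have blA: "bounded_linear A" by (rule clinear_bounded_linear[OF linA bdA])
  have "closed {x. A x = scaleC (complex_of_real a) x}"
    by (intro closed_Collect_eq linear_continuous_on blA
        bounded_bilinear.continuous_on[OF bounded_bilinear_scaleC] continuous_on_const continuous_on_id)
  then have N: "closed_csubspace N"
    using M(1) by (auto simp: N_def closed_csubspace_def csubspace_def clinear_simps[OF linA]
        scaleC_add_right scaleC_scaleC mult.commute)
  have AC: "A (C x) = C (A x)" for x
    by (simp add: A_def C_def T T' normal scaleC_add_right cvs.scale_right_diff_distrib algebra_simps)
  have CN: "C ` N \<subseteq> N"
    using CM by (auto simp: N_def AC clinear_simps[OF linC])
  obtain y c where y: "y \<in> N" "y \<noteq> 0" "C y = scaleC (complex_of_real c) y"
    using compact_selfadjoint_eigenvector[OF linC bdC N CN _ saC cC] x by (auto simp: N_def)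
  have Ay: "T y + T' y = scaleC (complex_of_real a) y" using y by (simp add: N_def A_def)
  have "scaleC (- \<i>) (C y) = T' y - T y" by (simp add: C_def scaleC_scaleC scaleC_one)
  then have Cy: "T' y - T y = scaleC (- \<i> * complex_of_real c) y" by (simp add: y scaleC_scaleC)
  have "T y = scaleC (1/2) ((T y + T' y) - (T' y - T y))" "T' y = scaleC (1/2) ((T y + T' y) + (T' y - T y))"
    by (simp_all add: scaleC_2[symmetric] scaleC_scaleC scaleC_one)
  then have "T y = scaleC ((complex_of_real a + \<i> * complex_of_real c) / 2) y"
    "T' y = scaleC ((complex_of_real a - \<i> * complex_of_real c) / 2) y"
    unfolding Ay Cy
    by (simp_all add: scaleC_scaleC scaleC_add_left[symmetric] cvs.scale_left_diff_distrib[symmetric])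
  moreover have "cnj ((complex_of_real a + \<i> * complex_of_real c) / 2) = (complex_of_real a - \<i> * complex_of_real c) / 2"
    by simp
  moreover have "y \<in> M" using y by (simp add: N_def)
  ultimately show ?thesis using y(2) by metis
qed

section \<open>Orthonormal sets and Hilbert dimension\<close>

definition orthonormal :: "'a::complex_inner set \<Rightarrow> bool" where
  "orthonormal B \<longleftrightarrow> (\<forall>b\<in>B. norm b = 1) \<and> (\<forall>b\<in>B. \<forall>c\<in>B. b \<noteq> c \<longrightarrow> cinner b c = 0)"

lemma orthonormal_independent:
  assumes "orthonormal B" shows "cindependent B"
  unfolding cindependent_def
proof (intro allI impI ballI)
  fix F c b assume F: "finite F \<and> F \<subseteq> B \<and> (\<Sum>b\<in>F. scaleC (c b) b) = 0" and b: "b \<in> F"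
  have "0 = cinner b (\<Sum>b\<in>F. scaleC (c b) b)" using F by simp
  also have "\<dots> = (\<Sum>b'\<in>F. c b' * cinner b b')" by (simp add: cinner_sum_right cinner_scaleC_right)
  also have "\<dots> = (\<Sum>b'\<in>F. if b' = b then c b else 0)"
    using F b assms by (intro sum.cong) (auto simp: orthonormal_def cinner_self_norm subset_iff)
  also have "\<dots> = c b" using F b by simp
  finally show "c b = 0" by simp
qed

text \<open>Distinct orthonormal vectors are at distance sqrt 2, so a point of \<open>D\<close>
  within 1/2 of one of them cannot be within 1/2 of another.\<close>

lemma orthonormal_countable:
  fixes B D :: "'a::complex_inner set"
  assumes "orthonormal B" "countable D" "closure D = UNIV" shows "countable B"
proof -
  have "\<exists>d\<in>D. dist d b < 1/2" for b
    using assms(3) closure_approachable[of b D] by (metis UNIV_I half_gt_zero_iff zero_less_one)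
  then obtain d where d: "\<And>b. d b \<in> D" "\<And>b. dist (d b) b < 1/2" by metis
  have "inj_on d B"
  proof (rule inj_onI, rule ccontr)
    fix b c assume bc: "b \<in> B" "c \<in> B" "d b = d c" "b \<noteq> c"
    then have "(norm (b - c))\<^sup>2 = 2" using assms(1) by (simp add: norm_diff_sq orthonormal_def)
    moreover have "norm (b - c) < 1"
      using dist_triangle2[of b c "d b"] d(2)[of b] d(2)[of c] bc(3) by (simp add: dist_commute dist_norm)
    then have "(norm (b - c))\<^sup>2 < 1" by (simp add: power_less_one_iff abs_square_less_1)
    ultimately show False by simp
  qed
  moreover have "countable (d ` B)" using countable_subset[OF _ assms(2)] d(1) by blast
  ultimately show ?thesis using countable_image_inj_on by blast
qed

text \<open>Stated for an arbitrary set \<open>S\<close>, because the eigenvectors for all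
  eigenvalues together, to which it is applied, need not form a subspace. The argument is Zorn's
  lemma.\<close>

lemma maximal_orthonormal_subset:
  fixes S :: "'a::complex_inner set"
  obtains B where "B \<subseteq> S" "orthonormal B" "\<And>x. x \<in> S \<Longrightarrow> norm x = 1 \<Longrightarrow> \<exists>b\<in>B. cinner b x \<noteq> 0"
proof -
  define A where "A = {B. B \<subseteq> S \<and> orthonormal B}"
  have "\<exists>B\<in>A. \<forall>X\<in>A. B \<subseteq> X \<longrightarrow> X = B"
  proof (rule subset_Zorn_nonempty)
    show "A \<noteq> {}" by (auto simp: A_def orthonormal_def intro!: exI[of _ "{}"])
    fix c assume c: "c \<noteq> {}" "subset.chain A c"
    then have 1: "\<And>X. X \<in> c \<Longrightarrow> X \<subseteq> S \<and> orthonormal X" and 2: "\<And>X Y. X \<in> c \<Longrightarrow> Y \<in> c \<Longrightarrow> X \<subseteq> Y \<or> Y \<subseteq> X"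
      by (auto simp: A_def subset_chain_def)
    have "orthonormal (\<Union> c)" unfolding orthonormal_def
    proof (intro conjI ballI impI)
      fix a b assume "a \<in> \<Union> c" "b \<in> \<Union> c" and ab: "a \<noteq> b"
      then obtain X where "X \<in> c" "a \<in> X" "b \<in> X" using 2 by blast
      then show "cinner a b = 0" using 1 ab unfolding orthonormal_def by blast
    qed (use 1 in \<open>auto simp: orthonormal_def\<close>)
    then show "\<Union> c \<in> A" using 1 by (auto simp: A_def)
  qed
  then obtain B where B: "B \<subseteq> S" "orthonormal B" and mx: "\<And>X. X \<subseteq> S \<Longrightarrow> orthonormal X \<Longrightarrow> B \<subseteq> X \<Longrightarrow> X = B"
    by (auto simp: A_def)
  have "\<exists>b\<in>B. cinner b x \<noteq> 0" if x: "x \<in> S" "norm x = 1" for x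
  proof (rule ccontr)
    assume no: "\<not> ?thesis"
    then have "orthonormal (insert x B)"
      using B(2) x(2) by (auto simp: orthonormal_def cinner_eq_0_commute[of x])
    then have "insert x B = B" using mx[of "insert x B"] B(1) x(1) by blast
    then have "x \<in> B" by blast
    then have "cinner x x = 0" using no by blast
    then show False using x(2) by auto
  qed
  then show ?thesis using that B by blast
qed

text \<open>Links the algebraic \<open>hdim\<close> with orthonormal bases. For finite
  \<open>B\<close> the Fourier expansion shows that \<open>B\<close> spans \<open>M\<close>
  algebraically, so no independent set is larger; for infinite \<open>B\<close> its finite subsets
  already give unbounded independent sets, and \<open>enat\<close> has a single infinite
  value.\<close>

lemma hdim_orthonormal_basis:
  fixes B M :: "'a::complex_inner set"
  assumes M: "csubspace M" "B \<subseteq> M" and B: "orthonormal B"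
    and complete: "\<And>x. x \<in> M \<Longrightarrow> x \<in> orth_complement B \<Longrightarrow> x = 0"
  shows "hdim M = (if finite B then enat (card B) else \<infinity>)"
proof (cases "finite B")
  case True
  have "M \<subseteq> cvs.span B"
  proof
    fix x assume x: "x \<in> M"
    define y where "y = x - (\<Sum>b\<in>B. scaleC (cinner b x) b)"
    have "(\<Sum>b\<in>B. scaleC (cinner b x) b) \<in> M"
      using M by (auto simp: csubspace_iff_subspace intro!: cvs.subspace_sum cvs.subspace_scale)
    then have "y \<in> M" using x M by (simp add: y_def csubspace_diff)
    moreover have "cinner c y = 0" if "c \<in> B" for c
    proof -
      have "(\<Sum>b\<in>B. cinner b x * cinner c b) = (\<Sum>b\<in>B. if b = c then cinner c x else 0)"
        using B that by (intro sum.cong) (auto simp: orthonormal_def cinner_self_norm)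
      then show ?thesis using that True by (simp add: y_def cinner_simps cinner_sum_right)
    qed
    ultimately have "y = 0" using complete by (auto simp: orth_complement_def)
    then have "x = (\<Sum>b\<in>B. scaleC (cinner b x) b)" by (simp add: y_def)
    also have "\<dots> \<in> cvs.span B" by (intro cvs.span_sum cvs.span_scale cvs.span_base)
    finally show "x \<in> cvs.span B" .
  qed
  then have "enat (card F) \<le> enat (card B)" if "finite F" "F \<subseteq> M" "cindependent F" for F
    using cvs.independent_span_bound[OF True, of F] that
    by (auto simp: cindependent_def cvs.independent_explicit_module)
  moreover have "cindependent B" by (rule orthonormal_independent[OF B])
  ultimately show ?thesis
    using True M(2) unfolding hdim_def by (auto intro!: Sup_eqI)
next
  case False
  have "\<exists>F. finite F \<and> F \<subseteq> M \<and> cindependent F \<and> card F = n" for n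
  proof -
    obtain F where "F \<subseteq> B" "finite F" "card F = n" using infinite_arbitrarily_large[OF False] by blast
    moreover then have "cindependent F"
      using B by (intro orthonormal_independent) (auto simp: orthonormal_def subset_iff)
    ultimately show ?thesis using M(2) by blast
  qed
  then have "enat n \<le> hdim M" for n unfolding hdim_def by (intro Sup_upper) (smt (verit, best) mem_Collect_eq)
  then have "hdim M = \<infinity>" by (metis enat_ord_code(4) enat_ord_simps(5) less_le_not_le linorder_not_le not_infinity_eq Suc_ile_eq)
  then show ?thesis using False by simp
qed

section \<open>Commuting isometries with normal cross-commutator\<close>

locale commuting_isometries =
  fixes V1 V2 :: "'a::{complex_inner, complete_space} \<Rightarrow> 'a"
  assumes iso1: "isometry V1" and iso2: "isometry V2" and comm: "V1 (V2 x) = V2 (V1 x)"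
begin

abbreviation "A1 \<equiv> adj V1"
abbreviation "A2 \<equiv> adj V2"
abbreviation "T \<equiv> cross_comm V1 V2"
abbreviation "T' \<equiv> cross_comm V2 V1"

lemmas V1_simps = clinear_simps[OF isometry_clinear[OF iso1]]
lemmas V2_simps = clinear_simps[OF isometry_clinear[OF iso2]]
lemmas A1_simps = clinear_simps[OF clinear_adj_isometry[OF iso1]]
lemmas A2_simps = clinear_simps[OF clinear_adj_isometry[OF iso2]]

lemma A1_V1 [simp]: "A1 (V1 x) = x" and A2_V2 [simp]: "A2 (V2 x) = x"
  by (simp_all add: adj_isometry_cancel iso1 iso2)

lemma cinner_A1: "cinner (V1 x) y = cinner x (A1 y)" and cinner_A2: "cinner (V2 x) y = cinner x (A2 y)"
  by (simp_all add: cinner_adj_isometry iso1 iso2)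

lemma cinner_A1': "cinner (A1 x) y = cinner x (V1 y)" and cinner_A2': "cinner (A2 x) y = cinner x (V2 y)"
  by (simp_all add: cinner_adj_isometry' iso1 iso2)

lemma adj_comm: "A1 (A2 x) = A2 (A1 x)"
  by (rule cinner_eqI) (simp add: comm flip: cinner_A1 cinner_A2)

lemma adj_product: "adj (V1 \<circ> V2) = A2 \<circ> A1"
  by (rule adj_eqI) (simp add: cinner_A1 cinner_A2)

lemma swap: "commuting_isometries V2 V1"
  by unfold_locales (simp_all add: iso1 iso2 comm)

text \<open>Pairing C x = x with \<open>x\<close> gives ||A1 A2 x||^2 = ||A1 x||^2 + ||A2 x||^2. As
  \<open>A1\<close> and \<open>A2\<close> are commuting contractions, the left side is at most
  either summand, so both summands vanish.\<close>

lemma E1_iff: "x \<in> E1 V1 V2 \<longleftrightarrow> A1 x = 0 \<and> A2 x = 0"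
proof
  assume "x \<in> E1 V1 V2"
  then have "V1 (V2 (A1 (A2 x))) = V1 (A1 x) + V2 (A2 x)"
    by (simp add: E1_def defect_op_def algebra_simps)
  then have "cinner x (V1 (V2 (A1 (A2 x)))) = cinner x (V1 (A1 x)) + cinner x (V2 (A2 x))"
    by (simp add: cinner_add_right)
  moreover have "cinner x (V1 (V2 (A1 (A2 x)))) = cinner (A1 (A2 x)) (A1 (A2 x))"
    by (simp add: adj_comm flip: cinner_A1' cinner_A2')
  ultimately have "complex_of_real ((norm (A1 (A2 x)))\<^sup>2) = complex_of_real ((norm (A1 x))\<^sup>2 + (norm (A2 x))\<^sup>2)"
    by (simp add: cinner_self_norm flip: cinner_A1' cinner_A2')
  then have eq: "(norm (A1 (A2 x)))\<^sup>2 = (norm (A1 x))\<^sup>2 + (norm (A2 x))\<^sup>2"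
    unfolding of_real_eq_iff .
  have "(norm (A1 (A2 x)))\<^sup>2 \<le> (norm (A2 x))\<^sup>2"
    by (intro power_mono norm_adj_isometry_le iso1) simp
  moreover have "(norm (A1 (A2 x)))\<^sup>2 \<le> (norm (A1 x))\<^sup>2"
    unfolding adj_comm by (intro power_mono norm_adj_isometry_le iso2) simp
  ultimately have "(norm (A1 x))\<^sup>2 \<le> 0" "(norm (A2 x))\<^sup>2 \<le> 0" using eq by linarith+
  then show "A1 x = 0 \<and> A2 x = 0" by simp
qed (simp add: E1_def defect_op_def V1_simps V2_simps A1_simps)

lemma closed_csubspace_E1: "closed_csubspace (E1 V1 V2)"
proof -
  have "E1 V1 V2 = {x. A1 x = 0} \<inter> {x. A2 x = 0}" using E1_iff by blast
  moreover have "closed {x. A1 x = 0}" "closed {x. A2 x = 0}"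
    by (intro closed_Collect_eq linear_continuous_on bounded_linear_adj_isometry iso1 iso2 continuous_on_const)+
  ultimately show ?thesis
    by (auto simp: closed_csubspace_def csubspace_def A1_simps A2_simps)
qed

lemma clinear_cross: "clinear T"
  by (simp add: clinear_def cross_comm_def V1_simps A2_simps cvs.scale_right_diff_distrib)

lemma cross_bound: "norm (T x) \<le> 2 * norm x"
proof -
  have "norm (T x) \<le> norm (A2 (V1 x)) + norm (V1 (A2 x))"
    unfolding cross_comm_def by (rule norm_triangle_ineq4)
  also have "\<dots> \<le> norm x + norm x"
    using norm_adj_isometry_le[OF iso2, of "V1 x"] norm_adj_isometry_le[OF iso2, of x]
    by (simp add: isometry_norm[OF iso1])
  finally show ?thesis by simp
qed

lemma cinner_cross: "cinner (T x) y = cinner x (T' y)"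
  by (simp add: cross_comm_def cinner_simps cinner_A1 cinner_A2')

lemma adj_cross: "adj T = T'"
  by (rule adj_eqI) (rule cinner_cross)

lemma cross_V2: "T (V2 x) = 0"
  by (simp add: cross_comm_def comm)

text \<open>Formulated for an invariant set \<open>S\<close>, since it is applied to the union of
  all cyclic subspaces.\<close>

lemma reducing_orth_complement_invariant:
  assumes "V1 ` S \<subseteq> S" "V2 ` S \<subseteq> S" "A1 ` S \<subseteq> S" "A2 ` S \<subseteq> S"
  shows "reducing V1 V2 (orth_complement S)"
  using assms closed_csubspace_orth_complement[of S] unfolding reducing_def
  by (auto simp: orth_complement_def image_subset_iff simp flip: cinner_A1 cinner_A2 cinner_A1' cinner_A2')

lemma reducing_orth_complement: "reducing V1 V2 S \<Longrightarrow> reducing V1 V2 (orth_complement S)"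
  by (intro reducing_orth_complement_invariant) (auto simp: reducing_def)

lemma reducing_Int: "reducing V1 V2 S \<Longrightarrow> reducing V1 V2 M \<Longrightarrow> reducing V1 V2 (S \<inter> M)"
  by (auto simp: reducing_def closed_csubspace_def csubspace_def)

lemma reducingD:
  assumes "reducing V1 V2 S"
  shows "closed_csubspace S" "x \<in> S \<Longrightarrow> V1 x \<in> S" "x \<in> S \<Longrightarrow> V2 x \<in> S"
    "x \<in> S \<Longrightarrow> A1 x \<in> S" "x \<in> S \<Longrightarrow> A2 x \<in> S"
  using assms by (auto simp: reducing_def)

text \<open>A Wold decomposition: where the cross-commutator and its adjoint vanish, everything commutes
  with the projections onto the ranges of the powers of V1.\<close>
lemma shift_unitary_onI:
  assumes K: "reducing V1 V2 K" and cross: "\<And>x. x \<in> K \<Longrightarrow> T x = 0" "\<And>x. x \<in> K \<Longrightarrow> T' x = 0"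
    and E1: "\<And>x. x \<in> K \<Longrightarrow> x \<in> E1 V1 V2 \<Longrightarrow> x = 0"
    and shift: "is_shift (V1 \<circ> V2)"
  shows "shift_unitary_on V1 V2 K"
proof -
  note K_rules = reducingD[OF K]
  \<comment> \<open>The orthogonal projection onto the range of \<open>V1 ^^ n\<close>.\<close>
  define P where "P n x = (V1 ^^ n) ((A1 ^^ n) x)" for n x
  have c21: "A2 (V1 x) = V1 (A2 x)" and c12: "A1 (V2 x) = V2 (A1 x)" if "x \<in> K" for x
    using cross[OF that] by (simp_all add: cross_comm_def)
  have An: "(A1 ^^ n) x \<in> K" "(A2 ^^ n) x \<in> K" "(V1 ^^ n) x \<in> K" if "x \<in> K" for n x
    using that by (induction n) (auto intro: K_rules)
  have cancel: "(A1 ^^ n) ((V1 ^^ n) x) = x" for n x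
    by (induction n) (simp_all add: funpow_swap1[of A1])
  have P_Suc: "P (Suc n) x = V1 (P n (A1 x))" for n x by (simp add: P_def funpow_swap1)
  have isoP: "isometry (V1 ^^ n)" for n by (rule isometry_funpow[OF iso1])
  have adjP: "adj (V1 ^^ n) = A1 ^^ n" for n by (rule adj_funpow[OF iso1])
  note linP = clinear_simps[OF isometry_clinear[OF isoP]]
  have linA: "clinear (A1 ^^ n)" for n by (rule clinear_funpow[OF clinear_adj_isometry[OF iso1]])
  have linPP: "clinear (P n)" for n
    by (simp add: clinear_def P_def linP clinear_simps[OF linA])
  have blP: "bounded_linear (P n)" for n
    unfolding P_def
    by (rule bounded_linear_compose[OF isometry_bounded_linear[OF isoP]])
      (use bounded_linear_adj_isometry[OF isoP, of n] in \<open>simp add: adjP\<close>)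
  have normP: "norm (P n x) = norm ((A1 ^^ n) x)" for n x
    by (simp add: P_def isometry_norm[OF isoP])
  have cinnerP: "cinner (P n x) y = cinner x (P n y)" for n x y
    by (simp add: P_def cinner_adj_isometry[OF isoP, unfolded adjP] cinner_adj_isometry'[OF isoP, unfolded adjP])
  have PP: "P m (P n x) = P n x" if "m \<le> n" for m n x
  proof -
    have "(V1 ^^ n) y = (V1 ^^ m) ((V1 ^^ (n - m)) y)" for y
      using that by (metis comp_apply funpow_add le_add_diff_inverse)
    then show ?thesis by (simp add: P_def cancel)
  qed
  have PV1: "P (Suc n) (V1 x) = V1 (P n x)" for n x by (simp add: P_Suc)
  \<comment> \<open>On \<open>K\<close> the vanishing cross-commutators let \<open>A2\<close>, and
    likewise \<open>V2\<close>, move past the powers of \<open>V1\<close> and \<open>A1\<close>;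
    hence both preserve the ranges of these projections inside \<open>K\<close>.\<close>
  have PA2: "P n (A2 x) = A2 (P n x)" if "x \<in> K" for n x
    using that
  proof (induction n arbitrary: x)
    case (Suc n)
    have "P n (A1 x) \<in> K" using An Suc.prems K_rules by (simp add: P_def)
    then show ?case using Suc.IH[OF K_rules(4)[OF Suc.prems]] c21 by (simp add: P_Suc adj_comm)
  qed (simp add: P_def)
  have PV2: "P n (V2 x) = V2 (P n x)" if "x \<in> K" for n x
    using that
  proof (induction n arbitrary: x)
    case (Suc n)
    show ?case using Suc.IH[OF K_rules(4)[OF Suc.prems]] c12[OF Suc.prems] by (simp add: P_Suc comm)
  qed (simp add: P_def)
  \<comment> \<open>The unitary part of \<open>V1\<close> in its Wold decomposition on
    \<open>K\<close>: the vectors in the range of every power.\<close>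
  define Kus where "Kus = K \<inter> {x. \<forall>n. P n x = x}"
  define Ksu where "Ksu = K \<inter> orth_complement Kus"
  have "closed {x. \<forall>n. P n x = x}"
  proof -
    have "{x. \<forall>n. P n x = x} = (\<Inter>n. {x. P n x = x})" by blast
    moreover have "closed {x. P n x = x}" for n
      by (intro closed_Collect_eq linear_continuous_on blP bounded_linear_ident)
    ultimately show ?thesis by auto
  qed
  then have Kus_cl: "closed_csubspace Kus"
    using K_rules(1) by (auto simp: Kus_def closed_csubspace_def csubspace_def clinear_simps[OF linPP])
  have us_V1A1: "V1 (A1 x) = x" if "x \<in> Kus" for x
  proof -
    have "P (Suc 0) x = x" using that by (simp add: Kus_def)
    then show ?thesis by (simp add: P_def)
  qed
  have Kus_V1: "V1 x \<in> Kus" if x: "x \<in> Kus" for x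
  proof -
    have "P n (V1 x) = V1 x" for n using x by (cases n) (auto simp: Kus_def PV1 P_def[of 0])
    then show ?thesis using x K_rules(2) by (auto simp: Kus_def)
  qed
  have Kus_A1: "A1 x \<in> Kus" if x: "x \<in> Kus" for x
  proof -
    have "P n (A1 x) = A1 x" for n
    proof -
      have "A1 (P (Suc n) x) = P n (A1 x)" by (simp add: P_Suc)
      then show ?thesis using x by (simp add: Kus_def)
    qed
    then show ?thesis using x K_rules(4) by (auto simp: Kus_def)
  qed
  have Kus: "reducing V1 V2 Kus"
    unfolding reducing_def using Kus_cl Kus_V1 Kus_A1
    by (auto simp: Kus_def PA2 PV2 intro: K_rules)
  have Ksu: "reducing V1 V2 Ksu"
    unfolding Ksu_def by (intro reducing_Int K reducing_orth_complement Kus)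
  \<comment> \<open>The decreasing projections \<open>P n x\<close> converge to some
    \<open>y\<close> in \<open>Kus\<close>, which is orthogonal to \<open>x\<close>. But
    \<open>cinner (P n x) x\<close> equals ||P n x||^2 and so tends to both
    \<open>cinner y x\<close> = 0 and ||y||^2; hence y = 0.\<close>
  have su_lim: "(\<lambda>n. (A1 ^^ n) x) \<longlonglongrightarrow> 0" if x: "x \<in> Ksu" for x
  proof -
    have xK: "x \<in> K" using x by (simp add: Ksu_def)
    have re: "Re (cinner (P m x) (P n x)) = (norm (P n x))\<^sup>2" if "m \<le> n" for m n
      by (simp add: norm_sq_cinner cinnerP PP[OF that] PP)
    have diff: "(norm (P m x - P n x))\<^sup>2 = (norm (P m x))\<^sup>2 - (norm (P n x))\<^sup>2" if "m \<le> n" for m n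
      using re[OF that] by (simp add: norm_diff_sq)
    have dec: "decseq (\<lambda>n. (norm (P n x))\<^sup>2)"
    proof (rule decseq_SucI)
      show "(norm (P (Suc n) x))\<^sup>2 \<le> (norm (P n x))\<^sup>2" for n
        using diff[of n "Suc n"] by (metis diff_ge_0_iff_ge le_SucI order_refl zero_le_power2)
    qed
    then have "convergent (\<lambda>n. (norm (P n x))\<^sup>2)"
      using decseq_convergent[of _ 0] unfolding convergent_def by (metis zero_le_power2)
    then have cau: "Cauchy (\<lambda>n. (norm (P n x))\<^sup>2)" by (rule convergent_Cauchy)
    have "Cauchy (\<lambda>n. P n x)"
    proof (rule metric_CauchyI)
      fix e :: real assume e: "e > 0"
      obtain N where N: "\<And>m n. m \<ge> N \<Longrightarrow> n \<ge> N \<Longrightarrow> dist ((norm (P m x))\<^sup>2) ((norm (P n x))\<^sup>2) < e\<^sup>2"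
        using metric_CauchyD[OF cau, of "e\<^sup>2"] e by auto
      have le: "dist (P m x) (P n x) < e" if "N \<le> m" "m \<le> n" for m n
      proof -
        have "(norm (P m x - P n x))\<^sup>2 < e\<^sup>2"
          using N[of m n] that diff[OF that(2)] by (simp add: dist_real_def)
        then show ?thesis using e by (simp add: dist_norm power_less_imp_less_base)
      qed
      show "\<exists>N. \<forall>m\<ge>N. \<forall>n\<ge>N. dist (P m x) (P n x) < e"
        using le by (intro exI[of _ N]) (metis dist_commute nat_le_linear)
    qed
    then obtain y where y: "(\<lambda>n. P n x) \<longlonglongrightarrow> y" using Cauchy_convergent convergent_def by blast
    have Pxn: "P n x \<in> K" for n using An xK by (simp add: P_def)
    have "P m y = y" for m
    proof (rule LIMSEQ_unique[of "\<lambda>n. P m (P (n + m) x)"])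
      show "(\<lambda>n. P m (P (n + m) x)) \<longlonglongrightarrow> P m y"
        by (intro bounded_linear.tendsto[OF blP] LIMSEQ_ignore_initial_segment y)
      show "(\<lambda>n. P m (P (n + m) x)) \<longlonglongrightarrow> y"
        using LIMSEQ_ignore_initial_segment[OF y, of m] by (simp add: PP)
    qed
    moreover have "y \<in> K" by (rule closed_sequentially[OF closed_csubspaceD(2)[OF K_rules(1)] Pxn y])
    ultimately have "y \<in> Kus" by (simp add: Kus_def)
    then have "cinner y x = 0" using x by (simp add: Ksu_def orth_complement_def)
    moreover have "(\<lambda>n. cinner (P n x) x) \<longlonglongrightarrow> cinner y x" by (intro tendsto_cinner y tendsto_const)
    moreover have "cinner (P n x) x = cinner (P n x) (P n x)" for n
      by (simp add: cinnerP PP)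
    moreover have "(\<lambda>n. cinner (P n x) (P n x)) \<longlonglongrightarrow> cinner y y" by (intro tendsto_cinner y)
    ultimately have "y = 0" using LIMSEQ_unique by fastforce
    then have "(\<lambda>n. norm (P n x)) \<longlonglongrightarrow> 0" using tendsto_norm[OF y] by simp
    then show ?thesis by (simp add: normP tendsto_norm_zero_iff)
  qed
  \<comment> \<open>The defect \<open>y\<close> of \<open>V2\<close> lies in the kernel of
    \<open>A2\<close>. For \<open>z\<close> in that kernel and in \<open>Ksu\<close>,
    \<open>z - V1 (A1 z)\<close> belongs to E_1 and therefore vanishes, so \<open>A1\<close>
    preserves the norm along the whole orbit of \<open>y\<close>. Since \<open>A1 ^^ n\<close> tends
    to 0 on \<open>Ksu\<close>, this forces y = 0.\<close>
  have su_V2: "V2 (A2 x) = x" if x: "x \<in> Ksu" for x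
  proof -
    define y where "y = x - V2 (A2 x)"
    have yS: "y \<in> Ksu"
      unfolding y_def by (rule csubspace_diff[OF closed_csubspaceD(1)[OF reducingD(1)[OF Ksu]] x])
        (intro reducingD[OF Ksu] x)
    have yA2: "A2 y = 0" by (simp add: y_def A2_simps)
    have An0: "A2 ((A1 ^^ n) y) = 0" for n
      by (induction n) (simp_all add: yA2 A1_simps flip: adj_comm)
    have inS: "(A1 ^^ n) y \<in> Ksu" for n by (induction n) (auto intro: yS reducingD[OF Ksu])
    have step: "V1 (A1 z) = z" if z: "z \<in> Ksu" "A2 z = 0" for z
    proof -
      have zK: "z \<in> K" using z by (simp add: Ksu_def)
      then have "z - V1 (A1 z) \<in> K"
        by (intro csubspace_diff[OF closed_csubspaceD(1)[OF K_rules(1)]] K_rules)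
      moreover have "A2 (z - V1 (A1 z)) = 0"
        using c21[OF K_rules(4)[OF zK]] z by (simp add: A2_simps V1_simps A1_simps flip: adj_comm)
      ultimately have "z - V1 (A1 z) = 0" by (intro E1) (auto simp: E1_iff A1_simps)
      then show ?thesis by simp
    qed
    have "norm ((A1 ^^ n) y) = norm y" for n
    proof (induction n)
      case (Suc n)
      have "norm (A1 ((A1 ^^ n) y)) = norm ((A1 ^^ n) y)"
        using step[OF inS An0] isometry_norm[OF iso1] by metis
      then show ?case using Suc by simp
    qed simp
    then have "norm y = 0"
      using LIMSEQ_unique[OF tendsto_norm[OF su_lim[OF yS]], of "norm y"] by simp
    then show ?thesis by (simp add: y_def)
  qed
  have dec: "\<exists>a\<in>Kus. \<exists>b\<in>Ksu. x = a + b" if x: "x \<in> K" for x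
  proof -
    obtain m where m: "m \<in> Kus" "x - m \<in> orth_complement Kus"
      using orthogonal_projection_exists[OF Kus_cl] by blast
    then have "x - m \<in> K"
      using x by (intro csubspace_diff[OF closed_csubspaceD(1)[OF K_rules(1)]]) (auto simp: Kus_def)
    then have "x - m \<in> Ksu" using m by (simp add: Ksu_def)
    then show ?thesis using m by (intro bexI[of _ m] bexI[of _ "x - m"]) auto
  qed
  \<comment> \<open>Only the product is assumed to be a shift. On \<open>Kus\<close> the powers of
    \<open>A1\<close> preserve norms, so the decay of (A2 A1)^n is that of
    \<open>A2 ^^ n\<close>.\<close>
  have us_lim: "(\<lambda>n. (A2 ^^ n) x) \<longlonglongrightarrow> 0" if x: "x \<in> Kus" for x
  proof -
    have xn: "(A2 ^^ n) x \<in> Kus" for n by (induction n) (auto intro: x reducingD[OF Kus])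
    have "((A2 \<circ> A1) ^^ n) x = (A1 ^^ n) ((A2 ^^ n) x)" for n
    proof (induction n)
      case (Suc n)
      have "A2 ((A1 ^^ k) z) = (A1 ^^ k) (A2 z)" for k z
        by (induction k) (simp_all flip: adj_comm)
      then show ?case using Suc by (simp flip: adj_comm)
    qed simp
    moreover have "norm ((A1 ^^ n) z) = norm z" if "z \<in> Kus" for n z
      using that by (simp add: Kus_def flip: normP)
    ultimately have "norm (((A2 \<circ> A1) ^^ n) x) = norm ((A2 ^^ n) x)" for n
      using xn by simp
    moreover have "(\<lambda>n. norm (((A2 \<circ> A1) ^^ n) x)) \<longlonglongrightarrow> 0"
      using shift by (auto simp: is_shift_def adj_product intro: tendsto_norm_zero)
    ultimately show ?thesis by (simp only: tendsto_norm_zero_iff)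
  qed
  have "V1 ` Kus = Kus" using us_V1A1 Kus_V1 Kus_A1 by (metis image_eqI image_subsetI subsetI subset_antisym)
  moreover have "V2 ` Ksu = Ksu"
    using su_V2 reducingD[OF Ksu] by (metis image_eqI image_subsetI subsetI subset_antisym)
  moreover have "corth Kus Ksu" by (simp add: corth_def Ksu_def orth_complement_def)
  moreover have "Kus \<subseteq> K" "Ksu \<subseteq> K" by (auto simp: Kus_def Ksu_def)
  ultimately show ?thesis
    unfolding shift_unitary_on_def unitary_on_def shift_on_def
    using cross(1) Kus Ksu dec us_lim su_lim
    by (intro conjI exI[of _ Kus] exI[of _ Ksu]) simp_all
qed

end

section \<open>Consequences of normality of the cross-commutator\<close>

locale normal_cross_pair = commuting_isometries +
  assumes normal: "normal_op (cross_comm V1 V2)"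
begin

lemma normal': "T (T' x) = T' (T x)"
  using normal by (simp add: normal_op_def adj_cross fun_eq_iff)

lemma norm_cross_swap: "norm (T' x) = norm (T x)"
proof -
  have "cinner (T' x) (T' x) = cinner (T x) (T x)"
    by (simp add: cinner_cross normal' commuting_isometries.cinner_cross[OF swap])
  then have "(norm (T' x))\<^sup>2 = (norm (T x))\<^sup>2" unfolding cinner_self_norm of_real_eq_iff .
  then show ?thesis by simp
qed

text \<open>A normal operator and its adjoint have equal norms on each vector, and \<open>T'\<close>
  kills the range of \<open>V1\<close> by \<open>cross_V2\<close> with the roles exchanged.\<close>

lemma cross_V1: "T (V1 x) = 0"
  using norm_cross_swap[of "V1 x"] commuting_isometries.cross_V2[OF swap, of x] by simp

lemma swap_normal: "normal_cross_pair V2 V1"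
proof -
  interpret s: commuting_isometries V2 V1 by (rule swap)
  show ?thesis by unfold_locales (simp add: normal_op_def s.adj_cross normal' fun_eq_iff)
qed

text \<open>The range of \<open>T\<close> is orthogonal to whatever its adjoint \<open>T'\<close>
  annihilates, which by normality includes the ranges of both isometries.\<close>

lemma cross_in_E1: "T x \<in> E1 V1 V2"
proof -
  interpret s: normal_cross_pair V2 V1 by (rule swap_normal)
  have "A1 (T x) = 0" "A2 (T x) = 0"
    by (rule cinner_eqI, simp add: s.cross_V1 s.cross_V2 flip: cinner_A1 cinner_A2 s.cinner_cross)+
  then show ?thesis by (simp add: E1_iff)
qed

lemma cross_swap_in_E1: "T' x \<in> E1 V1 V2"
proof -
  interpret s: normal_cross_pair V2 V1 by (rule swap_normal)
  show ?thesis using s.cross_in_E1 by (simp add: E1_iff s.E1_iff)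
qed

text \<open>\<open>T' (T x)\<close> lies in E_1, so its inner product with \<open>x\<close> is 0;
  that inner product is ||T x||^2.\<close>

lemma cross_orth_E1:
  assumes "x \<in> orth_complement (E1 V1 V2)" shows "T x = 0" "T' x = 0"
proof -
  have "cinner (T' (T x)) x = 0"
    using assms cross_swap_in_E1 by (simp add: orth_complement_def)
  then have "cinner (T x) (T x) = 0"
    by (simp add: commuting_isometries.cinner_cross[OF swap])
  then show "T x = 0" by simp
  then show "T' x = 0" using norm_cross_swap[of x] by simp
qed

section \<open>Cyclic subspaces generated by eigenvectors of the cross-commutator\<close>

definition orbit :: "'a \<Rightarrow> nat \<times> nat \<Rightarrow> 'a" where
  "orbit e p = (V1 ^^ fst p) ((V2 ^^ snd p) e)"

definition cyclic :: "'a \<Rightarrow> 'a set" where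
  "cyclic e = closure (cspan (range (orbit e)))"

lemma funpow_comm: "V2 ((V1 ^^ m) x) = (V1 ^^ m) (V2 x)"
  by (induction m) (simp_all flip: comm)

lemma orbit_0: "orbit e (0, 0) = e"
  and orbit_V1: "V1 (orbit e p) = orbit e (Suc (fst p), snd p)"
  and orbit_V2: "V2 (orbit e p) = orbit e (fst p, Suc (snd p))"
  by (simp_all add: orbit_def funpow_comm)

lemma closed_csubspace_cyclic: "closed_csubspace (cyclic e)"
  unfolding cyclic_def by (rule closed_csubspace_closure_cspan)

lemma orbit_in_cyclic: "orbit e p \<in> cyclic e"
  unfolding cyclic_def by (rule subsetD[OF closure_cspan_superset rangeI])

lemma reducing_contains_cyclic:
  assumes "reducing V1 V2 M" "e \<in> M" shows "cyclic e \<subseteq> M"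
proof -
  have "(V2 ^^ n) e \<in> M" for n by (induction n) (auto intro: assms reducingD[OF assms(1)])
  then have "(V1 ^^ m) ((V2 ^^ n) e) \<in> M" for m n
    by (induction m) (auto intro: reducingD[OF assms(1)])
  then show ?thesis unfolding cyclic_def
    by (intro closure_cspan_least reducingD[OF assms(1)]) (auto simp: orbit_def)
qed

text \<open>Both eigenvalue equations are recorded so that exchanging \<open>V1\<close> and
  \<open>V2\<close> turns an eigenpair for \<mu> into one for \<open>cnj \<mu>\<close>.\<close>

definition eigenpair :: "complex \<Rightarrow> 'a \<Rightarrow> bool" where
  "eigenpair \<mu> e \<longleftrightarrow> e \<in> E1 V1 V2 \<and> T e = scaleC \<mu> e \<and> T' e = scaleC (cnj \<mu>) e"

lemma eigenpair_kernel: "eigenpair \<mu> e \<Longrightarrow> A1 e = 0" "eigenpair \<mu> e \<Longrightarrow> A2 e = 0"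
  by (simp_all add: eigenpair_def E1_iff)

text \<open>Since \<open>T\<close> vanishes on the range of \<open>V1\<close>, \<open>A2\<close>
  commutes past every factor \<open>V1\<close> but the innermost one. There A2 e = 0, so A2 V1 e = T
  e = \<mu> e.\<close>

lemma A2_funpow_V1: "eigenpair \<mu> e \<Longrightarrow> A2 ((V1 ^^ Suc m) e) = scaleC \<mu> ((V1 ^^ m) e)"
proof (induction m)
  case 0
  then show ?case by (auto simp: eigenpair_def cross_comm_def E1_iff V1_simps)
next
  case (Suc m)
  have "A2 (V1 (V1 ((V1 ^^ m) e))) = V1 (A2 (V1 ((V1 ^^ m) e)))"
    using cross_V1[of "(V1 ^^ m) e"] by (simp add: cross_comm_def)
  then show ?case using Suc by (simp add: V1_simps)
qed

lemma A1_funpow_V2: "eigenpair \<mu> e \<Longrightarrow> A1 ((V2 ^^ Suc m) e) = scaleC (cnj \<mu>) ((V2 ^^ m) e)"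
proof -
  interpret s: normal_cross_pair V2 V1 by (rule swap_normal)
  show "eigenpair \<mu> e \<Longrightarrow> A1 ((V2 ^^ Suc m) e) = scaleC (cnj \<mu>) ((V2 ^^ m) e)"
    by (rule s.A2_funpow_V1) (simp add: eigenpair_def s.eigenpair_def E1_iff s.E1_iff)
qed

lemma A1_orbit:
  assumes "eigenpair \<mu> e"
  shows "A1 (orbit e (m, n)) = (if m = 0 then if n = 0 then 0 else scaleC (cnj \<mu>) (orbit e (0, n - 1))
    else orbit e (m - 1, n))"
  using A1_funpow_V2[OF assms, of "n - 1"] eigenpair_kernel[OF assms]
  by (cases m; cases n) (simp_all add: orbit_def)

lemma A2_orbit:
  assumes "eigenpair \<mu> e"
  shows "A2 (orbit e (m, n)) = (if n = 0 then if m = 0 then 0 else scaleC \<mu> (orbit e (m - 1, 0))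
    else orbit e (m, n - 1))"
proof (cases n)
  case 0
  then show ?thesis
    using A2_funpow_V1[OF assms, of "m - 1"] eigenpair_kernel[OF assms] by (cases m) (simp_all add: orbit_def)
next
  case (Suc k)
  then have "orbit e (m, n) = V2 (orbit e (m, k))" by (simp add: orbit_V2)
  then show ?thesis using Suc by simp
qed

text \<open>Each of the four operators sends an orbit vector to a scalar multiple of an orbit
  vector, possibly 0.\<close>

lemma reducing_cyclic:
  assumes "eigenpair \<mu> e" shows "reducing V1 V2 (cyclic e)"
proof -
  note cs = closed_csubspaceD(1)[OF closed_csubspace_cyclic[of e]]
  have inv: "f ` cyclic e \<subseteq> cyclic e"
    if "clinear f" "bounded_linear f" "\<And>m n. f (orbit e (m, n)) \<in> cyclic e" for f
    using that clinear_image_closure_cspan[OF that(1,2) closed_csubspace_cyclic, of "range (orbit e)" e]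
    by (force simp: cyclic_def)
  show ?thesis
    unfolding reducing_def
    by (intro conjI closed_csubspace_cyclic inv isometry_clinear isometry_bounded_linear iso1 iso2
        clinear_adj_isometry bounded_linear_adj_isometry)
      (auto simp: A1_orbit[OF assms] A2_orbit[OF assms] orbit_V1 orbit_V2
        intro!: orbit_in_cyclic csubspace_scaleC[OF cs] csubspace_0[OF cs])
qed

text \<open>The inner products of the orbit of a unit eigenvector. Moving an isometry across the
  inner product lowers the total degree on both sides, so different total degrees are orthogonal;
  within one degree the exponent counts how many factors \<open>V2\<close> are traded for
  \<open>V1\<close>.\<close>

definition gram :: "complex \<Rightarrow> nat \<times> nat \<Rightarrow> nat \<times> nat \<Rightarrow> complex" where
  "gram \<mu> p q = (if fst q + snd q = fst p + snd p
     then if fst p \<le> fst q then \<mu> ^ (fst q - fst p) else cnj \<mu> ^ (fst p - fst q) else 0)"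

text \<open>Induction on the degree of the left vector: a factor is stripped from it and its adjoint
  applied on the right, which is why only the eigenvalue on the right enters. Taking e = e' gives
  the Gram matrix of one orbit, and \<open>cinner e e' = 0\<close> the orthogonality of two.\<close>

lemma cinner_orbit:
  assumes e: "eigenpair \<nu> e" and e': "eigenpair \<mu> e'"
  shows "cinner (orbit e (m, n)) (orbit e' (p, q)) = gram \<mu> (m, n) (p, q) * cinner e e'"
proof (induction "m + n" arbitrary: m n p q rule: less_induct)
  case less
  consider "m = 0" "n = 0" | m' where "m = Suc m'" | n' where "m = 0" "n = Suc n'"
    by (metis not0_implies_Suc)
  then show ?case
  proof cases
    case 1
    consider "p = 0" "q = 0" | p' where "p = Suc p'" | q' where "p = 0" "q = Suc q'"
      by (metis not0_implies_Suc)
    then show ?thesis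
    proof cases
      case 1
      then show ?thesis using \<open>m = 0\<close> \<open>n = 0\<close> by (simp add: gram_def orbit_0)
    next
      case 2
      then have "orbit e' (p, q) = V1 (orbit e' (p', q))" by (simp add: orbit_V1)
      then show ?thesis using 1 2 eigenpair_kernel[OF e] by (simp add: gram_def orbit_0 flip: cinner_A1')
    next
      case 3
      then have "orbit e' (p, q) = V2 (orbit e' (p, q'))" by (simp add: orbit_V2)
      then show ?thesis using 1 3 eigenpair_kernel[OF e] by (simp add: gram_def orbit_0 flip: cinner_A2')
    qed
  next
    case 2
    then have "cinner (orbit e (m, n)) (orbit e' (p, q)) = cinner (orbit e (m', n)) (A1 (orbit e' (p, q)))"
      by (simp add: cinner_A1 flip: orbit_V1[of e "(m', n)", simplified])
    then show ?thesis
      using less[of m' n] 2 unfolding A1_orbit[OF e']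
      by (cases p; cases q) (auto simp: cinner_scaleC_right gram_def Suc_diff_le)
  next
    case 3
    then have "cinner (orbit e (m, n)) (orbit e' (p, q)) = cinner (orbit e (m, n')) (A2 (orbit e' (p, q)))"
      by (simp add: cinner_A2 flip: orbit_V2[of e "(0, n')", simplified])
    then show ?thesis
      using less[of m n'] 3 unfolding A2_orbit[OF e']
      by (cases p; cases q) (auto simp: cinner_scaleC_right gram_def)
  qed
qed

lemma cyclic_orthogonal:
  assumes "eigenpair \<nu> e" "eigenpair \<mu> e'" "cinner e e' = 0"
  shows "corth (cyclic e) (cyclic e')"
proof -
  have "range (orbit e') \<subseteq> orth_complement (range (orbit e))"
    using cinner_orbit[OF assms(1,2)] assms(3) by (auto simp: orth_complement_def)
  then have "cyclic e' \<subseteq> orth_complement (cyclic e)"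
    unfolding cyclic_def orth_complement_closure_cspan
    by (intro closure_cspan_least closed_csubspace_orth_complement)
  then show ?thesis by (auto simp: corth_def orth_complement_def)
qed

text \<open>\<open>x - scaleC t e\<close> is annihilated by both adjoints, hence orthogonal to every
  orbit vector other than \<open>e\<close>; the choice of \<open>t\<close> makes it orthogonal to
  \<open>e\<close> too.\<close>

lemma cyclic_Int_E1:
  assumes e: "eigenpair \<mu> e" "e \<noteq> 0" and x: "x \<in> cyclic e" "x \<in> E1 V1 V2"
  shows "\<exists>t. x = scaleC t e"
proof -
  define t where "t = cinner e x / cinner e e"
  have eH: "e \<in> cyclic e" using orbit_in_cyclic[of e "(0, 0)"] by (simp add: orbit_0)
  have "x - scaleC t e \<in> orth_complement (range (orbit e))"
  proof -
    have "cinner (orbit e (m, n)) (x - scaleC t e) = 0" for m n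
    proof (cases "m = 0 \<and> n = 0")
      case True
      then show ?thesis using e(2) by (simp add: orbit_0 cinner_simps t_def)
    next
      case False
      have A: "A1 (x - scaleC t e) = 0" "A2 (x - scaleC t e) = 0"
        using x(2) eigenpair_kernel[OF e(1)] by (simp_all add: E1_iff A1_simps A2_simps)
      from False consider m' where "m = Suc m'" | n' where "n = Suc n'" by (metis not0_implies_Suc)
      then show ?thesis
      proof cases
        case 1
        then show ?thesis by (simp add: A cinner_A1 flip: orbit_V1[of e "(m', n)", simplified])
      next
        case 2
        then show ?thesis by (simp add: A cinner_A2 flip: orbit_V2[of e "(m, n')", simplified])
      qed
    qed
    then show ?thesis by (auto simp: orth_complement_def)
  qed
  then have "x - scaleC t e \<in> orth_complement (cyclic e)"
    by (simp add: cyclic_def orth_complement_closure_cspan)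
  moreover have "x - scaleC t e \<in> cyclic e"
    using x(1) eH closed_csubspaceD(1)[OF closed_csubspace_cyclic[of e]]
    by (intro csubspace_diff csubspace_scaleC)
  ultimately have "cinner (x - scaleC t e) (x - scaleC t e) = 0" by (simp add: orth_complement_def)
  then have "x = scaleC t e" by simp
  then show ?thesis by blast
qed

text \<open>Split \<open>e\<close> along a reducing \<open>M\<close> and its complement. As both
  parts stay in reducing subspaces, the adjoints annihilate each part separately, so the component
  in \<open>M\<close> lies in E_1 and is a multiple of \<open>e\<close>. If it is 0, the whole
  cyclic space is orthogonal to \<open>M\<close>; otherwise \<open>M\<close> contains
  \<open>e\<close>.\<close>

lemma irreducible_on_cyclic:
  assumes e: "eigenpair \<mu> e" "e \<noteq> 0" shows "irreducible_on V1 V2 (cyclic e)"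
  unfolding irreducible_on_def
proof (intro allI impI)
  fix M assume M: "reducing V1 V2 M \<and> M \<subseteq> cyclic e"
  then have red: "reducing V1 V2 M" by simp
  note redo = reducing_orth_complement[OF red]
  obtain a where a: "a \<in> M" "e - a \<in> orth_complement M"
    using orthogonal_projection_exists[OF reducingD(1)[OF red]] by blast
  have disj: "x = 0" if "x \<in> M" "x \<in> orth_complement M" for x
    using that by (metis (mono_tags, lifting) cinner_self_eq_0 mem_Collect_eq orth_complement_def)
  have neg: "- x \<in> orth_complement M \<Longrightarrow> x \<in> orth_complement M" for x
    by (simp add: orth_complement_def cinner_minus_right)
  have "A1 (e - a) = - A1 a" "A2 (e - a) = - A2 a"
    using eigenpair_kernel[OF e(1)] by (simp_all add: A1_simps A2_simps)
  then have "A1 a = 0" "A2 a = 0"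
    using a reducingD(4,5)[OF redo a(2)] by (auto intro!: disj reducingD[OF red] neg)
  then have "a \<in> E1 V1 V2" by (simp add: E1_iff)
  then obtain t where t: "a = scaleC t e" using cyclic_Int_E1[OF e] a M by blast
  show "M = {0} \<or> M = cyclic e"
  proof (cases "t = 0")
    case True
    then have "cyclic e \<subseteq> orth_complement M"
      using a(2) t by (intro reducing_contains_cyclic redo) simp
    then have "M \<subseteq> {0}" using M disj by blast
    then show ?thesis using csubspace_0[OF closed_csubspaceD(1)[OF reducingD(1)[OF red]]] by blast
  next
    case False
    then have "e = scaleC (1 / t) a" by (simp add: t scaleC_scaleC scaleC_one)
    then have "e \<in> M"
      using a(1) csubspace_scaleC[OF closed_csubspaceD(1)[OF reducingD(1)[OF red]]] by metis
    then show ?thesis using reducing_contains_cyclic[OF red] M by blast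
  qed
qed

end

section \<open>The orthogonal decomposition\<close>

text \<open>A maximal orthonormal set of eigenvectors is complete in E_1: its complement there is
  invariant under \<open>T\<close> and \<open>T'\<close>, so if nonzero it would contain a further
  eigenvector. Separability makes the set countable, hence indexable by the positive integers up to
  the dimension.\<close>

lemma (in normal_cross_pair) eigenbasis_exists:
  fixes D :: "'a set"
  assumes compact: "compact_op T" and separable: "countable D" "closure D = UNIV"
  obtains e \<mu> where
    "\<And>i. 1 \<le> i \<Longrightarrow> enat i \<le> hdim (E1 V1 V2) \<Longrightarrow> eigenpair (\<mu> i) (e i) \<and> norm (e i) = 1"
    "\<And>i j. 1 \<le> i \<Longrightarrow> enat i \<le> hdim (E1 V1 V2) \<Longrightarrow> 1 \<le> j \<Longrightarrow> enat j \<le> hdim (E1 V1 V2) \<Longrightarrow>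
       i \<noteq> j \<Longrightarrow> cinner (e i) (e j) = 0"
    "\<And>x. x \<in> E1 V1 V2 \<Longrightarrow> (\<And>i. 1 \<le> i \<Longrightarrow> enat i \<le> hdim (E1 V1 V2) \<Longrightarrow> cinner (e i) x = 0) \<Longrightarrow> x = 0"
proof -
  interpret s: normal_cross_pair V2 V1 by (rule swap_normal)
  have cpt: "\<exists>r l. strict_mono r \<and> (\<lambda>n. T (f (r n))) \<longlonglongrightarrow> l" if f: "\<And>n. norm (f n) \<le> 1" for f :: "nat \<Rightarrow> 'a"
  proof -
    have sc: "seq_compact (closure (T ` cball 0 1))"
      using compact compact_imp_seq_compact by (auto simp: compact_op_def)
    have mem: "\<forall>n. T (f n) \<in> closure (T ` cball 0 1)"
      using f by (intro allI subsetD[OF closure_subset] imageI) simp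
    obtain l r where "strict_mono r" "((\<lambda>n. T (f n)) \<circ> r) \<longlonglongrightarrow> l"
      using seq_compactE[OF sc mem] by blast
    then show ?thesis by (auto simp: o_def)
  qed
  obtain B where B: "B \<subseteq> {x. \<exists>\<mu>. eigenpair \<mu> x}" "orthonormal B"
    and mx: "\<And>x. x \<in> {x. \<exists>\<mu>. eigenpair \<mu> x} \<Longrightarrow> norm x = 1 \<Longrightarrow> \<exists>b\<in>B. cinner b x \<noteq> 0"
    using maximal_orthonormal_subset[of "{x. \<exists>\<mu>. eigenpair \<mu> x}"] by blast
  have BE: "B \<subseteq> E1 V1 V2" using B(1) by (auto simp: eigenpair_def)
  define M where "M = E1 V1 V2 \<inter> orth_complement B"
  have M: "closed_csubspace M"
    using closed_csubspace_E1 closed_csubspace_orth_complement[of B]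
    by (auto simp: M_def closed_csubspace_def csubspace_def)
  have TM: "T ` M \<subseteq> M" "T' ` M \<subseteq> M"
  proof -
    have "cinner b (T x) = 0" "cinner b (T' x) = 0" if "x \<in> M" "b \<in> B" for b x
    proof -
      obtain \<mu> where "eigenpair \<mu> b" using B(1) \<open>b \<in> B\<close> by blast
      then show "cinner b (T x) = 0" "cinner b (T' x) = 0"
        using that by (simp_all add: M_def orth_complement_def eigenpair_def cinner_scaleC_left
            flip: cinner_cross s.cinner_cross)
    qed
    then show "T ` M \<subseteq> M" "T' ` M \<subseteq> M"
      using cross_in_E1 cross_swap_in_E1 by (auto simp: M_def orth_complement_def)
  qed
  have complete: "x = 0" if "x \<in> E1 V1 V2" "x \<in> orth_complement B" for x
  proof (rule ccontr)
    assume "x \<noteq> 0"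
    then have "\<exists>x\<in>M. x \<noteq> 0" using that by (auto simp: M_def)
    then obtain y \<mu> where y: "y \<in> M" "y \<noteq> 0" "T y = scaleC \<mu> y" "T' y = scaleC (cnj \<mu>) y"
      using compact_normal_common_eigenvector[OF clinear_cross s.clinear_cross cross_bound cinner_cross normal' M TM _ cpt]
      by blast
    define u where "u = scaleC (complex_of_real (1 / norm y)) y"
    have uM: "u \<in> M" using y(1) closed_csubspaceD(1)[OF M] by (simp add: u_def csubspace_scaleC)
    moreover have "norm u = 1" using y(2) by (simp add: u_def norm_scaleC norm_divide)
    moreover have "eigenpair \<mu> u" using uM y
      by (simp add: eigenpair_def M_def u_def clinear_scaleC[OF clinear_cross] clinear_scaleC[OF s.clinear_cross]
          scaleC_scaleC mult.commute)
    ultimately show False using mx[of u] by (auto simp: M_def orth_complement_def)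
  qed
  have dim: "hdim (E1 V1 V2) = (if finite B then enat (card B) else \<infinity>)"
    by (rule hdim_orthonormal_basis[OF closed_csubspaceD(1)[OF closed_csubspace_E1] BE B(2) complete])
  define I where "I = {i. 1 \<le> i \<and> enat i \<le> hdim (E1 V1 V2)}"
  have "\<exists>e. bij_betw e I B"
  proof (cases "finite B")
    case True
    then have "I = {1..card B}" by (auto simp: I_def dim)
    then show ?thesis using ex_bij_betw_nat_finite_1[OF True] by simp
  next
    case False
    then have "bij_betw (from_nat_into B) UNIV B"
      using orthonormal_countable[OF B(2) separable] by (rule bij_betw_from_nat_into[rotated])
    \<comment> \<open>In the infinite case the index set is all positive integers, whereas the
      enumeration of \<open>B\<close> starts at 0.\<close>
    moreover have "bij_betw (\<lambda>i. i - 1) I UNIV"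
      using False by (intro bij_betw_byWitness[of _ Suc]) (auto simp: I_def dim)
    ultimately show ?thesis using bij_betw_trans by blast
  qed
  then obtain e where e: "bij_betw e I B" by blast
  have eB: "e i \<in> B" if "1 \<le> i" "enat i \<le> hdim (E1 V1 V2)" for i
    using e that by (auto simp: I_def bij_betw_def)
  define \<mu> where "\<mu> i = (SOME \<mu>. eigenpair \<mu> (e i))" for i
  have 1: "eigenpair (\<mu> i) (e i) \<and> norm (e i) = 1" if "1 \<le> i" "enat i \<le> hdim (E1 V1 V2)" for i
    unfolding \<mu>_def using eB[OF that] B by (auto simp: orthonormal_def intro: someI)
  have 2: "cinner (e i) (e j) = 0"
    if "1 \<le> i" "enat i \<le> hdim (E1 V1 V2)" "1 \<le> j" "enat j \<le> hdim (E1 V1 V2)" "i \<noteq> j" for i j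
  proof -
    have "e i \<noteq> e j"
      using inj_onD[OF bij_betw_imp_inj_on[OF e], of i j] that by (auto simp: I_def)
    then show ?thesis using B(2) eB[OF that(1,2)] eB[OF that(3,4)] by (simp add: orthonormal_def)
  qed
  have 3: "x = 0" if "x \<in> E1 V1 V2" "\<And>i. 1 \<le> i \<Longrightarrow> enat i \<le> hdim (E1 V1 V2) \<Longrightarrow> cinner (e i) x = 0" for x
    using e that by (intro complete) (auto simp: orth_complement_def bij_betw_def I_def)
  show ?thesis by (rule that[of \<mu> e]) (fact 1, fact 2, fact 3)
qed

lemma (in normal_cross_pair) cyclic_decomposition:
  fixes D :: "'a set"
  assumes compact: "compact_op T" and separable: "countable D" "closure D = UNIV"
    and shift: "is_shift (V1 \<circ> V2)"
  obtains H e \<mu> where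
    "\<And>i. reducing V1 V2 (H i)" "\<And>i j. i \<noteq> j \<Longrightarrow> corth (H i) (H j)"
    "closure (cspan (\<Union>i. H i)) = UNIV" "\<And>i. 1 \<le> i \<Longrightarrow> hdim (E1 V1 V2) < enat i \<Longrightarrow> H i = {0}"
    "shift_unitary_on V1 V2 (H 0)"
    "\<And>i. 1 \<le> i \<Longrightarrow> enat i \<le> hdim (E1 V1 V2) \<Longrightarrow>
      eigenpair (\<mu> i) (e i) \<and> norm (e i) = 1 \<and> H i = cyclic (e i)"
proof -
  define I where "I = {i. 1 \<le> i \<and> enat i \<le> hdim (E1 V1 V2)}"
  obtain e \<mu> where e: "\<And>i. i \<in> I \<Longrightarrow> eigenpair (\<mu> i) (e i) \<and> norm (e i) = 1"
    and orth: "\<And>i j. i \<in> I \<Longrightarrow> j \<in> I \<Longrightarrow> i \<noteq> j \<Longrightarrow> cinner (e i) (e j) = 0"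
    and complete: "\<And>x. x \<in> E1 V1 V2 \<Longrightarrow> (\<And>i. i \<in> I \<Longrightarrow> cinner (e i) x = 0) \<Longrightarrow> x = 0"
  proof (rule eigenbasis_exists[OF compact separable])
    fix e \<mu>
    assume *: "\<And>i. 1 \<le> i \<Longrightarrow> enat i \<le> hdim (E1 V1 V2) \<Longrightarrow> eigenpair (\<mu> i) (e i) \<and> norm (e i) = 1"
      "\<And>i j. 1 \<le> i \<Longrightarrow> enat i \<le> hdim (E1 V1 V2) \<Longrightarrow> 1 \<le> j \<Longrightarrow> enat j \<le> hdim (E1 V1 V2) \<Longrightarrow>
         i \<noteq> j \<Longrightarrow> cinner (e i) (e j) = 0"
      "\<And>x. x \<in> E1 V1 V2 \<Longrightarrow> (\<And>i. 1 \<le> i \<Longrightarrow> enat i \<le> hdim (E1 V1 V2) \<Longrightarrow> cinner (e i) x = 0) \<Longrightarrow> x = 0"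
    show thesis by (rule that[of \<mu> e]) (use * in \<open>auto simp: I_def\<close>)
  qed
  define U where "U = (\<Union>i\<in>I. cyclic (e i))"
  define H where "H i = (if i = 0 then orth_complement U else if i \<in> I then cyclic (e i) else {0})" for i
  have I0: "0 \<notin> I" by (simp add: I_def)
  have cyc: "reducing V1 V2 (cyclic (e i))" if "i \<in> I" for i
    using e[OF that] reducing_cyclic by blast
  have red0: "reducing V1 V2 (orth_complement U)"
    using cyc unfolding U_def by (intro reducing_orth_complement_invariant) (auto dest: reducingD)
  have "reducing V1 V2 {0}"
    by (simp add: reducing_def closed_csubspace_def csubspace_def V1_simps V2_simps A1_simps A2_simps)
  then have red: "reducing V1 V2 (H i)" for i using red0 cyc by (simp add: H_def)
  have corth_H: "corth (H i) (H j)" if "i \<noteq> j" for i j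
  proof -
    have sym: "corth S S' \<Longrightarrow> corth S' S" for S S' :: "'a set"
      unfolding corth_def using cinner_eq_0_commute by blast
    have 0: "corth (H i) (H 0)" if "i \<noteq> 0" for i
      using that by (auto simp: H_def corth_def U_def orth_complement_def)
    show ?thesis
    proof (cases "i = 0 \<or> j = 0")
      case True
      then show ?thesis using 0 sym that by metis
    next
      case False
      show ?thesis
      proof (cases "i \<in> I \<and> j \<in> I")
        case True
        then show ?thesis using False that e orth cyclic_orthogonal by (metis H_def)
      qed (use False in \<open>auto simp: H_def corth_def\<close>)
    qed
  qed
  have eU: "e i \<in> U" if "i \<in> I" for i
    using that orbit_in_cyclic[of "e i" "(0, 0)"] by (auto simp: U_def orbit_0)
  \<comment> \<open>The projection of \<open>x\<close> to E_1 is orthogonal to every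
    \<open>e i\<close>, hence 0 by completeness of the eigenbasis.\<close>
  have E1orth: "x \<in> orth_complement (E1 V1 V2)" if x: "x \<in> orth_complement U" for x
  proof -
    obtain m where m: "m \<in> E1 V1 V2" "x - m \<in> orth_complement (E1 V1 V2)"
      using orthogonal_projection_exists[OF closed_csubspace_E1] by blast
    have "m = 0"
    proof (rule complete[OF m(1)])
      fix i assume i: "i \<in> I"
      then have "cinner (e i) x = 0" "cinner (e i) (x - m) = 0"
        using x m(2) eU e by (auto simp: orth_complement_def eigenpair_def)
      then show "cinner (e i) m = 0" by (simp add: cinner_diff_right)
    qed
    then show ?thesis using m by simp
  qed
  have su: "shift_unitary_on V1 V2 (H 0)"
  proof (rule shift_unitary_onI[OF red])
    show "x \<in> H 0 \<Longrightarrow> T x = 0" "x \<in> H 0 \<Longrightarrow> T' x = 0" for x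
      using E1orth cross_orth_E1 by (simp_all add: H_def)
    show "x = 0" if "x \<in> H 0" "x \<in> E1 V1 V2" for x
    proof -
      have "cinner x x = 0" using that E1orth[of x] by (auto simp: H_def orth_complement_def)
      then show ?thesis by simp
    qed
  qed (rule shift)
  have dense: "closure (cspan (\<Union>i. H i)) = UNIV"
  proof (rule closed_csubspace_eq_if_complement_trivial[OF closed_csubspace_closure_cspan])
    fix x assume "x \<in> orth_complement (closure (cspan (\<Union>i. H i)))"
    then have x: "x \<in> orth_complement (\<Union>i. H i)" by (simp add: orth_complement_closure_cspan)
    have "H i = cyclic (e i)" if "i \<in> I" for i using that I0 by (auto simp: H_def)
    then have "U \<subseteq> (\<Union>i. H i)" unfolding U_def by blast
    then have "x \<in> orth_complement U" using x unfolding orth_complement_def by blast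
    then have "x \<in> H 0" by (simp add: H_def)
    then have "cinner x x = 0" using x unfolding orth_complement_def by blast
    then show "x = 0" by simp
  qed (auto simp: csubspace_def)
  have zero: "H i = {0}" if "1 \<le> i" "hdim (E1 V1 V2) < enat i" for i
    using that by (auto simp: H_def I_def)
  have cyclic: "eigenpair (\<mu> i) (e i) \<and> norm (e i) = 1 \<and> H i = cyclic (e i)"
    if "1 \<le> i" "enat i \<le> hdim (E1 V1 V2)" for i
    using that e[of i] by (auto simp: H_def I_def)
  show ?thesis by (rule that[OF red corth_H dense zero su cyclic])
qed

lemma compact_normal_pair_normal_cross_pair:
  fixes V1 V2 :: "'a::{complex_inner, complete_space} \<Rightarrow> 'a"
  assumes "compact_normal_pair V1 V2" shows "normal_cross_pair V1 V2"
  using assms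
  by unfold_locales (auto simp: compact_normal_pair_def BCL_pair_def isometric_pair_def fun_eq_iff)

text \<open>On E_1 the term V1 A2 e vanishes, so \<mu> e = A2 V1 e is the image of \<open>e\<close>
  under a contraction.\<close>

lemma (in normal_cross_pair) eigenvalue_norm_le:
  assumes "eigenpair \<mu> e" "norm e = 1" shows "cmod \<mu> \<le> 1"
proof -
  have "scaleC \<mu> e = A2 (V1 e)"
    using assms(1) by (auto simp: eigenpair_def E1_iff cross_comm_def V1_simps)
  then have "cmod \<mu> = norm (A2 (V1 e))" using assms(2) norm_scaleC[of \<mu> e] by simp
  also have "\<dots> \<le> norm (V1 e)" by (rule norm_adj_isometry_le[OF iso2])
  finally show ?thesis using assms(2) by (simp add: isometry_norm[OF iso1])
qed

section \<open>Square-integrable functions\<close>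

lemma borel_measurable_cnj [measurable (raw)]:
  "f \<in> borel_measurable M \<Longrightarrow> (\<lambda>x. cnj (f x)) \<in> borel_measurable M"
  by (rule borel_measurable_continuous_on[of cnj]) (intro continuous_intros)

lemma L2D: "f \<in> L2 M \<Longrightarrow> f \<in> borel_measurable M" "f \<in> L2 M \<Longrightarrow> integrable M (\<lambda>x. (cmod (f x))\<^sup>2)"
  by (simp_all add: L2_def)

lemma L2_dominated:
  assumes "f \<in> borel_measurable M" "integrable M h" "AE x in M. (cmod (f x))\<^sup>2 \<le> h x"
  shows "f \<in> L2 M"
proof -
  have "integrable M (\<lambda>x. (cmod (f x))\<^sup>2)"
    by (rule Bochner_Integration.integrable_bound[OF assms(2)]) (use assms in auto)
  then show ?thesis using assms(1) by (simp add: L2_def)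
qed

lemma L2_AE_eq: "f \<in> L2 M \<Longrightarrow> g \<in> borel_measurable M \<Longrightarrow> AE x in M. g x = f x \<Longrightarrow> g \<in> L2 M"
  by (rule L2_dominated[of _ _ "\<lambda>x. (cmod (f x))\<^sup>2"]) (auto simp: L2_def)

lemma norm_add_sq_le: "(norm (a + b))\<^sup>2 \<le> 2 * (norm a)\<^sup>2 + 2 * (norm b)\<^sup>2" for a b :: complex
proof -
  have "(norm (a + b))\<^sup>2 \<le> (norm a + norm b)\<^sup>2" by (intro power_mono norm_triangle_ineq) simp
  also have "\<dots> \<le> 2 * (norm a)\<^sup>2 + 2 * (norm b)\<^sup>2"
    using sum_squares_bound[of "norm a" "norm b"] by (simp add: power2_sum)
  finally show ?thesis .
qed

lemma L2_add: "f \<in> L2 M \<Longrightarrow> g \<in> L2 M \<Longrightarrow> (\<lambda>x. f x + g x) \<in> L2 M"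
  by (rule L2_dominated[of _ _ "\<lambda>x. 2 * (cmod (f x))\<^sup>2 + 2 * (cmod (g x))\<^sup>2"])
    (auto simp: L2_def norm_add_sq_le)

lemma L2_mult:
  assumes "f \<in> L2 M" "t \<in> borel_measurable M" "AE x in M. cmod (t x) \<le> C"
  shows "(\<lambda>x. t x * f x) \<in> L2 M"
proof (rule L2_dominated[of _ _ "\<lambda>x. C\<^sup>2 * (cmod (f x))\<^sup>2"])
  show "AE x in M. (cmod (t x * f x))\<^sup>2 \<le> C\<^sup>2 * (cmod (f x))\<^sup>2"
    using assms(3) by (auto simp: norm_mult power_mult_distrib intro!: mult_right_mono power_mono)
qed (use assms in \<open>auto simp: L2_def\<close>)

lemma L2_cmult: "f \<in> L2 M \<Longrightarrow> (\<lambda>x. c * f x) \<in> L2 M"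
  by (rule L2_mult[where C = "cmod c"]) auto

lemma L2_diff: "f \<in> L2 M \<Longrightarrow> g \<in> L2 M \<Longrightarrow> (\<lambda>x. f x - g x) \<in> L2 M"
  using L2_add[of f M "\<lambda>x. - 1 * g x"] L2_cmult[of g M "- 1"] by simp

lemma L2_0: "(\<lambda>x. 0) \<in> L2 M"
  by (simp add: L2_def)

lemma L2_inner_integrable:
  assumes "f \<in> L2 M" "g \<in> L2 M" shows "integrable M (\<lambda>x. cnj (f x) * g x)"
proof (rule Bochner_Integration.integrable_bound[of _ "\<lambda>x. (cmod (f x))\<^sup>2 + (cmod (g x))\<^sup>2"])
  have "a * b \<le> a\<^sup>2 + b\<^sup>2" if "a \<ge> 0" "b \<ge> 0" for a b :: real
    using sum_squares_bound[of a b] mult_nonneg_nonneg[OF that] by linarith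
  then show "AE x in M. norm (cnj (f x) * g x) \<le> norm ((cmod (f x))\<^sup>2 + (cmod (g x))\<^sup>2)"
    by (auto simp: norm_mult)
qed (use assms in \<open>auto simp: L2_def intro!: borel_measurable_times borel_measurable_cnj\<close>)

lemma l2inner_add_left: "f \<in> L2 M \<Longrightarrow> g \<in> L2 M \<Longrightarrow> h \<in> L2 M \<Longrightarrow>
    l2inner M (\<lambda>x. f x + g x) h = l2inner M f h + l2inner M g h"
  by (simp add: l2inner_def distrib_right L2_inner_integrable)

lemma l2inner_add_right: "f \<in> L2 M \<Longrightarrow> g \<in> L2 M \<Longrightarrow> h \<in> L2 M \<Longrightarrow>
    l2inner M h (\<lambda>x. f x + g x) = l2inner M h f + l2inner M h g"
  by (simp add: l2inner_def distrib_left L2_inner_integrable)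

lemma l2inner_cmult_left: "l2inner M (\<lambda>x. c * f x) g = cnj c * l2inner M f g"
  by (simp add: l2inner_def mult.assoc)

lemma l2inner_cmult_right: "l2inner M f (\<lambda>x. c * g x) = c * l2inner M f g"
  by (simp add: l2inner_def mult.left_commute)

lemma l2inner_diff_left: "f \<in> L2 M \<Longrightarrow> g \<in> L2 M \<Longrightarrow> h \<in> L2 M \<Longrightarrow>
    l2inner M (\<lambda>x. f x - g x) h = l2inner M f h - l2inner M g h"
  by (simp add: l2inner_def left_diff_distrib L2_inner_integrable)

lemma l2inner_diff_right: "f \<in> L2 M \<Longrightarrow> g \<in> L2 M \<Longrightarrow> h \<in> L2 M \<Longrightarrow>
    l2inner M h (\<lambda>x. f x - g x) = l2inner M h f - l2inner M h g"
  by (simp add: l2inner_def right_diff_distrib L2_inner_integrable)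

lemma l2inner_0: "l2inner M (\<lambda>x. 0) f = 0" "l2inner M f (\<lambda>x. 0) = 0"
  by (simp_all add: l2inner_def)

lemma l2inner_commute: "l2inner M f g = cnj (l2inner M g f)"
  unfolding l2inner_def by (subst Bochner_Integration.integral_cnj[symmetric]) (simp add: mult.commute)

lemma l2norm_nonneg [simp]: "l2norm M f \<ge> 0"
  by (simp add: l2norm_def)

lemma l2norm_sq: "(l2norm M f)\<^sup>2 = (\<integral>x. (cmod (f x))\<^sup>2 \<partial>M)"
  by (simp add: l2norm_def)

lemma l2inner_self: "l2inner M f f = complex_of_real ((l2norm M f)\<^sup>2)"
  unfolding l2norm_sq l2inner_def integral_complex_of_real[symmetric]
  by (rule Bochner_Integration.integral_cong) (simp_all add: complex_norm_square mult.commute del: of_real_power)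

lemma l2norm_cong_AE:
  assumes "AE x in M. f x = g x" "f \<in> borel_measurable M" "g \<in> borel_measurable M"
  shows "l2norm M f = l2norm M g"
  unfolding l2norm_def using assms by (intro arg_cong[of _ _ sqrt] integral_cong_AE) auto

lemma l2norm_eq_0:
  assumes "f \<in> L2 M" "l2norm M f = 0" shows "AE x in M. f x = 0"
proof -
  have "(\<integral>x. (cmod (f x))\<^sup>2 \<partial>M) = 0" using assms(2) l2norm_sq[of M f] by simp
  then have "AE x in M. (cmod (f x))\<^sup>2 = 0"
    using integral_nonneg_eq_0_iff_AE[OF L2D(2)[OF assms(1)]] by simp
  then show ?thesis by simp
qed

text \<open>The inequality u v \<le> (t u^2 + v^2 / t) / 2 is integrated and used at the optimal t =
  ||g|| / ||f||. With moduli inside the integral it also bounds L^1 norms, as needed for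
  completeness.\<close>

lemma L2_abs_product_le:
  assumes "f \<in> L2 M" "g \<in> L2 M"
  shows "integrable M (\<lambda>x. cmod (f x) * cmod (g x))"
    "(\<integral>x. cmod (f x) * cmod (g x) \<partial>M) \<le> l2norm M f * l2norm M g"
proof -
  define a where "a = l2norm M f"
  define b where "b = l2norm M g"
  show int: "integrable M (\<lambda>x. cmod (f x) * cmod (g x))"
    using integrable_norm[OF L2_inner_integrable[OF assms]] by (simp add: norm_mult)
  have ab: "a \<ge> 0" "b \<ge> 0" by (simp_all add: a_def b_def)
  have bound: "(\<integral>x. cmod (f x) * cmod (g x) \<partial>M) \<le> (t * a\<^sup>2 + b\<^sup>2 / t) / 2" if t: "t > 0" for t
  proof -
    have pt: "u * v \<le> (t * u\<^sup>2 + v\<^sup>2 / t) / 2" for u v :: real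
    proof -
      have "2 * (u * v) * t \<le> (t * u)\<^sup>2 + v\<^sup>2" using sum_squares_bound[of "t * u" v] by (simp add: ac_simps)
      then show ?thesis using t by (simp add: field_simps power2_eq_square)
    qed
    have "(\<integral>x. cmod (f x) * cmod (g x) \<partial>M) \<le> (\<integral>x. (t * (cmod (f x))\<^sup>2 + (cmod (g x))\<^sup>2 / t) / 2 \<partial>M)"
      using assms by (intro integral_mono int pt) (auto simp: L2_def)
    also have "\<dots> = (t * a\<^sup>2 + b\<^sup>2 / t) / 2"
      using assms by (simp add: L2_def a_def b_def l2norm_sq)
    finally show ?thesis .
  qed
  have "(\<integral>x. cmod (f x) * cmod (g x) \<partial>M) \<le> a * b"
  proof (cases "a = 0 \<or> b = 0")
    case True
    then have "AE x in M. cmod (f x) * cmod (g x) = 0"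
      using l2norm_eq_0[OF assms(1)] l2norm_eq_0[OF assms(2)] by (auto simp: a_def b_def)
    then have "(\<integral>x. cmod (f x) * cmod (g x) \<partial>M) = 0"
      using assms by (subst integral_cong_AE[of _ _ "\<lambda>_. 0"]) (auto simp: L2_def)
    then show ?thesis using ab by simp
  next
    case False
    then have "a > 0" "b > 0" using ab by auto
    then show ?thesis using bound[of "b / a"] by (simp add: power2_eq_square)
  qed
  then show "(\<integral>x. cmod (f x) * cmod (g x) \<partial>M) \<le> l2norm M f * l2norm M g" by (simp add: a_def b_def)
qed

lemma l2inner_cauchy_schwarz:
  assumes "f \<in> L2 M" "g \<in> L2 M" shows "cmod (l2inner M f g) \<le> l2norm M f * l2norm M g"
proof -
  have "cmod (l2inner M f g) \<le> (\<integral>x. norm (cnj (f x) * g x) \<partial>M)"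
    unfolding l2inner_def by (rule integral_norm_bound)
  also have "\<dots> \<le> l2norm M f * l2norm M g" using L2_abs_product_le(2)[OF assms] by (simp add: norm_mult)
  finally show ?thesis .
qed

lemma l2norm_add_sq:
  assumes "f \<in> L2 M" "g \<in> L2 M"
  shows "(l2norm M (\<lambda>x. f x + g x))\<^sup>2 = (l2norm M f)\<^sup>2 + (l2norm M g)\<^sup>2 + 2 * Re (l2inner M f g)"
proof -
  have "Re (l2inner M g f) = Re (l2inner M f g)" using l2inner_commute[of M f g] by simp
  moreover have "complex_of_real ((l2norm M (\<lambda>x. f x + g x))\<^sup>2) =
      l2inner M f f + l2inner M f g + (l2inner M g f + l2inner M g g)"
    unfolding l2inner_self[symmetric]
    by (simp add: l2inner_add_left l2inner_add_right L2_add assms)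
  then have "Re (complex_of_real ((l2norm M (\<lambda>x. f x + g x))\<^sup>2)) =
      Re (l2inner M f f + l2inner M f g + (l2inner M g f + l2inner M g g))" by simp
  ultimately show ?thesis by (simp add: l2inner_self del: of_real_power)
qed

lemma l2norm_triangle:
  assumes "f \<in> L2 M" "g \<in> L2 M"
  shows "l2norm M (\<lambda>x. f x + g x) \<le> l2norm M f + l2norm M g"
proof -
  have "(l2norm M (\<lambda>x. f x + g x))\<^sup>2 \<le> (l2norm M f + l2norm M g)\<^sup>2"
    using l2inner_cauchy_schwarz[OF assms] complex_Re_le_cmod[of "l2inner M f g"]
    by (simp add: l2norm_add_sq[OF assms] power2_sum)
  then show ?thesis by (rule power2_le_imp_le) simp
qed

lemma l2norm_cmult: "l2norm M (\<lambda>x. c * f x) = cmod c * l2norm M f"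
  by (simp add: l2norm_def norm_mult power_mult_distrib real_sqrt_mult)

lemma l2norm_minus_commute: "l2norm M (\<lambda>x. f x - g x) = l2norm M (\<lambda>x. g x - f x)"
  by (simp add: l2norm_def norm_minus_commute)

lemma l2norm_triangle_diff:
  assumes "f \<in> L2 M" "g \<in> L2 M" "h \<in> L2 M"
  shows "l2norm M (\<lambda>x. f x - h x) \<le> l2norm M (\<lambda>x. f x - g x) + l2norm M (\<lambda>x. g x - h x)"
  using l2norm_triangle[OF L2_diff[OF assms(1,2)] L2_diff[OF assms(2,3)]] by simp

lemma l2norm_mult_le:
  assumes "f \<in> L2 M" "t \<in> borel_measurable M" "AE x in M. cmod (t x) \<le> C" "C \<ge> 0"
  shows "l2norm M (\<lambda>x. t x * f x) \<le> C * l2norm M f"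
proof -
  have "(\<integral>x. (cmod (t x * f x))\<^sup>2 \<partial>M) \<le> (\<integral>x. C\<^sup>2 * (cmod (f x))\<^sup>2 \<partial>M)"
    using assms L2D(2)[OF L2_mult[OF assms(1-3)]] L2D(2)[OF assms(1)]
    by (intro integral_mono_AE) (auto simp: norm_mult power_mult_distrib intro!: mult_right_mono power_mono)
  then have "(l2norm M (\<lambda>x. t x * f x))\<^sup>2 \<le> (C * l2norm M f)\<^sup>2"
    by (simp add: l2norm_sq power_mult_distrib)
  then show ?thesis by (rule power2_le_imp_le) (use assms in auto)
qed

text \<open>Riesz-Fischer. A subsequence with increments below (1/2)^k converges almost everywhere:
  finiteness of the measure turns the L^2 bounds on the increments into summable L^1 bounds.\<close>

lemma L2_complete:
  assumes fin: "finite_measure M" and f: "\<And>n. f n \<in> L2 M"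
    and cauchy: "\<And>e. e > 0 \<Longrightarrow> \<exists>N. \<forall>m\<ge>N. \<forall>n\<ge>N. l2norm M (\<lambda>x. f m x - f n x) < e"
  obtains g where "g \<in> L2 M" "(\<lambda>n. l2norm M (\<lambda>x. f n x - g x)) \<longlonglongrightarrow> 0"
proof -
  interpret finite_measure M by (rule fin)
  note [measurable] = L2D(1)[OF f]
  have "\<exists>r::nat \<Rightarrow> nat. \<forall>k. (\<forall>m\<ge>r k. \<forall>n\<ge>r k. l2norm M (\<lambda>x. f m x - f n x) < (1/2)^k) \<and> r k < r (Suc k)"
  proof (rule dependent_nat_choice)
    show "\<exists>N. \<forall>m\<ge>N. \<forall>n\<ge>N. l2norm M (\<lambda>x. f m x - f n x) < (1/2)^0" using cauchy[of 1] by simp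
  next
    fix x k
    obtain N where N: "\<forall>m\<ge>N. \<forall>n\<ge>N. l2norm M (\<lambda>x. f m x - f n x) < (1/2)^Suc k"
      using cauchy[of "(1/2)^Suc k"] by auto
    show "\<exists>y. (\<forall>m\<ge>y. \<forall>n\<ge>y. l2norm M (\<lambda>x. f m x - f n x) < (1/2)^Suc k) \<and> x < y"
      by (rule exI[of _ "max N (Suc x)"]) (use N in auto)
  qed
  then obtain r where r: "\<And>k m n. m \<ge> r k \<Longrightarrow> n \<ge> r k \<Longrightarrow> l2norm M (\<lambda>x. f m x - f n x) < (1/2)^k"
    and rS: "\<And>k. r k < r (Suc k)" by blast
  have rm: "strict_mono r" using rS by (simp add: strict_mono_Suc_iff)
  define h where "h k x = f (r (Suc k)) x - f (r k) x" for k x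
  have hL: "h k \<in> L2 M" for k unfolding h_def by (intro L2_diff f)
  have [measurable]: "h k \<in> borel_measurable M" for k using hL by (rule L2D)
  have one: "(\<lambda>x. 1) \<in> L2 M" by (simp add: L2_def)
  have hint: "integrable M (\<lambda>x. cmod (h k x))" "(\<integral>x. cmod (h k x) \<partial>M) \<le> l2norm M (\<lambda>x. 1) * (1/2)^k" for k
  proof -
    show "integrable M (\<lambda>x. cmod (h k x))" using L2_abs_product_le(1)[OF one hL] by simp
    have "(\<integral>x. cmod (h k x) \<partial>M) \<le> l2norm M (\<lambda>x. 1) * l2norm M (h k)"
      using L2_abs_product_le(2)[OF one hL] by simp
    also have "\<dots> \<le> l2norm M (\<lambda>x. 1) * (1/2)^k"
      using r[of k "r (Suc k)" "r k"] rS[of k] by (intro mult_left_mono) (auto simp: h_def[abs_def])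
    finally show "(\<integral>x. cmod (h k x) \<partial>M) \<le> l2norm M (\<lambda>x. 1) * (1/2)^k" .
  qed
  have "(\<integral>\<^sup>+x. (\<Sum>k. ennreal (cmod (h k x))) \<partial>M) = (\<Sum>k. \<integral>\<^sup>+x. ennreal (cmod (h k x)) \<partial>M)"
    by (rule nn_integral_suminf) simp
  also have "\<dots> \<le> (\<Sum>k. ennreal (l2norm M (\<lambda>x. 1) * (1/2)^k))"
    using hint by (intro suminf_le ennreal_leI summableI) (simp add: nn_integral_eq_integral ennreal_leI)
  also have "\<dots> = ennreal (\<Sum>k. l2norm M (\<lambda>x. 1) * (1/2)^k)"
    by (rule suminf_ennreal2) (auto intro!: summable_mult summable_geometric)
  finally have "(\<integral>\<^sup>+x. (\<Sum>k. ennreal (cmod (h k x))) \<partial>M) \<noteq> \<infinity>"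
    by (metis ennreal_less_top infinity_ennreal_def leD)
  then have "AE x in M. (\<Sum>k. ennreal (cmod (h k x))) \<noteq> \<infinity>"
    by (intro nn_integral_noteq_infinite) auto
  then have conv: "AE x in M. convergent (\<lambda>k. f (r k) x)"
  proof eventually_elim
    fix x assume "(\<Sum>k. ennreal (cmod (h k x))) \<noteq> \<infinity>"
    then have "summable (\<lambda>k. cmod (h k x))"
      by (intro summable_suminf_not_top) (auto simp: infinity_ennreal_def)
    then have "summable (\<lambda>k. h k x)" by (rule summable_norm_cancel)
    then have "convergent (\<lambda>n. \<Sum>k<n. h k x)" by (simp add: summable_iff_convergent)
    then have "convergent (\<lambda>n. f (r n) x - f (r 0) x)"
      using sum_lessThan_telescope[of "\<lambda>k. f (r k) x"] by (simp add: h_def)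
    then have "convergent (\<lambda>n. (f (r n) x - f (r 0) x) + f (r 0) x)"
      by (intro convergent_add convergent_const)
    then show "convergent (\<lambda>k. f (r k) x)" by simp
  qed
  define g where "g x = lim (\<lambda>k. f (r k) x)" for x
  have gm [measurable]: "g \<in> borel_measurable M" unfolding g_def by (rule borel_measurable_lim_metric) simp
  have gl: "AE x in M. (\<lambda>k. f (r k) x) \<longlonglongrightarrow> g x"
    using conv by (simp add: g_def convergent_LIMSEQ_iff)
  \<comment> \<open>Fatou's lemma along the subsequence turns the Cauchy bound into a bound on the
    distance to the pointwise limit, and shows that this distance is finite.\<close>
  have fatou: "(\<lambda>x. f n x - g x) \<in> L2 M \<and> (l2norm M (\<lambda>x. f n x - g x))\<^sup>2 \<le> ((1/2)^j)\<^sup>2" if n: "n \<ge> r j" for n j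
  proof -
    have "(\<integral>\<^sup>+x. ennreal ((cmod (f n x - g x))\<^sup>2) \<partial>M)
        = (\<integral>\<^sup>+x. liminf (\<lambda>k. ennreal ((cmod (f n x - f (r k) x))\<^sup>2)) \<partial>M)"
    proof (rule nn_integral_cong_AE)
      show "AE x in M. ennreal ((cmod (f n x - g x))\<^sup>2) = liminf (\<lambda>k. ennreal ((cmod (f n x - f (r k) x))\<^sup>2))"
        using gl
      proof eventually_elim
        fix x assume "(\<lambda>k. f (r k) x) \<longlonglongrightarrow> g x"
        then have "(\<lambda>k. ennreal ((cmod (f n x - f (r k) x))\<^sup>2)) \<longlonglongrightarrow> ennreal ((cmod (f n x - g x))\<^sup>2)"
          by (intro tendsto_intros)
        then show "ennreal ((cmod (f n x - g x))\<^sup>2) = liminf (\<lambda>k. ennreal ((cmod (f n x - f (r k) x))\<^sup>2))"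
          using lim_imp_Liminf by force
      qed
    qed
    also have "\<dots> \<le> liminf (\<lambda>k. \<integral>\<^sup>+x. ennreal ((cmod (f n x - f (r k) x))\<^sup>2) \<partial>M)"
      by (rule nn_integral_liminf) simp
    also have "\<dots> \<le> ennreal (((1/2)^j)\<^sup>2)"
    proof (rule Liminf_le)
      have "(\<integral>\<^sup>+x. ennreal ((cmod (f n x - f (r k) x))\<^sup>2) \<partial>M) \<le> ennreal (((1/2)^j)\<^sup>2)" if k: "k \<ge> j" for k
      proof -
        have "(\<integral>\<^sup>+x. ennreal ((cmod (f n x - f (r k) x))\<^sup>2) \<partial>M) = ennreal ((l2norm M (\<lambda>x. f n x - f (r k) x))\<^sup>2)"
          unfolding l2norm_sq using L2D(2)[OF L2_diff[OF f f]] by (intro nn_integral_eq_integral) auto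
        also have "\<dots> \<le> ennreal (((1/2)^j)\<^sup>2)"
          using r[OF n, of "r k"] strict_mono_less_eq[OF rm, of j k] k
          by (intro ennreal_leI power_mono) auto
        finally show ?thesis .
      qed
      then show "eventually (\<lambda>k. (\<integral>\<^sup>+x. ennreal ((cmod (f n x - f (r k) x))\<^sup>2) \<partial>M) \<le> ennreal (((1/2)^j)\<^sup>2)) sequentially"
        unfolding eventually_sequentially by blast
    qed simp
    finally have le: "(\<integral>\<^sup>+x. ennreal ((cmod (f n x - g x))\<^sup>2) \<partial>M) \<le> ennreal (((1/2)^j)\<^sup>2)" .
    then have int: "integrable M (\<lambda>x. (cmod (f n x - g x))\<^sup>2)"
      by (intro integrableI_nonneg) (auto intro: le_less_trans)
    have "ennreal ((l2norm M (\<lambda>x. f n x - g x))\<^sup>2) \<le> ennreal (((1/2)^j)\<^sup>2)"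
      using le nn_integral_eq_integral[OF int] by (simp add: l2norm_sq)
    then show ?thesis using int by (simp add: L2_def ennreal_le_iff)
  qed
  have gL: "g \<in> L2 M"
    using L2_diff[OF f[of "r 0"], of "\<lambda>x. f (r 0) x - g x"] fatou[of 0 "r 0"] by simp
  have "(\<lambda>n. l2norm M (\<lambda>x. f n x - g x)) \<longlonglongrightarrow> 0"
  proof (rule LIMSEQ_I)
    fix e :: real assume "e > 0"
    then obtain j where j: "(1/2)^j < e" using real_arch_pow_inv[of e "1/2"] by auto
    have "l2norm M (\<lambda>x. f n x - g x) < e" if "n \<ge> r j" for n
      using fatou[OF that] j power2_le_imp_le[of "l2norm M (\<lambda>x. f n x - g x)" "(1/2)^j"] by auto
    then show "\<exists>N. \<forall>n\<ge>N. norm (l2norm M (\<lambda>x. f n x - g x) - 0) < e" by auto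
  qed
  then show ?thesis using that gL by blast
qed

section \<open>Spans of functions and their L^2 closures\<close>

lemma fspan_0: "(\<lambda>x. 0) \<in> fspan A"
  unfolding fspan_def by (rule CollectI) (rule exI[of _ "{}"], simp)

lemma fspan_add:
  assumes "f \<in> fspan A" "g \<in> fspan A" shows "(\<lambda>x. f x + g x) \<in> fspan A"
proof -
  obtain F c where F: "finite F" "F \<subseteq> A" "f = (\<lambda>x. \<Sum>a\<in>F. c a * a x)"
    using assms(1) by (auto simp: fspan_def)
  obtain G d where G: "finite G" "G \<subseteq> A" "g = (\<lambda>x. \<Sum>a\<in>G. d a * a x)"
    using assms(2) by (auto simp: fspan_def)
  define e where "e a = (if a \<in> F then c a else 0) + (if a \<in> G then d a else 0)" for a
  have "f x + g x = (\<Sum>a\<in>F \<union> G. e a * a x)" for x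
  proof -
    have "(\<Sum>a\<in>F. c a * a x) = (\<Sum>a\<in>F \<union> G. (if a \<in> F then c a else 0) * a x)"
      using F G by (intro sum.mono_neutral_cong_left) auto
    moreover have "(\<Sum>a\<in>G. d a * a x) = (\<Sum>a\<in>F \<union> G. (if a \<in> G then d a else 0) * a x)"
      using F G by (intro sum.mono_neutral_cong_left) auto
    ultimately show ?thesis by (simp add: F G e_def sum.distrib distrib_right)
  qed
  then show ?thesis unfolding fspan_def using F G
    by (intro CollectI exI[of _ "F \<union> G"] exI[of _ e]) auto
qed

lemma fspan_cmult:
  assumes "f \<in> fspan A" shows "(\<lambda>x. c * f x) \<in> fspan A"
proof -
  obtain F d where F: "finite F" "F \<subseteq> A" "f = (\<lambda>x. \<Sum>a\<in>F. d a * a x)"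
    using assms by (auto simp: fspan_def)
  then show ?thesis unfolding fspan_def
    by (intro CollectI exI[of _ F] exI[of _ "\<lambda>a. c * d a"]) (auto simp: sum_distrib_left mult.assoc)
qed

lemma fspan_base: "a \<in> A \<Longrightarrow> a \<in> fspan A"
  unfolding fspan_def by (intro CollectI exI[of _ "{a}"] exI[of _ "\<lambda>_. 1"]) auto

lemma fspan_induct [consumes 1, case_names zero add]:
  assumes f: "f \<in> fspan A" and 0: "P (\<lambda>x. 0)"
    and add: "\<And>g c a. P g \<Longrightarrow> g \<in> fspan A \<Longrightarrow> a \<in> A \<Longrightarrow> P (\<lambda>x. c * a x + g x)"
  shows "P f"
proof -
  obtain F c where F: "finite F" "F \<subseteq> A" "f = (\<lambda>x. \<Sum>a\<in>F. c a * a x)"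
    using f by (auto simp: fspan_def)
  have "P (\<lambda>x. \<Sum>a\<in>F. c a * a x) \<and> (\<lambda>x. \<Sum>a\<in>F. c a * a x) \<in> fspan A" using F(1,2)
  proof (induction F rule: finite_induct)
    case (insert b F)
    then have "P (\<lambda>x. c b * b x + (\<Sum>a\<in>F. c a * a x))" by (intro add) auto
    moreover have "(\<lambda>x. c b * b x + (\<Sum>a\<in>F. c a * a x)) \<in> fspan A"
      using insert by (intro fspan_add[OF fspan_cmult[OF fspan_base]]) auto
    ultimately show ?case using insert by simp
  qed (use 0 fspan_0 in auto)
  then show ?thesis using F by simp
qed

lemma fspan_L2: "A \<subseteq> L2 M \<Longrightarrow> fspan A \<subseteq> L2 M"
proof
  fix f assume A: "A \<subseteq> L2 M" and "f \<in> fspan A"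
  from this(2) show "f \<in> L2 M"
    by (induction rule: fspan_induct) (use A in \<open>auto intro!: L2_0 L2_add L2_cmult\<close>)
qed

lemma L2_closureD: "f \<in> L2_closure M A \<Longrightarrow> f \<in> L2 M"
  by (simp add: L2_closure_def)

lemma L2_closure_approx:
  assumes "f \<in> L2_closure M A" "e > 0"
  obtains g where "g \<in> A" "l2norm M (\<lambda>x. f x - g x) < e"
  using assms by (auto simp: L2_closure_def)

lemma L2_closure_base: "f \<in> A \<Longrightarrow> f \<in> L2 M \<Longrightarrow> f \<in> L2_closure M A"
  unfolding L2_closure_def by (auto intro!: bexI[of _ f] simp: l2norm_def)

lemma L2_closure_closed:
  assumes A: "A \<subseteq> L2 M" and f: "f \<in> L2 M" "\<And>e. e > 0 \<Longrightarrow> \<exists>g\<in>L2_closure M A. l2norm M (\<lambda>x. f x - g x) < e"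
  shows "f \<in> L2_closure M A"
  unfolding L2_closure_def
proof (intro CollectI conjI allI impI f(1))
  fix e :: real assume "e > 0"
  then obtain g where g: "g \<in> L2_closure M A" "l2norm M (\<lambda>x. f x - g x) < e / 2"
    using f(2)[of "e / 2"] by auto
  then obtain h where h: "h \<in> A" "l2norm M (\<lambda>x. g x - h x) < e / 2"
    using L2_closure_approx[OF g(1) half_gt_zero[OF \<open>e > 0\<close>]] by blast
  have "l2norm M (\<lambda>x. f x - h x) \<le> l2norm M (\<lambda>x. f x - g x) + l2norm M (\<lambda>x. g x - h x)"
    using f g h A by (intro l2norm_triangle_diff) (auto simp: L2_closure_def)
  then show "\<exists>g\<in>A. l2norm M (\<lambda>x. f x - g x) < e" using g h by (intro bexI[of _ h]) auto
qed

lemma L2_closure_AE_eq: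
  assumes A: "A \<subseteq> L2 M" and f: "f \<in> L2_closure M A" and g: "g \<in> borel_measurable M" "AE x in M. g x = f x"
  shows "g \<in> L2_closure M A"
proof (rule L2_closure_closed[OF A])
  show gL: "g \<in> L2 M" by (rule L2_AE_eq[OF L2_closureD[OF f] g])
  fix e :: real assume "e > 0"
  have "l2norm M (\<lambda>x. g x - f x) = l2norm M (\<lambda>x. 0)"
    using g(2) L2D(1)[OF L2_diff[OF gL L2_closureD[OF f]]] by (intro l2norm_cong_AE) auto
  then show "\<exists>h\<in>L2_closure M A. l2norm M (\<lambda>x. g x - h x) < e"
    using f \<open>e > 0\<close> by (intro bexI[of _ f]) (simp_all add: l2norm_def)
qed

lemma L2_closure_fspan_add:
  assumes A: "A \<subseteq> L2 M" and f: "f \<in> L2_closure M (fspan A)" "g \<in> L2_closure M (fspan A)"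
  shows "(\<lambda>x. f x + g x) \<in> L2_closure M (fspan A)"
  unfolding L2_closure_def
proof (intro CollectI conjI allI impI L2_add L2_closureD[OF f(1)] L2_closureD[OF f(2)])
  fix e :: real assume e: "e > 0"
  obtain f' where f': "f' \<in> fspan A" "l2norm M (\<lambda>x. f x - f' x) < e / 2"
    using L2_closure_approx[OF f(1) half_gt_zero[OF e]] by blast
  obtain g' where g': "g' \<in> fspan A" "l2norm M (\<lambda>x. g x - g' x) < e / 2"
    using L2_closure_approx[OF f(2) half_gt_zero[OF e]] by blast
  have "l2norm M (\<lambda>x. (f x - f' x) + (g x - g' x)) \<le> l2norm M (\<lambda>x. f x - f' x) + l2norm M (\<lambda>x. g x - g' x)"
    using f f' g' fspan_L2[OF A] by (intro l2norm_triangle L2_diff) (auto simp: L2_closure_def)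
  then have "l2norm M (\<lambda>x. (f x + g x) - (f' x + g' x)) < e"
    using f' g' by (simp add: algebra_simps)
  then show "\<exists>h\<in>fspan A. l2norm M (\<lambda>x. (f x + g x) - h x) < e"
    using f' g' by (intro bexI[of _ "\<lambda>x. f' x + g' x"] fspan_add)
qed

lemma L2_closure_fspan_cmult:
  assumes A: "A \<subseteq> L2 M" and f: "f \<in> L2_closure M (fspan A)"
  shows "(\<lambda>x. c * f x) \<in> L2_closure M (fspan A)"
  unfolding L2_closure_def
proof (intro CollectI conjI allI impI L2_cmult L2_closureD[OF f])
  fix e :: real assume e: "e > 0"
  define d where "d = e / (cmod c + 1)"
  have d: "d > 0" "cmod c * d < e"
    using e by (auto simp: d_def field_simps add_pos_nonneg intro!: divide_pos_pos)
  obtain g where g: "g \<in> fspan A" "l2norm M (\<lambda>x. f x - g x) < d"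
    using L2_closure_approx[OF f d(1)] by blast
  have "l2norm M (\<lambda>x. c * f x - c * g x) = cmod c * l2norm M (\<lambda>x. f x - g x)"
    by (simp add: l2norm_cmult flip: right_diff_distrib)
  also have "\<dots> \<le> cmod c * d" using g by (intro mult_left_mono) auto
  finally show "\<exists>h\<in>fspan A. l2norm M (\<lambda>x. c * f x - h x) < e"
    using d g by (intro bexI[of _ "\<lambda>x. c * g x"] fspan_cmult) auto
qed

text \<open>A bounded multiplier is continuous on L^2, so it suffices to know where it sends the
  generators. The uses are the constant 1 (inclusions), the coordinate functions, polynomials, and
  an inner function and its conjugate.\<close>

lemma L2_closure_fspan_mult:
  assumes A: "A \<subseteq> L2 M" and B: "B \<subseteq> L2 M"
    and t: "t \<in> borel_measurable M" "AE x in M. cmod (t x) \<le> C"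
    and base: "\<And>a. a \<in> A \<Longrightarrow> (\<lambda>x. t x * a x) \<in> L2_closure M (fspan B)"
    and f: "f \<in> L2_closure M (fspan A)"
  shows "(\<lambda>x. t x * f x) \<in> L2_closure M (fspan B)"
proof (rule L2_closure_closed[OF fspan_L2[OF B] L2_mult[OF L2_closureD[OF f] t]])
  have span: "(\<lambda>x. t x * g x) \<in> L2_closure M (fspan B)" if "g \<in> fspan A" for g
    using that
  proof (induction rule: fspan_induct)
    case zero
    then show ?case using L2_closure_base[OF fspan_0 L2_0] by simp
  next
    case (add g c a)
    have "(\<lambda>x. c * (t x * a x) + t x * g x) \<in> L2_closure M (fspan B)"
      by (intro L2_closure_fspan_add B L2_closure_fspan_cmult base add)
    then show ?case by (simp add: algebra_simps)
  qed
  fix e :: real assume e: "e > 0"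
  \<comment> \<open>The bound \<open>C\<close> could be negative if the measure were zero; the
    truncation excludes this, and adding 1 below keeps the quotient defined.\<close>
  define C' where "C' = max C 0"
  have C': "C' \<ge> 0" "AE x in M. cmod (t x) \<le> C'" using t(2) by (auto simp: C'_def)
  define d where "d = e / (C' + 1)"
  have d: "d > 0" "C' * d < e"
    using e C' by (auto simp: d_def field_simps add_pos_nonneg intro!: divide_pos_pos)
  obtain g where g: "g \<in> fspan A" "l2norm M (\<lambda>x. f x - g x) < d"
    using L2_closure_approx[OF f d(1)] by blast
  have "l2norm M (\<lambda>x. t x * (f x - g x)) \<le> C' * l2norm M (\<lambda>x. f x - g x)"
    using L2_closureD[OF f] g fspan_L2[OF A] by (intro l2norm_mult_le L2_diff t C') auto
  also have "\<dots> \<le> C' * d" using g C' by (intro mult_left_mono) auto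
  finally have "l2norm M (\<lambda>x. t x * f x - t x * g x) < e" using d by (simp add: right_diff_distrib)
  then show "\<exists>h\<in>L2_closure M (fspan B). l2norm M (\<lambda>x. t x * f x - h x) < e"
    by (intro bexI[of _ "\<lambda>x. t x * g x"] span g)
qed

lemma L2_closure_fspan_mono:
  assumes "A \<subseteq> L2 M" "B \<subseteq> L2 M" "\<And>a. a \<in> A \<Longrightarrow> a \<in> L2_closure M (fspan B)" "f \<in> L2_closure M (fspan A)"
  shows "f \<in> L2_closure M (fspan B)"
  using L2_closure_fspan_mult[OF assms(1,2), of "\<lambda>_. 1" 1 f] assms(3,4) by simp

section \<open>Limits in L^2 and sums of orthogonal closed subspaces\<close>

lemma l2inner_tendsto:
  assumes L: "\<And>n. f n \<in> L2 M" "\<And>n. g n \<in> L2 M" "f' \<in> L2 M" "g' \<in> L2 M"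
    and lim: "(\<lambda>n. l2norm M (\<lambda>x. f n x - f' x)) \<longlonglongrightarrow> 0" "(\<lambda>n. l2norm M (\<lambda>x. g n x - g' x)) \<longlonglongrightarrow> 0"
  shows "(\<lambda>n. l2inner M (f n) (g n)) \<longlonglongrightarrow> l2inner M f' g'"
proof -
  define a where "a n = l2norm M (\<lambda>x. f n x - f' x)" for n
  define b where "b n = l2norm M (\<lambda>x. g n x - g' x)" for n
  have bound: "cmod (l2inner M (f n) (g n) - l2inner M f' g') \<le> a n * b n + a n * l2norm M g' + l2norm M f' * b n" for n
  proof -
    note D = L2_diff[OF L(1) L(3)] L2_diff[OF L(2) L(4)]
    have eq: "l2inner M (f n) (g n) - l2inner M f' g' = l2inner M (\<lambda>x. f n x - f' x) (\<lambda>x. g n x - g' x)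
        + l2inner M (\<lambda>x. f n x - f' x) g' + l2inner M f' (\<lambda>x. g n x - g' x)"
      using L D by (simp add: l2inner_diff_left l2inner_diff_right)
    have "cmod (l2inner M (f n) (g n) - l2inner M f' g') \<le> cmod (l2inner M (\<lambda>x. f n x - f' x) (\<lambda>x. g n x - g' x))
        + cmod (l2inner M (\<lambda>x. f n x - f' x) g') + cmod (l2inner M f' (\<lambda>x. g n x - g' x))"
      unfolding eq by (rule order_trans[OF norm_triangle_ineq add_right_mono[OF norm_triangle_ineq]])
    also have "\<dots> \<le> a n * b n + a n * l2norm M g' + l2norm M f' * b n"
      unfolding a_def b_def using L D by (intro add_mono l2inner_cauchy_schwarz)
    finally show ?thesis .
  qed
  have "a \<longlonglongrightarrow> 0" "b \<longlonglongrightarrow> 0" using lim by (simp_all add: a_def[abs_def] b_def[abs_def])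
  then have "(\<lambda>n. a n * b n + a n * l2norm M g' + l2norm M f' * b n) \<longlonglongrightarrow> 0 * 0 + 0 * l2norm M g' + l2norm M f' * 0"
    by (intro tendsto_intros)
  then have "(\<lambda>n. a n * b n + a n * l2norm M g' + l2norm M f' * b n) \<longlonglongrightarrow> 0" by simp
  then have "(\<lambda>n. l2inner M (f n) (g n) - l2inner M f' g') \<longlonglongrightarrow> 0"
    by (rule Lim_null_comparison[rotated]) (use bound in auto)
  then show ?thesis by (simp add: LIM_zero_iff)
qed

lemma L2_closure_sequence:
  assumes "f \<in> L2_closure M A"
  obtains g where "\<And>n::nat. g n \<in> A" "(\<lambda>n. l2norm M (\<lambda>x. g n x - f x)) \<longlonglongrightarrow> 0"
proof -
  have "\<exists>g\<in>A. l2norm M (\<lambda>x. g x - f x) < 1 / Suc n" for n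
    using assms l2norm_minus_commute[of M f] unfolding L2_closure_def by simp
  then obtain g where g: "\<And>n. g n \<in> A" "\<And>n. l2norm M (\<lambda>x. g n x - f x) < 1 / Suc n" by metis
  have "(\<lambda>n. l2norm M (\<lambda>x. g n x - f x)) \<longlonglongrightarrow> 0"
    by (rule Lim_null_comparison[OF _ LIMSEQ_inverse_real_of_nat])
      (use g(2) in \<open>auto simp: inverse_eq_divide intro!: always_eventually less_imp_le\<close>)
  then show ?thesis using that g(1) by blast
qed

lemma L2_closure_of_limit:
  assumes "f \<in> L2 M" "\<And>n. g n \<in> A" "(\<lambda>n. l2norm M (\<lambda>x. g n x - f x)) \<longlonglongrightarrow> 0"
  shows "f \<in> L2_closure M A"
  unfolding L2_closure_def
proof (intro CollectI conjI allI impI assms(1))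
  fix e :: real assume "e > 0"
  then obtain n where "l2norm M (\<lambda>x. g n x - f x) < e"
    using order_tendstoD(2)[OF assms(3)] by (auto simp: eventually_sequentially)
  then show "\<exists>g\<in>A. l2norm M (\<lambda>x. f x - g x) < e"
    using assms(2) l2norm_minus_commute[of M f] by metis
qed

lemma L2_limit_Cauchy:
  assumes L: "\<And>n. f n \<in> L2 M" "g \<in> L2 M" and lim: "(\<lambda>n. l2norm M (\<lambda>x. f n x - g x)) \<longlonglongrightarrow> 0" and e: "e > 0"
  shows "\<exists>N. \<forall>m\<ge>N. \<forall>n\<ge>N. l2norm M (\<lambda>x. f m x - f n x) < e"
proof -
  obtain N where N: "\<And>n. n \<ge> N \<Longrightarrow> l2norm M (\<lambda>x. f n x - g x) < e / 2"
    using order_tendstoD(2)[OF lim, of "e / 2"] e by (auto simp: eventually_sequentially)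
  have "l2norm M (\<lambda>x. f m x - f n x) < e" if "m \<ge> N" "n \<ge> N" for m n
    using l2norm_triangle_diff[OF L(1) L(2) L(1), of m n] N[OF that(1)] N[OF that(2)]
      l2norm_minus_commute[of M g "f n"] by linarith
  then show ?thesis by blast
qed

text \<open>A sum of two closed subspaces need not be closed; orthogonality rescues it. By
  Pythagoras both components of a convergent sequence are Cauchy, and completeness supplies their
  limits.\<close>

lemma L2_closure_orthogonal_union:
  assumes fin: "finite_measure M" and A: "A \<subseteq> L2 M" and B: "B \<subseteq> L2 M"
    and orth: "\<And>a b. a \<in> A \<Longrightarrow> b \<in> B \<Longrightarrow> l2inner M a b = 0"
    and F: "F \<in> L2_closure M (fspan (A \<union> B))"
  shows "\<exists>f\<in>L2_closure M (fspan A). \<exists>g\<in>L2_closure M (fspan B). AE x in M. F x = f x + g x"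
proof -
  note LA = fspan_L2[OF A] and LB = fspan_L2[OF B]
  have orth1: "l2inner M a g = 0" if "a \<in> A" "g \<in> fspan B" for a g
    using that(2)
  proof (induction rule: fspan_induct)
    case (add g c b)
    then show ?case using that orth A B LB
      by (subst l2inner_add_right) (auto simp: l2inner_cmult_right intro!: L2_cmult)
  qed (simp add: l2inner_0)
  have orth': "l2inner M f g = 0" if "f \<in> fspan A" "g \<in> fspan B" for f g
    using that(1)
  proof (induction rule: fspan_induct)
    case (add f c a)
    then show ?case using that orth1 A B LA LB
      by (subst l2inner_add_left) (auto simp: l2inner_cmult_left intro!: L2_cmult)
  qed (simp add: l2inner_0)
  have split: "\<exists>f\<in>fspan A. \<exists>g\<in>fspan B. h = (\<lambda>x. f x + g x)" if "h \<in> fspan (A \<union> B)" for h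
    using that
  proof (induction rule: fspan_induct)
    case zero
    then show ?case by (intro bexI[of _ "\<lambda>x. 0"] fspan_0) simp
  next
    case (add h c a)
    then obtain f g where fg: "f \<in> fspan A" "g \<in> fspan B" "h = (\<lambda>x. f x + g x)" by blast
    show ?case
    proof (cases "a \<in> A")
      case True
      show ?thesis
        by (rule bexI[OF bexI[OF _ fg(2)] fspan_add[OF fspan_cmult[OF fspan_base[OF True], of c] fg(1)]])
          (simp add: fg algebra_simps)
    next
      case False
      then have "a \<in> B" using add by simp
      show ?thesis
        by (rule bexI[OF bexI[OF _ fspan_add[OF fspan_cmult[OF fspan_base[OF \<open>a \<in> B\<close>], of c] fg(2)]] fg(1)])
          (simp add: fg algebra_simps)
    qed
  qed
  obtain h where h: "\<And>n. h n \<in> fspan (A \<union> B)" "(\<lambda>n. l2norm M (\<lambda>x. h n x - F x)) \<longlonglongrightarrow> 0"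
    using L2_closure_sequence[OF F] by blast
  have "\<forall>n. \<exists>f g. f \<in> fspan A \<and> g \<in> fspan B \<and> h n = (\<lambda>x. f x + g x)" using split[OF h(1)] by blast
  then obtain f g where fg: "\<And>n. f n \<in> fspan A" "\<And>n. g n \<in> fspan B" "\<And>n. h n = (\<lambda>x. f n x + g n x)"
    unfolding choice_iff by blast
  have hL: "h n \<in> L2 M" for n using h(1) fspan_L2[of "A \<union> B" M] A B by blast
  have fL: "f n \<in> L2 M" and gL: "g n \<in> L2 M" for n using fg LA LB by auto
  note FL = L2_closureD[OF F]
  have pyth: "(l2norm M (\<lambda>x. h m x - h n x))\<^sup>2 = (l2norm M (\<lambda>x. f m x - f n x))\<^sup>2 + (l2norm M (\<lambda>x. g m x - g n x))\<^sup>2" for m n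
  proof -
    have "h m x - h n x = (f m x - f n x) + (g m x - g n x)" for x by (simp add: fg(3))
    then have "(l2norm M (\<lambda>x. h m x - h n x))\<^sup>2 = (l2norm M (\<lambda>x. (f m x - f n x) + (g m x - g n x)))\<^sup>2" by simp
    also have "\<dots> = (l2norm M (\<lambda>x. f m x - f n x))\<^sup>2 + (l2norm M (\<lambda>x. g m x - g n x))\<^sup>2"
      using orth'[OF fg(1) fg(2)]
      by (subst l2norm_add_sq) (auto intro!: L2_diff fL gL simp: l2inner_diff_left l2inner_diff_right fL gL L2_diff)
    finally show ?thesis .
  qed
  have "l2norm M (\<lambda>x. f m x - f n x) \<le> l2norm M (\<lambda>x. h m x - h n x)"
    "l2norm M (\<lambda>x. g m x - g n x) \<le> l2norm M (\<lambda>x. h m x - h n x)" for m n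
    by (rule power2_le_imp_le; simp add: pyth)+
  then have cau: "\<exists>N. \<forall>m\<ge>N. \<forall>n\<ge>N. l2norm M (\<lambda>x. f m x - f n x) < e"
    "\<exists>N. \<forall>m\<ge>N. \<forall>n\<ge>N. l2norm M (\<lambda>x. g m x - g n x) < e" if "e > 0" for e
    using L2_limit_Cauchy[OF hL FL h(2) that] by (meson le_less_trans)+
  obtain f' where f': "f' \<in> L2 M" "(\<lambda>n. l2norm M (\<lambda>x. f n x - f' x)) \<longlonglongrightarrow> 0"
    using L2_complete[OF fin fL cau(1)] by blast
  obtain g' where g': "g' \<in> L2 M" "(\<lambda>n. l2norm M (\<lambda>x. g n x - g' x)) \<longlonglongrightarrow> 0"
    using L2_complete[OF fin gL cau(2)] by blast
  have "l2norm M (\<lambda>x. F x - (f' x + g' x)) \<le> l2norm M (\<lambda>x. h n x - F x) + (l2norm M (\<lambda>x. f n x - f' x) + l2norm M (\<lambda>x. g n x - g' x))" for n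
  proof -
    have "l2norm M (\<lambda>x. F x - (f' x + g' x)) \<le> l2norm M (\<lambda>x. F x - h n x) + l2norm M (\<lambda>x. h n x - (f' x + g' x))"
      by (intro l2norm_triangle_diff FL hL L2_add f' g')
    also have "(\<lambda>x. h n x - (f' x + g' x)) = (\<lambda>x. (f n x - f' x) + (g n x - g' x))"
      by (simp add: fg(3) algebra_simps)
    also have "l2norm M \<dots> \<le> l2norm M (\<lambda>x. f n x - f' x) + l2norm M (\<lambda>x. g n x - g' x)"
      by (intro l2norm_triangle L2_diff fL gL f' g')
    finally show ?thesis by (simp add: l2norm_minus_commute[of M F])
  qed
  moreover have "(\<lambda>n. l2norm M (\<lambda>x. h n x - F x) + (l2norm M (\<lambda>x. f n x - f' x) + l2norm M (\<lambda>x. g n x - g' x))) \<longlonglongrightarrow> 0 + (0 + 0)"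
    by (intro tendsto_add h f' g')
  ultimately have "l2norm M (\<lambda>x. F x - (f' x + g' x)) \<le> 0 + (0 + 0)"
    by (intro LIMSEQ_le_const) auto
  then have "l2norm M (\<lambda>x. F x - (f' x + g' x)) = 0" using l2norm_nonneg by (simp add: antisym)
  then have "AE x in M. F x - (f' x + g' x) = 0"
    by (intro l2norm_eq_0 L2_diff FL L2_add f' g')
  then have "AE x in M. F x = f' x + g' x" by simp
  moreover have "f' \<in> L2_closure M (fspan A)" by (rule L2_closure_of_limit[OF f'(1) fg(1) f'(2)])
  moreover have "g' \<in> L2_closure M (fspan B)" by (rule L2_closure_of_limit[OF g'(1) fg(2) g'(2)])
  ultimately show ?thesis by blast
qed

section \<open>Unitary equivalence from equal Gram matrices\<close>

text \<open>Pairs of linear combinations with the same coefficients. A relation is used because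
  coefficients are not determined by the vector; equality of Gram matrices later makes the relation
  isometric, hence single-valued up to null sets.\<close>

inductive combo :: "('i \<Rightarrow> 'a::complex_inner) \<Rightarrow> ('i \<Rightarrow> 't \<Rightarrow> complex) \<Rightarrow> 'a \<Rightarrow> ('t \<Rightarrow> complex) \<Rightarrow> bool"
  for v u where
  zero: "combo v u 0 (\<lambda>t. 0)"
| add: "combo v u x f \<Longrightarrow> combo v u (scaleC c (v i) + x) (\<lambda>t. c * u i t + f t)"

text \<open>The closure of the graph of \<open>combo\<close>, that is, the graph of the unitary
  extension with functions taken up to almost everywhere equality.\<close>

definition limit_graph :: "'t measure \<Rightarrow> ('i \<Rightarrow> 'a::complex_inner) \<Rightarrow> ('i \<Rightarrow> 't \<Rightarrow> complex) \<Rightarrow> 'a \<Rightarrow> ('t \<Rightarrow> complex) \<Rightarrow> bool" where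
  "limit_graph M v u x f \<longleftrightarrow> f \<in> L2 M \<and>
     (\<exists>y g. (\<forall>n::nat. combo v u (y n) (g n)) \<and> y \<longlonglongrightarrow> x \<and> (\<lambda>n. l2norm M (\<lambda>t. g n t - f t)) \<longlonglongrightarrow> 0)"

lemma limit_graphI:
  assumes "f \<in> L2 M" "\<And>n. combo v u (y n) (g n)" "y \<longlonglongrightarrow> x" "(\<lambda>n. l2norm M (\<lambda>t. g n t - f t)) \<longlonglongrightarrow> 0"
  shows "limit_graph M v u x f"
  using assms unfolding limit_graph_def by blast

locale equal_gram = finite_measure M for M :: "'t measure" +
  fixes v :: "'i \<Rightarrow> 'a::{complex_inner, complete_space}" and u :: "'i \<Rightarrow> 't \<Rightarrow> complex"
  assumes u_L2: "u i \<in> L2 M" and gram: "l2inner M (u i) (u j) = cinner (v i) (v j)"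
begin

lemma combo_L2: "combo v u x f \<Longrightarrow> f \<in> L2 M"
  by (induction rule: combo.induct) (intro L2_0 L2_add L2_cmult u_L2 | assumption)+

lemma combo_inner1: "combo v u x f \<Longrightarrow> l2inner M (u i) f = cinner (v i) x"
proof (induction rule: combo.induct)
  case (add x f c j)
  then show ?case using combo_L2
    by (subst l2inner_add_right) (auto simp: l2inner_cmult_right cinner_simps gram intro!: L2_cmult u_L2)
qed (simp add: l2inner_0)

lemma combo_inner: "combo v u x f \<Longrightarrow> combo v u y g \<Longrightarrow> l2inner M f g = cinner x y"
proof (induction rule: combo.induct)
  case (add x f c j)
  then show ?case using combo_L2 combo_inner1
    by (subst l2inner_add_left) (auto simp: l2inner_cmult_left cinner_simps intro!: L2_cmult u_L2)
qed (simp add: l2inner_0)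

lemma combo_diff:
  assumes "combo v u x f" "combo v u y g" shows "l2norm M (\<lambda>t. f t - g t) = norm (x - y)"
proof -
  note L = combo_L2[OF assms(1)] combo_L2[OF assms(2)]
  have "complex_of_real ((l2norm M (\<lambda>t. f t - g t))\<^sup>2) = complex_of_real ((norm (x - y))\<^sup>2)"
    unfolding l2inner_self[symmetric] cinner_self_norm[symmetric]
    using assms by (simp add: l2inner_diff_left l2inner_diff_right L L2_diff cinner_simps combo_inner)
  then have "(l2norm M (\<lambda>t. f t - g t))\<^sup>2 = (norm (x - y))\<^sup>2" unfolding of_real_eq_iff .
  then show ?thesis by simp
qed

lemma combo_exists_left: "x \<in> cspan (range v) \<Longrightarrow> \<exists>f. combo v u x f"
  unfolding cspan_eq_span
proof (induction rule: cvs.span_induct_alt)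
  case base
  then show ?case using combo.zero by blast
next
  case (step c x y)
  then obtain i f where "x = v i" "combo v u y f" by blast
  then show ?case using combo.add[of v u y f c i] by blast
qed

lemma combo_exists_right: "f \<in> fspan (range u) \<Longrightarrow> \<exists>x. combo v u x f"
proof (induction rule: fspan_induct)
  case zero
  then show ?case using combo.zero by blast
next
  case (add g c a)
  then obtain i x where "a = u i" "combo v u x g" by blast
  then show ?case using combo.add[of v u x g c i] by blast
qed

lemma combo_in_fspan: "combo v u x f \<Longrightarrow> f \<in> fspan (range u)"
  by (induction rule: combo.induct) (auto intro: fspan_0 fspan_add[OF fspan_cmult[OF fspan_base]])

lemma combo_in_cspan: "combo v u x f \<Longrightarrow> x \<in> cspan (range v)"
  unfolding cspan_eq_span
  by (induction rule: combo.induct) (auto intro: cvs.span_zero cvs.span_add[OF cvs.span_scale[OF cvs.span_base]])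

lemma limit_graph_inner:
  assumes "limit_graph M v u x f" "limit_graph M v u y g" shows "l2inner M f g = cinner x y"
proof -
  obtain xs fs where 1: "\<And>n. combo v u (xs n) (fs n)" "xs \<longlonglongrightarrow> x" "(\<lambda>n. l2norm M (\<lambda>t. fs n t - f t)) \<longlonglongrightarrow> 0"
    using assms(1) by (auto simp: limit_graph_def)
  obtain ys gs where 2: "\<And>n. combo v u (ys n) (gs n)" "ys \<longlonglongrightarrow> y" "(\<lambda>n. l2norm M (\<lambda>t. gs n t - g t)) \<longlonglongrightarrow> 0"
    using assms(2) by (auto simp: limit_graph_def)
  have "(\<lambda>n. l2inner M (fs n) (gs n)) \<longlonglongrightarrow> l2inner M f g"
    using assms by (intro l2inner_tendsto combo_L2[OF 1(1)] combo_L2[OF 2(1)] 1 2) (auto simp: limit_graph_def)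
  moreover have "(\<lambda>n. l2inner M (fs n) (gs n)) \<longlonglongrightarrow> cinner x y"
    using tendsto_cinner[OF 1(2) 2(2)] combo_inner[OF 1(1) 2(1)] by simp
  ultimately show ?thesis by (rule LIMSEQ_unique)
qed

lemma limit_graph_unique:
  assumes "limit_graph M v u x f" "limit_graph M v u x g" shows "AE t in M. f t = g t"
proof -
  have L: "f \<in> L2 M" "g \<in> L2 M" using assms by (auto simp: limit_graph_def)
  have "l2inner M (\<lambda>t. f t - g t) (\<lambda>t. f t - g t) = 0"
    using assms by (simp add: l2inner_diff_left l2inner_diff_right L L2_diff limit_graph_inner[where x = x and y = x])
  then have "l2norm M (\<lambda>t. f t - g t) = 0" by (simp add: l2inner_self)
  then have "AE t in M. f t - g t = 0" by (intro l2norm_eq_0 L2_diff L)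
  then show ?thesis by simp
qed

lemma limit_graph_exists_right:
  assumes "x \<in> closure (cspan (range v))"
  shows "\<exists>f. limit_graph M v u x f"
proof -
  obtain y where y: "\<And>n. y n \<in> cspan (range v)" "y \<longlonglongrightarrow> x"
    using assms unfolding closure_sequential by blast
  have "\<forall>n. \<exists>g. combo v u (y n) g" using combo_exists_left[OF y(1)] by blast
  then obtain g where g: "\<And>n. combo v u (y n) (g n)" unfolding choice_iff by blast
  have "\<exists>N. \<forall>m\<ge>N. \<forall>n\<ge>N. l2norm M (\<lambda>t. g m t - g n t) < e" if "e > 0" for e
    using metric_CauchyD[OF LIMSEQ_imp_Cauchy[OF y(2)] that] by (simp add: combo_diff[OF g g] dist_norm)
  then obtain f where "f \<in> L2 M" "(\<lambda>n. l2norm M (\<lambda>t. g n t - f t)) \<longlonglongrightarrow> 0"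
    by (rule L2_complete[OF finite_measure_axioms combo_L2[OF g]])
  then show ?thesis using y g by (auto simp: limit_graph_def)
qed

lemma limit_graph_exists_left:
  assumes f: "f \<in> L2_closure M (fspan (range u))"
  shows "\<exists>x\<in>closure (cspan (range v)). limit_graph M v u x f"
proof -
  obtain g where g: "\<And>n. g n \<in> fspan (range u)" "(\<lambda>n. l2norm M (\<lambda>t. g n t - f t)) \<longlonglongrightarrow> 0"
    using L2_closure_sequence[OF f] by blast
  have "\<forall>n. \<exists>y. combo v u y (g n)" using combo_exists_right[OF g(1)] by blast
  then obtain y where y: "\<And>n. combo v u (y n) (g n)" unfolding choice_iff by blast
  have "Cauchy y"
    using L2_limit_Cauchy[OF combo_L2[OF y] L2_closureD[OF f] g(2)]
    by (intro metric_CauchyI) (simp add: combo_diff[OF y y] dist_norm)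
  then obtain x where x: "y \<longlonglongrightarrow> x" using Cauchy_convergent convergent_def by blast
  then have "x \<in> closure (cspan (range v))"
    using combo_in_cspan[OF y] unfolding closure_sequential by blast
  then show ?thesis using x y g L2_closureD[OF f] by (auto simp: limit_graph_def)
qed

lemma limit_graph_closure: "limit_graph M v u x f \<Longrightarrow> f \<in> L2_closure M (fspan (range u))"
  by (auto simp: limit_graph_def intro: L2_closure_of_limit[OF _ combo_in_fspan])

lemma limit_graph_AE_eq:
  assumes "limit_graph M v u x f" "g \<in> borel_measurable M" "AE t in M. f t = g t"
  shows "limit_graph M v u x g"
proof -
  obtain xs fs where 1: "\<And>n. combo v u (xs n) (fs n)" "xs \<longlonglongrightarrow> x" "(\<lambda>n. l2norm M (\<lambda>t. fs n t - f t)) \<longlonglongrightarrow> 0"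
    using assms(1) by (auto simp: limit_graph_def)
  have L: "f \<in> L2 M" using assms by (auto simp: limit_graph_def)
  have gL: "g \<in> L2 M" by (rule L2_AE_eq[OF L assms(2)]) (use assms(3) in auto)
  have "l2norm M (\<lambda>t. fs n t - g t) = l2norm M (\<lambda>t. fs n t - f t)" for n
    using assms(3) L2D(1)[OF L2_diff[OF combo_L2[OF 1(1)] L]] L2D(1)[OF L2_diff[OF combo_L2[OF 1(1)] gL]]
    by (intro l2norm_cong_AE) auto
  then show ?thesis using 1(3) by (intro limit_graphI[OF gL 1(1,2)]) simp
qed

text \<open>On combinations both \<open>V\<close> and multiplication by \<tau> act as the index
  shift \<open>s\<close>, the latter up to a null set; both are continuous, so this passes to
  limits.\<close>

lemma limit_graph_intertwine:
  assumes V: "isometry V" "\<And>i. V (v i) = v (s i)"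
    and \<tau>: "\<tau> \<in> borel_measurable M" "AE t in M. cmod (\<tau> t) = 1" "\<And>i. AE t in M. \<tau> t * u i t = u (s i) t"
    and x: "limit_graph M v u x f"
  shows "limit_graph M v u (V x) (\<lambda>t. \<tau> t * f t)"
proof -
  note linV = clinear_simps[OF isometry_clinear[OF V(1)]]
  have \<tau>1: "AE t in M. cmod (\<tau> t) \<le> 1" using \<tau>(2) by eventually_elim simp
  have step: "\<exists>g'. combo v u (V y) g' \<and> (AE t in M. \<tau> t * g t = g' t)" if "combo v u y g" for y g
    using that
  proof (induction rule: combo.induct)
    case zero
    then show ?case using combo.zero linV by (intro exI[of _ "\<lambda>t. 0"]) simp
  next
    case (add x f c i)
    then obtain g' where g': "combo v u (V x) g'" "AE t in M. \<tau> t * f t = g' t" by blast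
    have "AE t in M. \<tau> t * (c * u i t + f t) = c * u (s i) t + g' t"
      using g'(2) \<tau>(3)[of i] by eventually_elim (simp add: algebra_simps)
    then show ?case using combo.add[OF g'(1), of c "s i"] by (auto simp: linV V)
  qed
  obtain xs fs where 1: "\<And>n. combo v u (xs n) (fs n)" "xs \<longlonglongrightarrow> x" "(\<lambda>n. l2norm M (\<lambda>t. fs n t - f t)) \<longlonglongrightarrow> 0"
    using x by (auto simp: limit_graph_def)
  have L: "f \<in> L2 M" using x by (auto simp: limit_graph_def)
  have "\<forall>n. \<exists>g'. combo v u (V (xs n)) g' \<and> (AE t in M. \<tau> t * fs n t = g' t)" using step[OF 1(1)] by blast
  then obtain gs where gs: "\<And>n. combo v u (V (xs n)) (gs n)" "\<And>n. AE t in M. \<tau> t * fs n t = gs n t"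
    unfolding choice_iff by blast
  note L\<tau> = L2_mult[OF L \<tau>(1) \<tau>1]
  have "l2norm M (\<lambda>t. gs n t - \<tau> t * f t) \<le> l2norm M (\<lambda>t. fs n t - f t)" for n
  proof -
    have "l2norm M (\<lambda>t. gs n t - \<tau> t * f t) = l2norm M (\<lambda>t. \<tau> t * (fs n t - f t))"
    proof (rule l2norm_cong_AE)
      show "AE t in M. gs n t - \<tau> t * f t = \<tau> t * (fs n t - f t)"
        using gs(2)[of n] by eventually_elim (simp add: algebra_simps)
    qed (use L2D(1)[OF L2_diff[OF combo_L2[OF gs(1)] L\<tau>]] L2D(1)[OF L2_diff[OF combo_L2[OF 1(1)] L]] \<tau>(1) in auto)
    also have "\<dots> \<le> 1 * l2norm M (\<lambda>t. fs n t - f t)"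
      by (intro l2norm_mult_le L2_diff combo_L2[OF 1(1)] L \<tau> \<tau>1) simp
    finally show ?thesis by simp
  qed
  then have "(\<lambda>n. l2norm M (\<lambda>t. gs n t - \<tau> t * f t)) \<longlonglongrightarrow> 0"
    by (intro Lim_null_comparison[OF _ 1(3)] always_eventually) simp
  moreover have "(\<lambda>n. V (xs n)) \<longlonglongrightarrow> V x"
    by (intro bounded_linear.tendsto[OF isometry_bounded_linear[OF V(1)]] 1)
  ultimately show ?thesis by (intro limit_graphI[OF L\<tau> gs(1)])
qed

lemma ueq_L2_from_gram:
  assumes V1: "isometry V1" "\<And>i. V1 (v i) = v (s1 i)"
    and V2: "isometry V2" "\<And>i. V2 (v i) = v (s2 i)"
    and \<tau>1: "\<tau>1 \<in> borel_measurable M" "AE t in M. cmod (\<tau>1 t) = 1" "\<And>i. AE t in M. \<tau>1 t * u i t = u (s1 i) t"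
    and \<tau>2: "\<tau>2 \<in> borel_measurable M" "AE t in M. cmod (\<tau>2 t) = 1" "\<And>i. AE t in M. \<tau>2 t * u i t = u (s2 i) t"
    and inv: "\<And>x. x \<in> closure (cspan (range v)) \<Longrightarrow> V1 x \<in> closure (cspan (range v))"
      "\<And>x. x \<in> closure (cspan (range v)) \<Longrightarrow> V2 x \<in> closure (cspan (range v))"
    and K: "\<And>f. f \<in> L2_closure M (fspan (range u)) \<Longrightarrow> ae_in M f K" "K \<subseteq> L2_closure M (fspan (range u))"
    and T: "\<And>f. T1 f = (\<lambda>t. \<tau>1 t * f t)" "\<And>f. T2 f = (\<lambda>t. \<tau>2 t * f t)"
  shows "ueq_L2 M V1 V2 (closure (cspan (range v))) T1 T2 K"
proof -
  let ?S = "closure (cspan (range v))"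
  \<comment> \<open>\<open>K\<close> contains every element of the closed span only up to a null
    set, so the limit is replaced by a representative that lies in \<open>K\<close>.\<close>
  have "\<exists>f. limit_graph M v u x f \<and> f \<in> K" if xS: "x \<in> ?S" for x
  proof -
    obtain f where f: "limit_graph M v u x f" using limit_graph_exists_right[OF xS] by blast
    obtain g where g: "g \<in> K" "AE t in M. f t = g t"
      using K(1)[OF limit_graph_closure[OF f]] by (auto simp: ae_in_def)
    have "g \<in> borel_measurable M" using g(1) K(2) L2_closureD L2D(1) by blast
    then show ?thesis using limit_graph_AE_eq[OF f _ g(2)] g(1) by blast
  qed
  then have "\<forall>x. \<exists>f. x \<in> ?S \<longrightarrow> limit_graph M v u x f \<and> f \<in> K" by blast
  then obtain U where U: "\<And>x. x \<in> ?S \<Longrightarrow> limit_graph M v u x (U x)" "\<And>x. x \<in> ?S \<Longrightarrow> U x \<in> K"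
    unfolding choice_iff by blast
  have "\<exists>x\<in>?S. AE t in M. U x t = g t" if "g \<in> K" for g
  proof -
    obtain x where x: "x \<in> ?S" "limit_graph M v u x g"
      using limit_graph_exists_left K(2) \<open>g \<in> K\<close> by blast
    then show ?thesis using limit_graph_unique[OF U(1) x(2)] by blast
  qed
  \<comment> \<open>Both sides are limits attached to the same vector \<open>V1 x\<close>, hence
    agree almost everywhere.\<close>
  moreover have "AE t in M. U (V1 x) t = T1 (U x) t" if "x \<in> ?S" for x
    unfolding T by (rule limit_graph_unique[OF U(1)[OF inv(1)[OF that]]
        limit_graph_intertwine[OF V1(1) V1(2) \<tau>1 U(1)[OF that]]])
  moreover have "AE t in M. U (V2 x) t = T2 (U x) t" if "x \<in> ?S" for x
    unfolding T by (rule limit_graph_unique[OF U(1)[OF inv(2)[OF that]]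
        limit_graph_intertwine[OF V2(1) V2(2) \<tau>2 U(1)[OF that]]])
  ultimately show ?thesis
    unfolding ueq_L2_def using U limit_graph_inner[OF U(1) U(1)]
    by (intro exI[of _ U]) simp
qed

end

section \<open>Moments on the circle and the torus\<close>

lemma cis_measurable [measurable]: "cis \<in> borel_measurable borel"
  by (intro borel_measurable_continuous_onI continuous_intros)

lemma sets_circle_measure [simp, measurable_cong]: "sets circle_measure = sets borel"
  and space_circle_measure [simp]: "space circle_measure = UNIV"
  by (simp_all add: circle_measure_def)

lemma emeasure_circle_measure: "emeasure circle_measure UNIV = 1"
proof -
  have "emeasure (uniform_measure lborel {0..2*pi}) (space lborel) = 1"
    using emeasure_uniform_measure_1[of lborel "{0..2*pi}"] by simp
  then show ?thesis unfolding circle_measure_def by (subst emeasure_distr) auto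
qed

lemma finite_circle_measure: "finite_measure circle_measure"
  by (rule finite_measureI) (simp add: emeasure_circle_measure)

lemma AE_circle: "AE z in circle_measure. cmod z = 1"
  unfolding circle_measure_def by (subst AE_distr_iff) auto

lemma integral_circle:
  fixes f :: "complex \<Rightarrow> complex"
  assumes [measurable]: "f \<in> borel_measurable borel"
  shows "integral\<^sup>L circle_measure f = (\<integral>t. indicator {0..2*pi} t *\<^sub>R f (cis t) \<partial>lborel) / (2 * pi)"
proof -
  have eq: "uniform_measure lborel {0..2*pi} = density lborel (\<lambda>t. ennreal (indicator {0..2*pi} t / (2*pi)))"
    unfolding uniform_measure_def
    using divide_ennreal[of 1 "2*pi"] pi_gt_zero
    by (intro arg_cong[of _ _ "density lborel"] ext) (auto split: split_indicator)
  have "integral\<^sup>L circle_measure f = integral\<^sup>L (uniform_measure lborel {0..2*pi}) (\<lambda>t. f (cis t))"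
    unfolding circle_measure_def by (rule integral_distr) auto
  also have "\<dots> = (\<integral>t. (indicator {0..2*pi} t / (2*pi)) *\<^sub>R f (cis t) \<partial>lborel)"
    unfolding eq by (rule integral_density) auto
  also have "\<dots> = (\<integral>t. (indicator {0..2*pi} t *\<^sub>R f (cis t)) / (2 * pi) \<partial>lborel)"
    by (intro Bochner_Integration.integral_cong) (auto simp: scaleR_conv_of_real)
  finally show ?thesis by simp
qed

lemma measurable_power_int [measurable (raw)]:
  fixes f :: "'t \<Rightarrow> complex"
  assumes [measurable]: "f \<in> borel_measurable M"
  shows "(\<lambda>x. f x powi n) \<in> borel_measurable M"
  by (cases "n \<ge> 0") (simp_all add: power_int_def)

lemma circle_moment: "(\<integral>z. z powi n \<partial>circle_measure) = (if n = 0 then 1 else 0)"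
proof -
  interpret finite_measure circle_measure by (rule finite_circle_measure)
  show ?thesis
  proof (cases "n = 0")
    case True
    then show ?thesis by (simp add: measure_def emeasure_circle_measure)
  next
    case False
    have "(\<integral>t. indicator {0..2*pi} t *\<^sub>R cis (of_int n * t) \<partial>lborel)
        = cis (of_int n * (2*pi)) / (\<i> * of_int n) - cis (of_int n * 0) / (\<i> * of_int n)"
    proof (rule integral_FTC_Icc)
      fix t :: real
      have "((\<lambda>z. exp (\<i> * of_int n * z) / (\<i> * of_int n)) has_field_derivative exp (\<i> * of_int n * of_real t)) (at (of_real t))"
        using False by (auto intro!: derivative_eq_intros)
      from has_vector_derivative_real_field[OF this] show "((\<lambda>x. cis (of_int n * x) / (\<i> * of_int n)) has_vector_derivative cis (of_int n * t)) (at t within {0..2*pi})"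
        by (simp add: cis_conv_exp mult.assoc)
    qed (auto intro!: continuous_intros)
    moreover have "cis (of_int n * (2 * pi)) = 1"
      using cis_multiple_2pi[of "of_int n"] by (simp add: mult.commute mult.left_commute)
    ultimately show ?thesis
      using False by (subst integral_circle) (auto simp: cis_power_int)
  qed
qed

section \<open>Product measure, Laurent monomials and Poisson integrals on the torus\<close>

interpretation circle: finite_measure circle_measure by (rule finite_circle_measure)
interpretation torus: pair_sigma_finite circle_measure circle_measure by unfold_locales

lemma sets_torus_measure [simp, measurable_cong]: "sets torus_measure = sets borel"
  unfolding torus_measure_def
  by (metis borel_prod sets_circle_measure sets_pair_measure_cong)

lemma space_torus_measure [simp]: "space torus_measure = UNIV"
  by (simp add: torus_measure_def space_pair_measure)

lemma emeasure_torus_measure: "emeasure torus_measure UNIV = 1"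
  using circle.emeasure_pair_measure_Times[of UNIV circle_measure UNIV]
  by (simp add: torus_measure_def emeasure_circle_measure)

lemma finite_torus_measure: "finite_measure torus_measure"
  by (rule finite_measureI) (simp add: emeasure_torus_measure)

interpretation torus_finite: finite_measure torus_measure by (rule finite_torus_measure)

text \<open>\<open>torus_measure\<close> is a measure on all pairs of complex numbers; identities
  that rest on unimodularity are proved on this set of full measure.\<close>

definition torus :: "(complex \<times> complex) set" where
  "torus = {x. cmod (fst x) = 1 \<and> cmod (snd x) = 1}"

lemma torus_nonzero: "x \<in> torus \<Longrightarrow> fst x \<noteq> 0 \<and> snd x \<noteq> 0"
  by (auto simp: torus_def)

lemma closed_torus: "closed torus"
  unfolding torus_def by (intro closed_Collect_conj closed_Collect_eq continuous_intros)

lemma AE_torus: "AE x in torus_measure. x \<in> torus"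
  unfolding torus_measure_def
proof (rule torus.AE_pair_measure)
  have "torus \<in> sets borel" by (intro borel_closed closed_torus)
  then have "{x \<in> space torus_measure. x \<in> torus} \<in> sets torus_measure" by simp
  then show "{x \<in> space (circle_measure \<Otimes>\<^sub>M circle_measure). x \<in> torus} \<in> sets (circle_measure \<Otimes>\<^sub>M circle_measure)"
    by (simp only: torus_measure_def)
  show "AE x in circle_measure. AE y in circle_measure. (x, y) \<in> torus"
    using AE_circle by eventually_elim (use AE_circle in \<open>auto simp: torus_def elim: eventually_mono\<close>)
qed

lemma AE_torusI: "(\<And>x. x \<in> torus \<Longrightarrow> P x) \<Longrightarrow> AE x in torus_measure. P x"
  using AE_torus by (rule eventually_mono)

lemma torus_measurable [measurable]: "fst \<in> borel_measurable torus_measure" "snd \<in> borel_measurable torus_measure"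
  by (simp_all add: measurable_cong_sets[OF sets_torus_measure refl] borel_measurable_continuous_onI continuous_on_fst continuous_on_snd continuous_on_id)

lemma integrable_torus:
  fixes f :: "complex \<times> complex \<Rightarrow> 'b::{banach, second_countable_topology}"
  assumes "f \<in> borel_measurable torus_measure" "\<And>x. x \<in> torus \<Longrightarrow> norm (f x) \<le> B"
  shows "integrable torus_measure f"
  by (rule torus_finite.integrable_const_bound[of _ B]) (use AE_torus assms in \<open>auto elim: eventually_mono\<close>)

lemma integral_torus_cong:
  fixes f :: "complex \<times> complex \<Rightarrow> 'b::{banach, second_countable_topology}"
  assumes "f \<in> borel_measurable torus_measure" "g \<in> borel_measurable torus_measure" "\<And>x. x \<in> torus \<Longrightarrow> f x = g x"
  shows "integral\<^sup>L torus_measure f = integral\<^sup>L torus_measure g"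
  by (rule integral_cong_AE) (use AE_torus assms in \<open>auto elim: eventually_mono\<close>)

text \<open>Laurent monomials: conjugation inverts the coordinates on the torus, so integer
  exponents absorb the conjugation in inner products.\<close>

definition tmono :: "int \<Rightarrow> int \<Rightarrow> complex \<times> complex \<Rightarrow> complex" where
  "tmono a b x = fst x powi a * snd x powi b"

lemma tmono_measurable [measurable]: "tmono a b \<in> borel_measurable torus_measure"
  unfolding tmono_def by measurable

lemma norm_tmono: "x \<in> torus \<Longrightarrow> cmod (tmono a b x) = 1"
  by (simp add: tmono_def torus_def norm_mult norm_power_int)

lemma tmono_add: "x \<in> torus \<Longrightarrow> tmono (a + c) (b + d) x = tmono a b x * tmono c d x"
  using torus_nonzero[of x] by (simp add: tmono_def power_int_add)

lemma cnj_torus: "x \<in> torus \<Longrightarrow> cnj (fst x) = inverse (fst x)" "x \<in> torus \<Longrightarrow> cnj (snd x) = inverse (snd x)"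
  using complex_div_cnj[of 1 "fst x"] complex_div_cnj[of 1 "snd x"] by (simp_all add: torus_def divide_inverse)

lemma cnj_tmono: "x \<in> torus \<Longrightarrow> cnj (tmono a b x) = tmono (- a) (- b) x"
  by (simp add: tmono_def cnj_torus power_int_minus power_int_inverse)

lemma tmono_0 [simp]: "tmono 0 0 x = 1"
  by (simp add: tmono_def)

lemma tmono_nat: "tmono (int m) (int n) x = fst x ^ m * snd x ^ n"
  by (simp add: tmono_def)

lemma tmono_power: "x \<in> torus \<Longrightarrow> tmono s t x ^ k = tmono (int k * s) (int k * t) x"
  by (simp add: tmono_def power_mult_distrib power_int_power' mult.commute[of s] mult.commute[of t])

lemma torus_moment: "integral\<^sup>L torus_measure (tmono a b) = (if a = 0 \<and> b = 0 then 1 else 0)"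
proof -
  have int: "integrable (circle_measure \<Otimes>\<^sub>M circle_measure) (tmono a b)"
    unfolding torus_measure_def[symmetric] by (rule integrable_torus[of _ 1]) (simp_all add: norm_tmono)
  have "integral\<^sup>L torus_measure (tmono a b) = (\<integral>z. \<integral>w. z powi a * w powi b \<partial>circle_measure \<partial>circle_measure)"
    using torus.integral_fst'[OF int] by (simp add: torus_measure_def tmono_def)
  then show ?thesis by (simp add: circle_moment)
qed

text \<open>The geometric series has terms of modulus q^k on the torus and may be integrated
  termwise; \<open>torus_moment\<close> keeps only those k at which both exponents vanish.\<close>

lemma torus_geometric_moment:
  fixes q :: real
  assumes q: "0 \<le> q" "q < 1"
  shows "(\<lambda>k. complex_of_real (q ^ k) * (if a + int k * s = 0 \<and> b + int k * t = 0 then 1 else 0))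
    sums (\<integral>x. tmono a b x / (1 - complex_of_real q * tmono s t x) \<partial>torus_measure)"
proof -
  define f where "f k x = complex_of_real (q ^ k) * (tmono a b x * tmono s t x ^ k)" for k x
  have fm [measurable]: "f k \<in> borel_measurable torus_measure" for k unfolding f_def by measurable
  have nf: "cmod (f k x) = q ^ k" if "x \<in> torus" for k x
    using that q by (simp add: f_def norm_mult norm_power norm_tmono)
  have fint: "integrable torus_measure (f k)" for k
    by (rule integrable_torus[of _ "q ^ k"]) (simp_all add: nf)
  have sum: "(\<Sum>k. f k x) = tmono a b x / (1 - complex_of_real q * tmono s t x)" if x: "x \<in> torus" for x
  proof -
    have "cmod (complex_of_real q * tmono s t x) < 1" using q x by (simp add: norm_mult norm_tmono)
    from sums_mult[OF geometric_sums[OF this], of "tmono a b x"]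
    have "(\<lambda>k. f k x) sums (tmono a b x * (1 / (1 - complex_of_real q * tmono s t x)))"
      by (simp add: f_def power_mult_distrib mult_ac)
    then show ?thesis by (simp add: sums_iff)
  qed
  have nfi: "(\<integral>x. norm (f k x) \<partial>torus_measure) = q ^ k" for k
  proof -
    have "(\<integral>x. norm (f k x) \<partial>torus_measure) = (\<integral>x. q ^ k \<partial>torus_measure)"
      by (rule integral_torus_cong) (simp_all add: nf)
    then show ?thesis by (simp add: measure_def emeasure_torus_measure)
  qed
  have "(\<lambda>k. integral\<^sup>L torus_measure (f k)) sums (\<integral>x. (\<Sum>k. f k x) \<partial>torus_measure)"
  proof (rule sums_integral[OF fint])
    show "AE x in torus_measure. summable (\<lambda>k. norm (f k x))"
      using AE_torus by eventually_elim (use q in \<open>simp add: nf summable_geometric\<close>)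
    show "summable (\<lambda>k. \<integral>x. norm (f k x) \<partial>torus_measure)"
      unfolding nfi using q by (intro summable_geometric) simp
  qed
  moreover have "integral\<^sup>L torus_measure (f k) = complex_of_real (q ^ k) * (if a + int k * s = 0 \<and> b + int k * t = 0 then 1 else 0)" for k
  proof -
    have "integral\<^sup>L torus_measure (f k) = (\<integral>x. complex_of_real (q ^ k) * tmono (a + int k * s) (b + int k * t) x \<partial>torus_measure)"
      by (rule integral_torus_cong) (auto simp: f_def tmono_power tmono_add)
    then show ?thesis by (simp add: torus_moment)
  qed
  moreover have "(\<integral>x. (\<Sum>k. f k x) \<partial>torus_measure) = (\<integral>x. tmono a b x / (1 - complex_of_real q * tmono s t x) \<partial>torus_measure)"
    by (rule integral_torus_cong) (auto simp: sum)
  ultimately show ?thesis by simp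
qed

text \<open>The Poisson kernel as the sum of v^k over k \<ge> 0 and of \<open>cnj v\<close> ^ k over
  k \<ge> 1, both in closed form.\<close>

lemma poisson_kernel_eq:
  fixes v :: complex
  assumes "cmod v < 1"
  shows "complex_of_real ((1 - (cmod v)\<^sup>2) / (cmod (1 - v))\<^sup>2) = 1 / (1 - v) + cnj v / (1 - cnj v)"
proof -
  have nz: "1 - v \<noteq> 0" "1 - cnj v \<noteq> 0" using assms by (auto simp: complex_cnj_cancel_iff[of 1 v, simplified])
  have "complex_of_real ((1 - (cmod v)\<^sup>2) / (cmod (1 - v))\<^sup>2) = (1 - v * cnj v) / ((1 - v) * (1 - cnj v))"
    using complex_norm_square[of v] complex_norm_square[of "1 - v"] by simp
  also have "\<dots> = 1 / (1 - v) + cnj v / (1 - cnj v)" using nz by (simp add: field_simps)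
  finally show ?thesis .
qed

text \<open>The general direction (s, t) serves two kernels: (N, N) for estimating where (z w)^N is
  near 1, and (1, -1) for the density of the model. The conjugate half of the kernel is the
  geometric moment in direction (-s, -t), shifted by one step.\<close>

lemma poisson_moment:
  fixes q :: real
  assumes q: "0 \<le> q" "q < 1" and st: "(s, t) \<noteq> (0, 0)"
  shows "(\<integral>x. tmono a b x * complex_of_real ((1 - q\<^sup>2) / (cmod (1 - complex_of_real q * tmono s t x))\<^sup>2) \<partial>torus_measure)
    = (\<Sum>k. complex_of_real (q ^ k) * (if a + int k * s = 0 \<and> b + int k * t = 0 then 1 else 0))
      + (\<Sum>k. complex_of_real (q ^ Suc k) * (if a - int (Suc k) * s = 0 \<and> b - int (Suc k) * t = 0 then 1 else 0))"
proof -
  have nz: "cmod (1 - complex_of_real q * tmono s t x) \<ge> 1 - q" if "x \<in> torus" for s t x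
    using norm_triangle_ineq2[of 1 "complex_of_real q * tmono s t x"] q that by (simp add: norm_mult norm_tmono)
  have int: "integrable torus_measure (\<lambda>x. tmono a b x / (1 - complex_of_real q * tmono s t x))" for a b s t
  proof (rule integrable_torus[of _ "1 / (1 - q)"])
    fix x assume x: "x \<in> torus"
    then show "norm (tmono a b x / (1 - complex_of_real q * tmono s t x)) \<le> 1 / (1 - q)"
      using nz[OF x, of s t] q by (simp add: norm_divide norm_tmono frac_le)
  qed simp
  have "(\<integral>x. tmono a b x * complex_of_real ((1 - q\<^sup>2) / (cmod (1 - complex_of_real q * tmono s t x))\<^sup>2) \<partial>torus_measure)
    = (\<integral>x. tmono a b x / (1 - complex_of_real q * tmono s t x)
        + complex_of_real q * (tmono (a - s) (b - t) x / (1 - complex_of_real q * tmono (- s) (- t) x)) \<partial>torus_measure)"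
  proof (rule integral_torus_cong)
    fix x assume x: "x \<in> torus"
    define v where "v = complex_of_real q * tmono s t x"
    have v: "cmod v = q" using q x by (simp add: v_def norm_mult norm_tmono)
    have cv: "cnj v = complex_of_real q * tmono (- s) (- t) x" using x by (simp add: v_def cnj_tmono)
    have "tmono (a - s) (b - t) x = tmono a b x * tmono (- s) (- t) x" using tmono_add[OF x, of a "- s" b "- t"] by simp
    then show "tmono a b x * complex_of_real ((1 - q\<^sup>2) / (cmod (1 - complex_of_real q * tmono s t x))\<^sup>2)
      = tmono a b x / (1 - complex_of_real q * tmono s t x)
        + complex_of_real q * (tmono (a - s) (b - t) x / (1 - complex_of_real q * tmono (- s) (- t) x))"
      using poisson_kernel_eq[of v] v q unfolding cv[symmetric] v_def[symmetric]
      by (simp add: cv distrib_left mult_ac)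
  qed measurable
  also have "\<dots> = (\<integral>x. tmono a b x / (1 - complex_of_real q * tmono s t x) \<partial>torus_measure)
      + complex_of_real q * (\<integral>x. tmono (a - s) (b - t) x / (1 - complex_of_real q * tmono (- s) (- t) x) \<partial>torus_measure)"
    by (subst Bochner_Integration.integral_add[OF int integrable_mult_right[OF int]])
      (simp only: integral_mult_right_zero)
  also have "\<dots> = (\<Sum>k. complex_of_real (q ^ k) * (if a + int k * s = 0 \<and> b + int k * t = 0 then 1 else 0))
      + complex_of_real q * (\<Sum>k. complex_of_real (q ^ k) * (if a - s + int k * (- s) = 0 \<and> b - t + int k * (- t) = 0 then 1 else 0))"
    using sums_unique[OF torus_geometric_moment[OF q]] by simp
  also have "complex_of_real q * (\<Sum>k. complex_of_real (q ^ k) * (if a - s + int k * (- s) = 0 \<and> b - t + int k * (- t) = 0 then 1 else 0))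
    = (\<Sum>k. complex_of_real q * (complex_of_real (q ^ k) * (if a - s + int k * (- s) = 0 \<and> b - t + int k * (- t) = 0 then 1 else 0)))"
    by (rule suminf_mult[symmetric]) (rule sums_summable[OF torus_geometric_moment[OF q]])
  also have "\<dots> = (\<Sum>k. complex_of_real (q ^ Suc k) * (if a - int (Suc k) * s = 0 \<and> b - int (Suc k) * t = 0 then 1 else 0))"
    by (intro arg_cong[of _ _ suminf] ext) (simp add: algebra_simps)
  finally show ?thesis .
qed

section \<open>An inner function vanishing on w = \<lambda>z\<close>

definition monomials :: "(complex \<times> complex \<Rightarrow> complex) set" where
  "monomials = {(\<lambda>(z, w). z ^ j * w ^ l) | j l. True}"

lemma H2_bidisc_eq: "H2_bidisc = L2_closure torus_measure (fspan monomials)"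
  by (simp add: H2_bidisc_def monomials_def)

lemma monomialsI: "(\<lambda>x. fst x ^ j * snd x ^ l) \<in> monomials"
  unfolding monomials_def by (auto simp: case_prod_unfold)

lemma monomialsE:
  assumes "a \<in> monomials" obtains j l where "a = (\<lambda>x. fst x ^ j * snd x ^ l)"
  using assms by (auto simp: monomials_def case_prod_unfold)

lemma monomials_eq: "monomials = range (\<lambda>p x. fst x ^ fst p * snd x ^ snd p)"
proof
  show "monomials \<subseteq> range (\<lambda>p x. fst x ^ fst p * snd x ^ snd p)"
  proof
    fix a assume "a \<in> monomials"
    then obtain j l where "a = (\<lambda>x. fst x ^ j * snd x ^ l)" by (rule monomialsE)
    then show "a \<in> range (\<lambda>p x. fst x ^ fst p * snd x ^ snd p)"
      by (intro image_eqI[of _ _ "(j, l)"]) auto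
  qed
qed (auto intro: monomialsI)

lemma bounded_L2_torus:
  assumes "f \<in> borel_measurable torus_measure" "AE x in torus_measure. cmod (f x) \<le> B"
  shows "f \<in> L2 torus_measure"
proof -
  have "(\<lambda>x. 1) \<in> L2 torus_measure" by (simp add: L2_def)
  from L2_mult[OF this assms] show ?thesis by simp
qed

lemma monomials_L2: "monomials \<subseteq> L2 torus_measure"
proof
  fix a assume "a \<in> monomials"
  then obtain j l where a: "a = (\<lambda>x. fst x ^ j * snd x ^ l)" by (rule monomialsE)
  show "a \<in> L2 torus_measure"
  proof (rule bounded_L2_torus[of _ 1])
    show "AE x in torus_measure. cmod (a x) \<le> 1"
      using AE_torus by eventually_elim (simp add: a torus_def norm_mult norm_power)
  qed (simp add: a)
qed

lemma fspan_monomials_mult: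
  assumes p: "p \<in> fspan monomials" and q: "q \<in> fspan monomials"
  shows "(\<lambda>x. p x * q x) \<in> fspan monomials"
proof -
  have 1: "(\<lambda>x. a x * q x) \<in> fspan monomials" if a: "a \<in> monomials" for a
    using q
  proof (induction rule: fspan_induct)
    case zero
    then show ?case using fspan_0 by simp
  next
    case (add g c b)
    obtain j l where a': "a = (\<lambda>x. fst x ^ j * snd x ^ l)" using a by (rule monomialsE)
    obtain j' l' where b': "b = (\<lambda>x. fst x ^ j' * snd x ^ l')" using add by (auto elim: monomialsE)
    have "(\<lambda>x. a x * b x) \<in> monomials"
      using monomialsI[of "j + j'" "l + l'"] by (simp add: a' b' power_add mult_ac)
    then have "(\<lambda>x. c * (a x * b x) + a x * g x) \<in> fspan monomials"
      by (intro fspan_add[OF fspan_cmult[OF fspan_base]] add)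
    then show ?case by (simp add: algebra_simps)
  qed
  show ?thesis using p
  proof (induction rule: fspan_induct)
    case zero
    then show ?case using fspan_0 by simp
  next
    case (add g c a)
    have "(\<lambda>x. c * (a x * q x) + g x * q x) \<in> fspan monomials"
      by (intro fspan_add[OF fspan_cmult[OF 1]] add)
    then show ?case by (simp add: algebra_simps)
  qed
qed

section \<open>Uniform limits of polynomials on the torus\<close>

lemma fspan_monomials_bounded:
  assumes "p \<in> fspan monomials" shows "\<exists>B. \<forall>x\<in>torus. cmod (p x) \<le> B"
  using assms
proof (induction rule: fspan_induct)
  case (add g c a)
  then obtain B where B: "\<forall>x\<in>torus. cmod (g x) \<le> B" by blast
  obtain j l where a: "a = (\<lambda>x. fst x ^ j * snd x ^ l)" using add by (auto elim: monomialsE)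
  have "cmod (c * a x + g x) \<le> cmod c + B" if "x \<in> torus" for x
  proof -
    have "cmod (c * a x) = cmod c" using that by (simp add: a torus_def norm_mult norm_power)
    then show ?thesis using norm_triangle_ineq[of "c * a x" "g x"] B that by fastforce
  qed
  then show ?case by blast
qed auto

lemma fspan_monomials_measurable: "p \<in> fspan monomials \<Longrightarrow> p \<in> borel_measurable torus_measure"
  using fspan_L2[OF monomials_L2] L2D(1) by blast

text \<open>The bidisc algebra seen on the torus. It is closed under products, exponentials and
  geometric series, so membership in H^2 of functions built by these operations is obtained through
  it.\<close>

definition bidisc_algebra :: "(complex \<times> complex \<Rightarrow> complex) set" where
  "bidisc_algebra = {f \<in> borel_measurable torus_measure.
     \<forall>e>0. \<exists>p\<in>fspan monomials. \<forall>x\<in>torus. cmod (f x - p x) < e}"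

lemma bidisc_algebra_measurable: "f \<in> bidisc_algebra \<Longrightarrow> f \<in> borel_measurable torus_measure"
  by (simp add: bidisc_algebra_def)

lemma bidisc_algebra_polynomial: "p \<in> fspan monomials \<Longrightarrow> p \<in> bidisc_algebra"
  unfolding bidisc_algebra_def using fspan_monomials_measurable by (auto intro!: bexI[of _ p])

lemma bidisc_algebra_uniform_limit:
  assumes "f \<in> borel_measurable torus_measure" "\<And>e. e > 0 \<Longrightarrow> \<exists>g\<in>bidisc_algebra. \<forall>x\<in>torus. cmod (f x - g x) < e"
  shows "f \<in> bidisc_algebra"
  unfolding bidisc_algebra_def
proof (intro CollectI conjI allI impI assms(1))
  fix e :: real assume "e > 0"
  then obtain g where g: "g \<in> bidisc_algebra" "\<forall>x\<in>torus. cmod (f x - g x) < e / 2"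
    using assms(2)[of "e / 2"] by auto
  then obtain p where p: "p \<in> fspan monomials" "\<forall>x\<in>torus. cmod (g x - p x) < e / 2"
    using \<open>e > 0\<close> half_gt_zero unfolding bidisc_algebra_def by blast
  have "cmod (f x - p x) < e" if "x \<in> torus" for x
    using g(2) p(2) that norm_triangle_ineq[of "f x - g x" "g x - p x"] by fastforce
  then show "\<exists>p\<in>fspan monomials. \<forall>x\<in>torus. cmod (f x - p x) < e" using p by blast
qed

lemma bidisc_algebra_cong:
  assumes "f \<in> bidisc_algebra" "g \<in> borel_measurable torus_measure" "\<And>x. x \<in> torus \<Longrightarrow> g x = f x"
  shows "g \<in> bidisc_algebra"
  by (rule bidisc_algebra_uniform_limit[OF assms(2)]) (use assms in \<open>auto intro!: bexI[of _ f]\<close>)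

lemma bidisc_algebra_bounded: "f \<in> bidisc_algebra \<Longrightarrow> \<exists>B. \<forall>x\<in>torus. cmod (f x) \<le> B"
proof -
  assume "f \<in> bidisc_algebra"
  then obtain p where p: "p \<in> fspan monomials" "\<forall>x\<in>torus. cmod (f x - p x) < 1"
    unfolding bidisc_algebra_def using zero_less_one by blast
  then obtain B where "\<forall>x\<in>torus. cmod (p x) \<le> B" using fspan_monomials_bounded by blast
  then have "cmod (f x) \<le> B + 1" if "x \<in> torus" for x
    using p(2) that norm_triangle_ineq[of "f x - p x" "p x"] by fastforce
  then show ?thesis by blast
qed

lemma bidisc_algebra_add:
  assumes "f \<in> bidisc_algebra" "g \<in> bidisc_algebra" shows "(\<lambda>x. f x + g x) \<in> bidisc_algebra"
proof (rule bidisc_algebra_uniform_limit)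
  fix e :: real assume "e > 0"
  then have e2: "e / 2 > 0" by simp
  obtain p where p: "p \<in> fspan monomials" "\<forall>x\<in>torus. cmod (f x - p x) < e / 2"
    using assms(1) e2 unfolding bidisc_algebra_def by blast
  obtain q where q: "q \<in> fspan monomials" "\<forall>x\<in>torus. cmod (g x - q x) < e / 2"
    using assms(2) e2 unfolding bidisc_algebra_def by blast
  have "cmod ((f x + g x) - (p x + q x)) < e" if "x \<in> torus" for x
    using p(2) q(2) that norm_diff_triangle_ineq[of "f x" "g x" "p x" "q x"] by fastforce
  then show "\<exists>h\<in>bidisc_algebra. \<forall>x\<in>torus. cmod (f x + g x - h x) < e"
    using p q by (intro bexI[of _ "\<lambda>x. p x + q x"] bidisc_algebra_polynomial fspan_add) auto
qed (use assms bidisc_algebra_measurable in auto)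

lemma bidisc_algebra_mult:
  assumes "f \<in> bidisc_algebra" "g \<in> bidisc_algebra" shows "(\<lambda>x. f x * g x) \<in> bidisc_algebra"
proof (rule bidisc_algebra_uniform_limit)
  fix e :: real assume "e > 0"
  obtain A where A: "\<forall>x\<in>torus. cmod (f x) \<le> A" using bidisc_algebra_bounded[OF assms(1)] by blast
  obtain B where B: "\<forall>x\<in>torus. cmod (g x) \<le> B" using bidisc_algebra_bounded[OF assms(2)] by blast
  \<comment> \<open>The extra 1 leaves room for |q| \<le> |g| + d with d \<le> 1, so one constant
    bounds both \<open>f\<close> and the approximant of \<open>g\<close>.\<close>
  define C where "C = max A 0 + max B 0 + 1"
  have C: "C \<ge> 1" "\<forall>x\<in>torus. cmod (f x) \<le> C" "\<forall>x\<in>torus. cmod (g x) \<le> C - 1"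
    using A B by (force simp: C_def)+
  define d where "d = min 1 (e / (2 * C))"
  have d: "d > 0" "d \<le> 1" "2 * C * d \<le> e" using \<open>e > 0\<close> C(1) by (auto simp: d_def min_def field_simps)
  obtain p where p: "p \<in> fspan monomials" "\<forall>x\<in>torus. cmod (f x - p x) < d"
    using assms(1) d unfolding bidisc_algebra_def by blast
  obtain q where q: "q \<in> fspan monomials" "\<forall>x\<in>torus. cmod (g x - q x) < d"
    using assms(2) d unfolding bidisc_algebra_def by blast
  have "cmod (f x * g x - p x * q x) < e" if x: "x \<in> torus" for x
  proof -
    have "cmod (q x) \<le> C" using C(3) q(2) x d norm_triangle_ineq2[of "q x" "g x"] norm_minus_commute[of "q x" "g x"] by fastforce
    have "f x * g x - p x * q x = f x * (g x - q x) + (f x - p x) * q x" by (simp add: algebra_simps)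
    then have "cmod (f x * g x - p x * q x) \<le> cmod (f x) * cmod (g x - q x) + cmod (f x - p x) * cmod (q x)"
      by (metis norm_mult norm_triangle_ineq)
    also have "\<dots> < C * d + d * C"
    proof (rule add_le_less_mono)
      show "cmod (f x) * cmod (g x - q x) \<le> C * d" using C q x by (intro mult_mono) (auto intro: less_imp_le)
      have "cmod (f x - p x) * cmod (q x) \<le> cmod (f x - p x) * C" using \<open>cmod (q x) \<le> C\<close> by (intro mult_left_mono) auto
      also have "\<dots> < d * C" using p x C by (intro mult_strict_right_mono) auto
      finally show "cmod (f x - p x) * cmod (q x) < d * C" .
    qed
    finally show ?thesis using d by (simp add: mult_ac)
  qed
  then show "\<exists>h\<in>bidisc_algebra. \<forall>x\<in>torus. cmod (f x * g x - h x) < e"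
    using p q by (intro bexI[of _ "\<lambda>x. p x * q x"] bidisc_algebra_polynomial fspan_monomials_mult) auto
qed (use assms bidisc_algebra_measurable in auto)

lemma bidisc_algebra_const: "(\<lambda>x. c) \<in> bidisc_algebra"
  using bidisc_algebra_polynomial[OF fspan_cmult[OF fspan_base[OF monomialsI[of 0 0]], of c]] by simp

lemma bidisc_algebra_fst: "fst \<in> bidisc_algebra" and bidisc_algebra_snd: "snd \<in> bidisc_algebra"
  using bidisc_algebra_polynomial[OF fspan_base[OF monomialsI[of 1 0]]]
    bidisc_algebra_polynomial[OF fspan_base[OF monomialsI[of 0 1]]] by simp_all

lemma bidisc_algebra_power: "f \<in> bidisc_algebra \<Longrightarrow> (\<lambda>x. f x ^ n) \<in> bidisc_algebra"
  by (induction n) (simp_all add: bidisc_algebra_const bidisc_algebra_mult)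

lemma bidisc_algebra_sum: "(\<And>i. i \<in> I \<Longrightarrow> f i \<in> bidisc_algebra) \<Longrightarrow> (\<lambda>x. \<Sum>i\<in>I. f i x) \<in> bidisc_algebra"
  by (induction I rule: infinite_finite_induct) (simp_all add: bidisc_algebra_const bidisc_algebra_add)

lemma bidisc_algebra_suminf:
  assumes f: "\<And>n::nat. f n \<in> bidisc_algebra" "\<And>n x. x \<in> torus \<Longrightarrow> cmod (f n x) \<le> K n" and K: "summable K"
  shows "(\<lambda>x. \<Sum>n. f n x) \<in> bidisc_algebra"
proof (rule bidisc_algebra_uniform_limit)
  show "(\<lambda>x. \<Sum>n. f n x) \<in> borel_measurable torus_measure"
    using bidisc_algebra_measurable[OF f(1)] by (rule borel_measurable_suminf)
  fix e :: real assume e: "e > 0"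
  obtain N where N: "norm (\<Sum>i. K (i + N)) < e" using suminf_exist_split[OF e K] by blast
  have "cmod ((\<Sum>n. f n x) - (\<Sum>n<N. f n x)) < e" if x: "x \<in> torus" for x
  proof -
    have sf: "summable (\<lambda>n. cmod (f n x))"
      by (rule summable_comparison_test'[OF K, of 0]) (simp add: f(2)[OF x])
    have "cmod ((\<Sum>n. f n x) - (\<Sum>n<N. f n x)) = cmod (\<Sum>n. f (n + N) x)"
      using suminf_minus_initial_segment[OF summable_norm_cancel[OF sf], of N] by simp
    also have "\<dots> \<le> (\<Sum>n. cmod (f (n + N) x))"
      by (rule summable_norm) (use sf in \<open>simp add: summable_iff_shift[of "\<lambda>n. cmod (f n x)"]\<close>)
    also have "\<dots> \<le> (\<Sum>n. K (n + N))"
      by (rule suminf_le) (use sf K f(2)[OF x] in \<open>simp_all add: summable_iff_shift[of "\<lambda>n. cmod (f n x)"] summable_iff_shift[of K]\<close>)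
    also have "\<dots> < e" using N by simp
    finally show ?thesis .
  qed
  then show "\<exists>g\<in>bidisc_algebra. \<forall>x\<in>torus. cmod ((\<Sum>n. f n x) - g x) < e"
    by (intro bexI[of _ "\<lambda>x. \<Sum>n<N. f n x"] bidisc_algebra_sum f) auto
qed

lemma bidisc_algebra_exp:
  assumes f: "f \<in> bidisc_algebra" shows "(\<lambda>x. exp (f x)) \<in> bidisc_algebra"
proof -
  obtain B where B: "\<forall>x\<in>torus. cmod (f x) \<le> B" using bidisc_algebra_bounded[OF f] by blast
  have "(\<lambda>x. \<Sum>n. complex_of_real (inverse (fact n)) * f x ^ n) \<in> bidisc_algebra"
  proof (rule bidisc_algebra_suminf)
    show "summable (\<lambda>n. inverse (fact n) * B ^ n)" by (rule summable_exp)
    show "cmod (complex_of_real (inverse (fact n)) * f x ^ n) \<le> inverse (fact n) * B ^ n" if "x \<in> torus" for n x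
      using B that by (auto simp: norm_mult norm_power norm_inverse intro!: mult_left_mono power_mono)
  qed (intro bidisc_algebra_mult bidisc_algebra_const bidisc_algebra_power f)
  then show ?thesis by (simp add: exp_def scaleR_conv_of_real)
qed

lemma bidisc_algebra_inverse:
  assumes f: "f \<in> bidisc_algebra" "\<And>x. x \<in> torus \<Longrightarrow> cmod (f x) \<le> r" "r < 1"
  shows "(\<lambda>x. 1 / (1 - f x)) \<in> bidisc_algebra"
proof (rule bidisc_algebra_cong)
  have "(1, 1) \<in> torus" by (simp add: torus_def)
  then have r: "0 \<le> r" using f(2) norm_ge_zero order_trans by blast
  show "(\<lambda>x. \<Sum>n. f x ^ n) \<in> bidisc_algebra"
    by (rule bidisc_algebra_suminf[of _ "\<lambda>n. r ^ n"])
      (use f r in \<open>auto simp: norm_power intro!: bidisc_algebra_power power_mono summable_geometric\<close>)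
  show "1 / (1 - f x) = (\<Sum>n. f x ^ n)" if "x \<in> torus" for x
    using suminf_geometric[of "f x"] f(2)[OF that] f(3) by simp
  show "(\<lambda>x. 1 / (1 - f x)) \<in> borel_measurable torus_measure"
    using bidisc_algebra_measurable[OF f(1)] by measurable
qed

lemma bidisc_algebra_H2:
  assumes f: "f \<in> bidisc_algebra" shows "f \<in> H2_bidisc"
  unfolding H2_bidisc_eq L2_closure_def
proof (intro CollectI conjI allI impI)
  obtain B where B: "\<forall>x\<in>torus. cmod (f x) \<le> B" using bidisc_algebra_bounded[OF f] by blast
  show fL: "f \<in> L2 torus_measure"
    by (rule bounded_L2_torus[OF bidisc_algebra_measurable[OF f], of B]) (use AE_torus B in \<open>auto elim: eventually_mono\<close>)
  fix e :: real assume e: "e > 0"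
  then have e2: "e / 2 > 0" by simp
  obtain p where p: "p \<in> fspan monomials" "\<forall>x\<in>torus. cmod (f x - p x) < e / 2"
    using f e2 unfolding bidisc_algebra_def by blast
  have pL: "p \<in> L2 torus_measure" using p fspan_L2[OF monomials_L2] by blast
  have "(\<integral>x. (cmod (f x - p x))\<^sup>2 \<partial>torus_measure) \<le> (\<integral>x. (e / 2)\<^sup>2 \<partial>torus_measure)"
  proof (rule integral_mono_AE)
    show "AE x in torus_measure. (cmod (f x - p x))\<^sup>2 \<le> (e / 2)\<^sup>2"
      using AE_torus by eventually_elim (intro power_mono less_imp_le p(2)[rule_format] norm_ge_zero)
  qed (use L2D(2)[OF L2_diff[OF fL pL]] in auto)
  also have "\<dots> = (e / 2)\<^sup>2" by (simp add: measure_def emeasure_torus_measure)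
  finally have "l2norm torus_measure (\<lambda>x. f x - p x) \<le> e / 2"
    unfolding l2norm_sq[symmetric] by (rule power2_le_imp_le) (use e in simp)
  then show "\<exists>p\<in>fspan monomials. l2norm torus_measure (\<lambda>x. f x - p x) < e" using p e by (intro bexI[of _ p]) auto
qed

section \<open>Bounded boundary limits and the set where (zw)^N is close to 1\<close>

text \<open>Dominated convergence by a constant turns almost everywhere convergence into L^2
  convergence. This is how \<open>outer_fn q 1\<close> is reached from its approximants with r <
  1.\<close>

lemma H2_bidisc_bounded_limit:
  assumes f: "\<And>n::nat. f n \<in> bidisc_algebra" "\<And>n x. x \<in> torus \<Longrightarrow> cmod (f n x) \<le> B"
    and g: "g \<in> borel_measurable torus_measure" and lim: "AE x in torus_measure. (\<lambda>n. f n x) \<longlonglongrightarrow> g x"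
  shows "g \<in> H2_bidisc"
proof -
  have gB: "AE x in torus_measure. cmod (g x) \<le> B"
    using lim AE_torus
  proof eventually_elim
    fix x assume "(\<lambda>n. f n x) \<longlonglongrightarrow> g x" "x \<in> torus"
    then show "cmod (g x) \<le> B"
      using LIMSEQ_le_const2[OF tendsto_norm, of "\<lambda>n. f n x" "g x" B] f(2)[OF \<open>x \<in> torus\<close>] by blast
  qed
  have gL: "g \<in> L2 torus_measure" by (rule bounded_L2_torus[OF g gB])
  have [measurable]: "f n \<in> borel_measurable torus_measure" for n by (rule bidisc_algebra_measurable[OF f(1)])
  have "(\<lambda>n. \<integral>x. (cmod (f n x - g x))\<^sup>2 \<partial>torus_measure) \<longlonglongrightarrow> (\<integral>x. 0 \<partial>torus_measure)"
  proof (rule integral_dominated_convergence[where w = "\<lambda>x. (2 * B)\<^sup>2"])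
    show "AE x in torus_measure. (\<lambda>n. (cmod (f n x - g x))\<^sup>2) \<longlonglongrightarrow> 0"
      using lim
    proof eventually_elim
      fix x assume "(\<lambda>n. f n x) \<longlonglongrightarrow> g x"
      then have "(\<lambda>n. (cmod (f n x - g x))\<^sup>2) \<longlonglongrightarrow> (cmod (g x - g x))\<^sup>2" by (intro tendsto_intros)
      then show "(\<lambda>n. (cmod (f n x - g x))\<^sup>2) \<longlonglongrightarrow> 0" by simp
    qed
    show "AE x in torus_measure. norm ((cmod (f n x - g x))\<^sup>2) \<le> (2 * B)\<^sup>2" for n
      using gB AE_torus
    proof eventually_elim
      fix x assume "cmod (g x) \<le> B" "x \<in> torus"
      then have "cmod (f n x - g x) \<le> 2 * B" using f(2)[of x n] norm_triangle_ineq4[of "f n x" "g x"] by simp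
      from power_mono[OF this norm_ge_zero, of 2]
      show "norm ((cmod (f n x - g x))\<^sup>2) \<le> (2 * B)\<^sup>2" by simp
    qed
  qed (use g in auto)
  then have "(\<lambda>n. sqrt (\<integral>x. (cmod (f n x - g x))\<^sup>2 \<partial>torus_measure)) \<longlonglongrightarrow> sqrt 0"
    by (intro tendsto_real_sqrt) simp
  then have lim2: "(\<lambda>n. l2norm torus_measure (\<lambda>x. f n x - g x)) \<longlonglongrightarrow> 0"
    by (simp add: l2norm_def)
  show ?thesis unfolding H2_bidisc_eq
  proof (rule L2_closure_closed[OF fspan_L2[OF monomials_L2] gL])
    fix e :: real assume "e > 0"
    then obtain n where "l2norm torus_measure (\<lambda>x. f n x - g x) < e"
      using order_tendstoD(2)[OF lim2] by (auto simp: eventually_sequentially)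
    then show "\<exists>h\<in>L2_closure torus_measure (fspan monomials). l2norm torus_measure (\<lambda>x. g x - h x) < e"
      using bidisc_algebra_H2[OF f(1)[of n]] l2norm_minus_commute[of torus_measure g]
      by (intro bexI[of _ "f n"]) (simp_all add: H2_bidisc_eq)
  qed
qed

text \<open>The Poisson kernel has mean one and is at least 1/(4e) where |1 - v| < e, if its radius is 1 - e.\<close>
lemma measure_near_one:
  assumes N: "N > 0" and e: "0 < e" "e < 1"
  shows "measure torus_measure {x. cmod (1 - tmono (int N) (int N) x) < e} \<le> 4 * e"
proof -
  define q where "q = 1 - e"
  have q: "0 \<le> q" "q < 1" using e by (simp_all add: q_def)
  define u where "u x = (1 - q\<^sup>2) / (cmod (1 - complex_of_real q * tmono (int N) (int N) x))\<^sup>2" for x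
  have um [measurable]: "u \<in> borel_measurable torus_measure" unfolding u_def by measurable
  have low: "cmod (1 - complex_of_real q * tmono (int N) (int N) x) \<ge> 1 - q" if "x \<in> torus" for x
    using norm_triangle_ineq2[of 1 "complex_of_real q * tmono (int N) (int N) x"] q that by (simp add: norm_mult norm_tmono)
  have q2: "q\<^sup>2 \<le> 1" using q by (simp add: power_le_one)
  have u0: "0 \<le> u x" for x unfolding u_def using q2 by simp
  have int: "integrable torus_measure u"
  proof (rule integrable_torus[of _ "(1 - q\<^sup>2) / (1 - q)\<^sup>2"])
    fix x assume "x \<in> torus"
    from low[OF this] have "(1 - q)\<^sup>2 \<le> (cmod (1 - complex_of_real q * tmono (int N) (int N) x))\<^sup>2"
      using q by (intro power_mono) auto
    then show "norm (u x) \<le> (1 - q\<^sup>2) / (1 - q)\<^sup>2"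
      using u0[of x] q q2 by (auto simp: u_def intro!: divide_left_mono mult_pos_pos intro: less_le_trans[of 0 "(1 - q)\<^sup>2"])
  qed simp
  have "complex_of_real (\<integral>x. u x \<partial>torus_measure) = (\<integral>x. tmono 0 0 x * complex_of_real (u x) \<partial>torus_measure)"
    by simp
  also have "\<dots> = (\<Sum>k. complex_of_real (q ^ k) * (if 0 + int k * int N = 0 \<and> 0 + int k * int N = 0 then 1 else 0))
      + (\<Sum>k. complex_of_real (q ^ Suc k) * (if 0 - int (Suc k) * int N = 0 \<and> 0 - int (Suc k) * int N = 0 then 1 else 0))"
    unfolding u_def by (rule poisson_moment[OF q]) (use N in simp)
  also have "(\<lambda>k. complex_of_real (q ^ k) * (if 0 + int k * int N = 0 \<and> 0 + int k * int N = 0 then 1 else 0)) = (\<lambda>k. if k = 0 then 1 else 0)"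
    using N by (auto simp: fun_eq_iff)
  also have "(\<lambda>k. complex_of_real (q ^ Suc k) * (if 0 - int (Suc k) * int N = 0 \<and> 0 - int (Suc k) * int N = 0 then 1 else 0)) = (\<lambda>k. 0)"
    using N by (auto simp: fun_eq_iff)
  also have "(\<Sum>k. if k = (0::nat) then 1 else 0) + (\<Sum>k. 0) = (1::complex)"
    using sums_unique[OF sums_single[of 0 "\<lambda>_. 1::complex"]] by simp
  finally have one: "(\<integral>x. u x \<partial>torus_measure) = 1" by simp
  have sub: "u x \<ge> 1 / (4 * e)" if "x \<in> torus" "cmod (1 - tmono (int N) (int N) x) < e" for x
  proof -
    let ?v = "tmono (int N) (int N) x"
    have "1 - complex_of_real q * ?v = (1 - ?v) + complex_of_real e * ?v" by (simp add: q_def algebra_simps)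
    then have "cmod (1 - complex_of_real q * ?v) \<le> cmod (1 - ?v) + cmod (complex_of_real e * ?v)"
      using norm_triangle_ineq by metis
    then have le: "cmod (1 - complex_of_real q * ?v) \<le> 2 * e"
      using that e by (simp add: norm_mult norm_tmono)
    have pos: "cmod (1 - complex_of_real q * ?v) > 0" using low[OF that(1)] q by linarith
    have "1 / (4 * e) = e / (2 * e)\<^sup>2" using e by (simp add: power2_eq_square)
    also have "\<dots> \<le> e / (cmod (1 - complex_of_real q * ?v))\<^sup>2"
      by (intro divide_left_mono power_mono le less_imp_le[OF e(1)] mult_pos_pos) (use e pos in auto)
    also have "\<dots> \<le> u x"
    proof -
      have "e \<le> 1 - q\<^sup>2" using e by (simp add: q_def power2_eq_square algebra_simps)
      then show ?thesis unfolding u_def by (intro divide_right_mono) auto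
    qed
    finally show ?thesis .
  qed
  have "measure torus_measure {x. cmod (1 - tmono (int N) (int N) x) < e} \<le> measure torus_measure {x \<in> space torus_measure. u x \<ge> 1 / (4 * e)}"
  proof (rule torus_finite.finite_measure_mono_AE)
    show "AE x in torus_measure. x \<in> {x. cmod (1 - tmono (int N) (int N) x) < e} \<longrightarrow> x \<in> {x \<in> space torus_measure. u x \<ge> 1 / (4 * e)}"
      using AE_torus by eventually_elim (use sub in auto)
  qed measurable
  also have "\<dots> \<le> (\<integral>x. u x \<partial>torus_measure) / (1 / (4 * e))"
    by (rule integral_Markov_inequality_measure[OF int]) (use u0 e in \<open>auto simp: sets_torus_measure\<close>)
  finally show ?thesis by (simp add: one)
qed

text \<open>Adding -2 p u^k / (1 - u^k) with u = zw and a real trigonometric polynomial p in z/w of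
  degree at most k produces an analytic function whose real part on the torus is p, since
  Re (v / (1 - v)) = -1/2 for unimodular v (in Rudin's terms: p minus p times a singular measure has
  spectrum in the two quadrants).  Applied to p = (q^N / N) (1 + Re ((z/w)^N)), this gives the terms below, whose
  sum at r = 1 has real part log (1 - q) + log \<bar>1 - q z / w\<bar>.\<close>
definition outer_term :: "real \<Rightarrow> real \<Rightarrow> nat \<Rightarrow> complex \<times> complex \<Rightarrow> complex" where
  "outer_term q r n x = complex_of_real (q ^ Suc n / Suc n) *
     ((fst x ^ Suc n + snd x ^ Suc n)\<^sup>2 * (1 / (1 - complex_of_real r * tmono (int (Suc n)) (int (Suc n)) x)))"

text \<open>The cofactor of w - q z in the inner function, up to the constant 1 - q. For r < 1 it
  lies in the bidisc algebra; r = 1 is the boundary function that is wanted.\<close>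

definition outer_fn :: "real \<Rightarrow> real \<Rightarrow> complex \<times> complex \<Rightarrow> complex" where
  "outer_fn q r x = exp (- (\<Sum>n. outer_term q r n x))"

section \<open>Convergence and modulus of the cofactor\<close>

lemma outer_term_measurable [measurable]: "outer_term q r n \<in> borel_measurable torus_measure"
  unfolding outer_term_def by measurable

lemma outer_fn_measurable [measurable]: "outer_fn q r \<in> borel_measurable torus_measure"
  unfolding outer_fn_def by measurable

lemma torus_power: "x \<in> torus \<Longrightarrow> cmod (fst x ^ n) = 1" "x \<in> torus \<Longrightarrow> cmod (snd x ^ n) = 1"
  by (simp_all add: torus_def norm_power)

lemma norm_square_sum_le:
  assumes "x \<in> torus" shows "cmod ((fst x ^ n + snd x ^ n)\<^sup>2) \<le> 4"
proof -
  have "cmod (fst x ^ n + snd x ^ n) \<le> 2"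
    using norm_triangle_ineq[of "fst x ^ n" "snd x ^ n"] torus_power[OF assms, of n] by simp
  then have "(cmod (fst x ^ n + snd x ^ n))\<^sup>2 \<le> 2\<^sup>2" by (intro power_mono) auto
  then show ?thesis by (simp add: norm_power)
qed

text \<open>With Z = z^N and W = w^N this exhibits each term of the exponent as a nonnegative weight
  times v / (1 - r v), where v = (z w)^N, so that bounds on the real part of the quotient carry
  over.\<close>

lemma square_sum_eq:
  fixes Z W :: complex
  assumes "cmod Z = 1" "cmod W = 1"
  shows "(Z + W)\<^sup>2 = complex_of_real ((cmod (Z + W))\<^sup>2) * (Z * W)"
proof -
  have "Z * cnj Z = 1" "W * cnj W = 1"
    using complex_norm_square[of Z] complex_norm_square[of W] assms by simp_all
  then show ?thesis
    unfolding complex_norm_square complex_cnj_add by algebra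
qed

text \<open>A lower bound independent of r, which is what keeps the approximants uniformly bounded
  as r tends to 1. At r v = 1 the quotient is 0 by the convention on division.\<close>

lemma Re_geometric_ge:
  fixes v :: complex
  assumes "cmod v = 1" "0 \<le> r" "r \<le> 1"
  shows "Re (v / (1 - complex_of_real r * v)) \<ge> -1"
proof (cases "1 - complex_of_real r * v = 0")
  case False
  define c where "c = Re v"
  have v2: "(Re v)\<^sup>2 + (Im v)\<^sup>2 = 1" using assms(1) by (simp add: cmod_def)
  have c: "- 1 \<le> c" "c \<le> 1" using abs_Re_le_cmod[of v] assms(1) by (auto simp: c_def)
  have D: "(cmod (1 - complex_of_real r * v))\<^sup>2 = 1 - 2 * r * c + r\<^sup>2"
  proof -
    have "(cmod (1 - complex_of_real r * v))\<^sup>2 = (1 - r * Re v)\<^sup>2 + (r * Im v)\<^sup>2"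
      by (simp add: cmod_power2)
    also have "\<dots> = 1 - 2 * r * c + r\<^sup>2" using v2 unfolding c_def by algebra
    finally show ?thesis .
  qed
  have "0 < (cmod (1 - complex_of_real r * v))\<^sup>2" using False by simp
  then have pos: "1 - 2 * r * c + r\<^sup>2 > 0" unfolding D .
  have "Re (v / (1 - complex_of_real r * v)) = (c - r) / (1 - 2 * r * c + r\<^sup>2)"
    unfolding Re_divide D[symmetric] cmod_power2
    using v2 by (intro arg_cong2[of _ _ _ _ "(/)"]) (simp_all add: c_def power2_eq_square, algebra)
  also have "\<dots> \<ge> -1"
  proof -
    \<comment> \<open>The quantity 1 - 2 r c + r^2 + c - r is affine in c, with values r (1 + r) at
      c = -1 and (1 - r)(2 - r) at c = 1; the sum of the two products is twice its
      interpolation.\<close>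
    have "0 \<le> (1 - c) * (r * (1 + r))" "0 \<le> (1 + c) * ((1 - r) * (2 - r))"
      using c assms by auto
    then have "- (1 - 2 * r * c + r\<^sup>2) \<le> c - r" by (simp add: power2_eq_square algebra_simps)
    then show ?thesis using pos by (simp add: le_divide_eq)
  qed
  finally show ?thesis .
qed simp

lemma Re_geometric_eq:
  fixes v :: complex
  assumes "cmod v = 1" "v \<noteq> 1" shows "Re (v / (1 - v)) = - 1 / 2"
proof -
  have v2: "(Re v)\<^sup>2 + (Im v)\<^sup>2 = 1" using assms(1) by (simp add: cmod_def)
  have "0 < (cmod (1 - v))\<^sup>2" using assms by simp
  then have pos: "0 < (1 - Re v)\<^sup>2 + (Im v)\<^sup>2" by (simp add: cmod_power2)
  have "2 * (Re v * (1 - Re v) - (Im v)\<^sup>2) = - ((1 - Re v)\<^sup>2 + (Im v)\<^sup>2)"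
    using v2 by (simp add: power2_eq_square) algebra
  then show ?thesis using pos
    by (simp add: Re_divide power2_eq_square field_simps)
qed

context
  fixes q :: real
  assumes q: "0 < q" "q < 1"
begin

lemma summable_q: "summable (\<lambda>n. q ^ Suc n)"
  using q by (intro summable_Suc_iff[THEN iffD2] summable_geometric) simp

lemma coeff_bounds: "0 \<le> q ^ Suc n / Suc n" "q ^ Suc n / Suc n \<le> q ^ Suc n"
  using q by (simp_all add: divide_le_eq)

lemma coeff_le: "cmod (complex_of_real (q ^ Suc n / Suc n)) \<le> q ^ Suc n"
  using coeff_bounds[of n] unfolding norm_of_real by simp

lemma outer_term_in_algebra:
  assumes r: "0 \<le> r" "r < 1" shows "outer_term q r n \<in> bidisc_algebra"
proof -
  have "tmono (int (Suc n)) (int (Suc n)) \<in> bidisc_algebra"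
    unfolding tmono_nat by (intro bidisc_algebra_mult bidisc_algebra_power bidisc_algebra_fst bidisc_algebra_snd)
  then have "(\<lambda>x. 1 / (1 - complex_of_real r * tmono (int (Suc n)) (int (Suc n)) x)) \<in> bidisc_algebra"
    using r by (intro bidisc_algebra_inverse[of _ r] bidisc_algebra_mult bidisc_algebra_const) (simp_all add: norm_mult norm_tmono)
  then show ?thesis unfolding outer_term_def
    by (intro bidisc_algebra_mult bidisc_algebra_add bidisc_algebra_const bidisc_algebra_power
        bidisc_algebra_fst bidisc_algebra_snd)
qed

lemma norm_outer_term_le:
  assumes x: "x \<in> torus" and d: "d > 0" "cmod (1 - complex_of_real r * tmono (int (Suc n)) (int (Suc n)) x) \<ge> d"
  shows "cmod (outer_term q r n x) \<le> q ^ Suc n * (4 / d)"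
proof -
  have "cmod (1 / (1 - complex_of_real r * tmono (int (Suc n)) (int (Suc n)) x)) \<le> 1 / d"
    using d by (simp add: norm_divide frac_le)
  then have "cmod (outer_term q r n x) \<le> q ^ Suc n * (4 * (1 / d))"
    unfolding outer_term_def norm_mult[of "complex_of_real (q ^ Suc n / Suc n)"] norm_mult[of "(_ + _)\<^sup>2"]
    using q by (intro mult_mono coeff_le norm_square_sum_le x) auto
  then show ?thesis by simp
qed

lemma outer_fn_in_algebra:
  assumes r: "0 \<le> r" "r < 1" shows "outer_fn q r \<in> bidisc_algebra"
proof -
  have "(\<lambda>x. \<Sum>n. outer_term q r n x) \<in> bidisc_algebra"
  proof (rule bidisc_algebra_suminf)
    fix n x assume x: "x \<in> torus"
    show "cmod (outer_term q r n x) \<le> q ^ Suc n * (4 / (1 - r))"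
    proof (rule norm_outer_term_le[OF x])
      show "1 - r \<le> cmod (1 - complex_of_real r * tmono (int (Suc n)) (int (Suc n)) x)"
        using norm_triangle_ineq2[of 1 "complex_of_real r * tmono (int (Suc n)) (int (Suc n)) x"] r x
        by (simp add: norm_mult norm_tmono)
    qed (use r in simp)
  next
    show "summable (\<lambda>n. q ^ Suc n * (4 / (1 - r)))" by (intro summable_mult2 summable_q)
  qed (rule outer_term_in_algebra[OF r])
  then have "(\<lambda>x. exp (- 1 * (\<Sum>n. outer_term q r n x))) \<in> bidisc_algebra"
    by (intro bidisc_algebra_exp bidisc_algebra_mult bidisc_algebra_const)
  then show ?thesis by (simp add: outer_fn_def[abs_def])
qed

lemma outer_term_eq:
  assumes x: "x \<in> torus"
  shows "outer_term q r n x = complex_of_real (q ^ Suc n / Suc n * (cmod (fst x ^ Suc n + snd x ^ Suc n))\<^sup>2) *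
    (tmono (int (Suc n)) (int (Suc n)) x / (1 - complex_of_real r * tmono (int (Suc n)) (int (Suc n)) x))"
  unfolding outer_term_def square_sum_eq[OF torus_power(1)[OF x] torus_power(2)[OF x]] tmono_nat of_real_mult
  by (simp only: mult.assoc times_divide_eq_right mult_1_right)

text \<open>The weight is at most 4 q^N because |z^N + w^N|^2 \<le> 4, and the quotient it
  multiplies has real part at least -1.\<close>

lemma Re_outer_term_ge:
  assumes x: "x \<in> torus" and r: "0 \<le> r" "r \<le> 1"
  shows "Re (outer_term q r n x) \<ge> - (4 * q ^ Suc n)"
proof -
  define v where "v = tmono (int (Suc n)) (int (Suc n)) x"
  define a where "a = q ^ Suc n / Suc n * (cmod (fst x ^ Suc n + snd x ^ Suc n))\<^sup>2"
  have a: "0 \<le> a" "a \<le> q ^ Suc n * 4"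
  proof -
    show "a \<le> q ^ Suc n * 4" unfolding a_def
      using norm_square_sum_le[OF x, of "Suc n"] q
      by (intro mult_mono coeff_bounds) (simp_all only: norm_power, simp_all)
  qed (use q in \<open>simp add: a_def\<close>)
  have "Re (v / (1 - complex_of_real r * v)) \<ge> - 1"
    by (rule Re_geometric_ge[OF _ r]) (simp add: v_def norm_tmono x)
  then have "a * (- 1) \<le> a * Re (v / (1 - complex_of_real r * v))" using a by (intro mult_left_mono)
  moreover have "Re (outer_term q r n x) = a * Re (v / (1 - complex_of_real r * v))"
    unfolding outer_term_eq[OF x] v_def[symmetric] a_def[symmetric]
    by (simp del: times_divide_eq_right times_divide_eq_left)
  ultimately show ?thesis using a by linarith
qed


text \<open>Borel-Cantelli: almost surely 1 - (zw)^N is at least q^(N/2) in modulus for all large N.\<close>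
lemma AE_summable_outer:
  "AE x in torus_measure. (\<forall>n. tmono (int (Suc n)) (int (Suc n)) x \<noteq> 1) \<and>
     summable (\<lambda>n. q ^ Suc n / cmod (1 - tmono (int (Suc n)) (int (Suc n)) x))"
proof -
  define d where "d n x = cmod (1 - tmono (int (Suc n)) (int (Suc n)) x)" for n x
  have [measurable]: "d n \<in> borel_measurable torus_measure" for n unfolding d_def by measurable
  have small: "measure torus_measure {x. d n x < e} \<le> 4 * e" if "0 < e" "e < 1" for n e
    unfolding d_def by (rule measure_near_one) (use that in auto)
  have "AE x in torus_measure. d n x \<noteq> 0" for n
  proof -
    have meas: "{x. d n x = 0} \<in> sets torus_measure" "{x. d n x < e} \<in> sets torus_measure" for e
      using measurable_sets[OF \<open>d n \<in> borel_measurable torus_measure\<close>, of "{0}"]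
        measurable_sets[OF \<open>d n \<in> borel_measurable torus_measure\<close>, of "{..<e}"]
      by (simp_all add: vimage_def)
    have "measure torus_measure {x. d n x = 0} \<le> 4 * e" if "0 < e" "e < 1" for e
      using torus_finite.finite_measure_mono[OF _ meas(2)[of e], of "{x. d n x = 0}"] small[OF that, of n] that
      by fastforce
    note bound = this
    have "measure torus_measure {x. d n x = 0} = 0"
    proof (rule ccontr)
      define m where "m = measure torus_measure {x. d n x = 0}"
      assume "measure torus_measure {x. d n x = 0} \<noteq> 0"
      then have "m > 0" by (simp add: m_def zero_less_measure_iff)
      \<comment> \<open>With this choice of e the bound 4 e is at most m / 2, contradicting m > 0;
        the minimum with 1/2 keeps e below 1.\<close>
      moreover from this have "m \<le> 4 * min (1/2) (m / 8)" unfolding m_def[symmetric]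
        using bound[of "min (1/2) (m / 8)"] by (simp add: m_def)
      ultimately show False by (simp add: min_def split: if_splits)
    qed
    then have "emeasure torus_measure {x. d n x = 0} = 0" by (simp add: torus_finite.emeasure_eq_measure)
    then show ?thesis using meas(1) by (subst AE_iff_measurable[of "{x. d n x = 0}"]) auto
  qed
  then have nz: "AE x in torus_measure. \<forall>n. d n x \<noteq> 0" by (simp add: AE_all_countable)
  \<comment> \<open>Splitting q^N = s^N s^N uses one factor as the summable measure of the
    exceptional sets and leaves the other as a convergent majorant outside them.\<close>
  define s where "s = sqrt q"
  have s: "0 < s" "s < 1" "s * s = q" using q by (simp_all add: s_def)
  have sn: "0 < s ^ Suc n" "s ^ Suc n < 1" for n
    using s power_Suc_less_one[of s n] by simp_all
  have ssum: "summable (\<lambda>n. s ^ Suc n)" using s by (intro summable_Suc_iff[THEN iffD2] summable_geometric) simp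
  have "AE x in torus_measure. eventually (\<lambda>n. x \<in> space torus_measure - {x. d n x < s ^ Suc n}) sequentially"
  proof (rule borel_cantelli_AE1)
    show "{x. d n x < s ^ Suc n} \<in> sets torus_measure" for n
      using measurable_sets[OF \<open>d n \<in> borel_measurable torus_measure\<close>, of "{..<s ^ Suc n}"] by (simp add: vimage_def)
    show "emeasure torus_measure {x. d n x < s ^ Suc n} < \<infinity>" for n
      by (simp add: torus_finite.emeasure_eq_measure)
    show "summable (\<lambda>n. measure torus_measure {x. d n x < s ^ Suc n})"
      by (rule summable_comparison_test'[OF summable_mult[OF ssum, of 4], of 0])
        (use small[OF sn] in simp)
  qed
  then show ?thesis using nz
  proof eventually_elim
    fix x assume ev: "eventually (\<lambda>n. x \<in> space torus_measure - {x. d n x < s ^ Suc n}) sequentially" and nz: "\<forall>n. d n x \<noteq> 0"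
    have "summable (\<lambda>n. q ^ Suc n / d n x)"
    proof (rule summable_comparison_test_ev[OF _ ssum])
      show "eventually (\<lambda>n. norm (q ^ Suc n / d n x) \<le> s ^ Suc n) sequentially"
        using ev
      proof eventually_elim
        fix n assume "x \<in> space torus_measure - {x. d n x < s ^ Suc n}"
        then have ge: "s ^ Suc n \<le> d n x" by simp
        have "q ^ Suc n / d n x \<le> q ^ Suc n / s ^ Suc n"
          using ge sn[of n] q by (intro divide_left_mono) (auto intro!: mult_pos_pos intro: less_le_trans)
        also have "\<dots> = s ^ Suc n" using s by (simp add: field_simps flip: power_mult_distrib s(3))
        finally show "norm (q ^ Suc n / d n x) \<le> s ^ Suc n" using q by (simp add: d_def)
      qed
    qed
    then show "(\<forall>n. tmono (int (Suc n)) (int (Suc n)) x \<noteq> 1) \<and>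
      summable (\<lambda>n. q ^ Suc n / cmod (1 - tmono (int (Suc n)) (int (Suc n)) x))"
      using nz by (auto simp: d_def)
  qed
qed

text \<open>The gap |v - r v| = 1 - r is itself at most |1 - r v|, so replacing r by 1 costs a
  factor 2.\<close>

lemma norm_one_minus_le:
  assumes "cmod v = 1" "0 \<le> r" "r \<le> 1" shows "cmod (1 - v) \<le> 2 * cmod (1 - complex_of_real r * v)"
proof -
  have "1 - v = (1 - complex_of_real r * v) - complex_of_real (1 - r) * v" by (simp add: algebra_simps)
  then have "cmod (1 - v) \<le> cmod (1 - complex_of_real r * v) + cmod (complex_of_real (1 - r) * v)"
    by (metis norm_triangle_ineq4)
  also have "cmod (complex_of_real (1 - r) * v) = 1 - r" using assms by (simp add: norm_mult del: of_real_diff)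
  also have "1 - r \<le> cmod (1 - complex_of_real r * v)"
    using norm_triangle_ineq2[of 1 "complex_of_real r * v"] assms by (simp add: norm_mult)
  finally show ?thesis by simp
qed

text \<open>The majorant no longer contains r. Its constant 8 is 4 from |z^N + w^N|^2 times 2 from
  \<open>norm_one_minus_le\<close>.\<close>

lemma outer_term_dominated:
  assumes x: "x \<in> torus" "tmono (int (Suc n)) (int (Suc n)) x \<noteq> 1" and r: "0 \<le> r" "r \<le> 1"
  shows "cmod (outer_term q r n x) \<le> 8 * (q ^ Suc n / cmod (1 - tmono (int (Suc n)) (int (Suc n)) x))"
  using norm_outer_term_le[OF x(1), of "cmod (1 - tmono (int (Suc n)) (int (Suc n)) x) / 2" r n]
    norm_one_minus_le[of "tmono (int (Suc n)) (int (Suc n)) x" r] x r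
  by (simp add: norm_tmono mult_ac)

lemma outer_fn_tendsto:
  assumes x: "x \<in> torus" "\<And>n. tmono (int (Suc n)) (int (Suc n)) x \<noteq> 1"
      "summable (\<lambda>n. q ^ Suc n / cmod (1 - tmono (int (Suc n)) (int (Suc n)) x))"
    and r: "\<And>k. 0 \<le> r k" "\<And>k. r k \<le> 1" "r \<longlonglongrightarrow> 1"
  shows "(\<lambda>k::nat. outer_fn q (r k) x) \<longlonglongrightarrow> outer_fn q 1 x"
proof -
  have "(\<lambda>k. outer_term q (r k) n x) \<longlonglongrightarrow> outer_term q 1 n x" for n
    unfolding outer_term_def using x(2)[of n] r(3) by (intro tendsto_intros) auto
  moreover have "eventually (\<lambda>(n, k). norm (outer_term q (r k) n x)
      \<le> 8 * (q ^ Suc n / cmod (1 - tmono (int (Suc n)) (int (Suc n)) x))) (at_top \<times>\<^sub>F sequentially)"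
    using outer_term_dominated[OF x(1,2) r(1,2)] by (intro always_eventually) auto
  moreover have "summable (\<lambda>n. 8 * (q ^ Suc n / cmod (1 - tmono (int (Suc n)) (int (Suc n)) x)))"
    by (intro summable_mult x)
  ultimately have "(\<lambda>k. \<Sum>n. outer_term q (r k) n x) \<longlonglongrightarrow> (\<Sum>n. outer_term q 1 n x)"
    using tannerys_theorem[of "\<lambda>n k. outer_term q (r k) n x"] by simp
  then show ?thesis unfolding outer_fn_def by (intro tendsto_intros)
qed

text \<open>The modulus of an exponential depends on the real part alone, so the one-sided bound on
  each term suffices, although the terms themselves are not bounded uniformly in r.\<close>

lemma norm_outer_fn_le:
  assumes x: "x \<in> torus" and r: "0 \<le> r" "r < 1"
  shows "cmod (outer_fn q r x) \<le> exp (\<Sum>n. 4 * q ^ Suc n)"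
proof -
  have "1 - r \<le> cmod (1 - complex_of_real r * tmono (int (Suc n)) (int (Suc n)) x)" for n
    using norm_triangle_ineq2[of 1 "complex_of_real r * tmono (int (Suc n)) (int (Suc n)) x"] r x
    by (simp add: norm_mult norm_tmono)
  then have "cmod (outer_term q r n x) \<le> q ^ Suc n * (4 / (1 - r))" for n
    using r by (intro norm_outer_term_le x) auto
  then have sum: "summable (\<lambda>n. outer_term q r n x)"
    by (intro summable_comparison_test'[OF summable_mult2[OF summable_q, of "4 / (1 - r)"], of 0]) auto
  have "- Re (\<Sum>n. outer_term q r n x) = (\<Sum>n. - Re (outer_term q r n x))"
    using bounded_linear.suminf[OF bounded_linear_Re sum] bounded_linear.summable[OF bounded_linear_Re sum]
    by (simp add: suminf_minus)
  also have "\<dots> \<le> (\<Sum>n. 4 * q ^ Suc n)"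
    using Re_outer_term_ge[OF x r(1), of _] r bounded_linear.summable[OF bounded_linear_Re sum]
    by (intro suminf_le summable_minus summable_mult summable_q) (auto simp: minus_le_iff)
  finally show ?thesis by (simp add: outer_fn_def)
qed

lemma norm_outer_fn_eq:
  assumes x: "x \<in> torus" "\<And>n. tmono (int (Suc n)) (int (Suc n)) x \<noteq> 1"
      "summable (\<lambda>n. q ^ Suc n / cmod (1 - tmono (int (Suc n)) (int (Suc n)) x))"
  shows "cmod (outer_fn q 1 x) = 1 / ((1 - q) * cmod (snd x - complex_of_real q * fst x))"
proof -
  have sum: "summable (\<lambda>n. outer_term q 1 n x)"
    by (rule summable_comparison_test'[OF summable_mult[OF x(3), of 8], of 0]) (use outer_term_dominated[OF x(1,2)] in auto)
  \<comment> \<open>On the torus \<open>y\<close> is q z / w. The real parts of the terms at r = 1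
    split into the logarithm series at q and at \<open>y\<close>.\<close>
  define y where "y = complex_of_real q * (fst x * cnj (snd x))"
  have ny: "cmod y = q" using x(1) q by (simp add: y_def norm_mult torus_def)
  have log: "(\<lambda>n. z ^ Suc n / of_nat (Suc n)) sums - ln (1 - z)" if "cmod z < 1" for z :: complex
  proof -
    have "(\<lambda>n. - (z ^ n) / of_nat n) sums ln (1 - z)" using Ln_series'[of "- z"] that by simp
    then have "(\<lambda>n. - (z ^ Suc n) / of_nat (Suc n)) sums ln (1 - z)" by (subst sums_Suc_iff) simp
    from sums_minus[OF this] show ?thesis by simp
  qed
  have re: "Re (outer_term q 1 n x) = - Re (complex_of_real q ^ Suc n / of_nat (Suc n)) - Re (y ^ Suc n / of_nat (Suc n))" for n
  proof -
    define Z where "Z = fst x ^ Suc n"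
    define W where "W = snd x ^ Suc n"
    have ZW: "cmod Z = 1" "cmod W = 1" using torus_power[OF x(1)] by (simp_all add: Z_def W_def del: power_Suc)
    have sq: "(cmod (Z + W))\<^sup>2 = 2 + 2 * Re (Z * cnj W)"
    proof -
      have "(Re Z)\<^sup>2 + (Im Z)\<^sup>2 = 1" "(Re W)\<^sup>2 + (Im W)\<^sup>2 = 1" using ZW by (simp_all add: cmod_def)
      moreover have "(cmod (Z + W))\<^sup>2 = (Re Z + Re W)\<^sup>2 + (Im Z + Im W)\<^sup>2" by (simp add: cmod_power2)
      ultimately show ?thesis by (simp add: power2_eq_square algebra_simps)
    qed
    define t where "t = q ^ Suc n / Suc n"
    have yn: "y ^ Suc n / of_nat (Suc n) = complex_of_real t * (Z * cnj W)"
      unfolding y_def power_mult_distrib t_def Z_def W_def complex_cnj_power of_real_divide of_real_power of_real_of_nat_eq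
      by simp
    have qn: "complex_of_real q ^ Suc n / of_nat (Suc n) = complex_of_real t"
      unfolding t_def of_real_divide of_real_power of_real_of_nat_eq by simp
    have "Re (outer_term q 1 n x) = t * (cmod (Z + W))\<^sup>2 * Re (tmono (int (Suc n)) (int (Suc n)) x / (1 - tmono (int (Suc n)) (int (Suc n)) x))"
      unfolding outer_term_eq[OF x(1)] Z_def[symmetric] W_def[symmetric] t_def[symmetric]
      by (simp del: times_divide_eq_right times_divide_eq_left of_nat_Suc of_real_mult of_real_power)
    also have "\<dots> = - t - t * Re (Z * cnj W)"
      unfolding sq using x by (subst Re_geometric_eq) (simp_all add: norm_tmono algebra_simps)
    finally show ?thesis unfolding yn qn by simp
  qed
  have "(\<lambda>n. - Re (complex_of_real q ^ Suc n / of_nat (Suc n)) - Re (y ^ Suc n / of_nat (Suc n)))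
      sums (- Re (- ln (1 - complex_of_real q)) - Re (- ln (1 - y)))"
    using q ny by (intro sums_diff sums_minus sums_Re log) auto
  then have "Re (\<Sum>n. outer_term q 1 n x) = Re (ln (1 - complex_of_real q)) + Re (ln (1 - y))"
    unfolding re[symmetric] using sums_unique2[OF sums_Re[OF summable_sums[OF sum]]] by simp
  also have "\<dots> = ln (1 - q) + ln (cmod (1 - y))"
  proof -
    have "1 - complex_of_real q = complex_of_real (1 - q)" by simp
    moreover have "1 - y \<noteq> 0" using ny q by auto
    ultimately show ?thesis using q by (simp add: Ln_of_real del: of_real_diff)
  qed
  finally have "cmod (outer_fn q 1 x) = exp (- (ln (1 - q) + ln (cmod (1 - y))))"
    by (simp add: outer_fn_def)
  also have "\<dots> = 1 / ((1 - q) * cmod (1 - y))"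
  proof -
    have "cmod (1 - y) > 0" using ny q by auto
    then show ?thesis using q by (simp add: exp_add exp_minus exp_diff field_simps)
  qed
  also have "cmod (1 - y) = cmod (snd x - complex_of_real q * fst x)"
  proof -
    have "snd x * cnj (snd x) = 1" using complex_norm_square[of "snd x"] x(1) by (simp add: torus_def)
    then have "snd x * (1 - y) = snd x - complex_of_real q * fst x"
      by (simp add: y_def algebra_simps)
    then have "cmod (snd x) * cmod (1 - y) = cmod (snd x - complex_of_real q * fst x)"
      unfolding norm_mult[symmetric] by (rule arg_cong)
    then show ?thesis using x(1) by (simp add: torus_def)
  qed
  finally show ?thesis .
qed

lemma outer_fn_H2: "outer_fn q 1 \<in> H2_bidisc"
proof -
  define r where "r k = 1 - inverse (real (Suc k))" for k
  have r: "0 \<le> r k" "r k < 1" for k by (auto simp: r_def field_simps)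
  have "r \<longlonglongrightarrow> 1 - 0" unfolding r_def by (intro tendsto_diff tendsto_const LIMSEQ_inverse_real_of_nat)
  then have r1: "r \<longlonglongrightarrow> 1" by simp
  show ?thesis
  proof (rule H2_bidisc_bounded_limit[where f = "\<lambda>k. outer_fn q (r k)" and B = "exp (\<Sum>n. 4 * q ^ Suc n)"])
    show "AE x in torus_measure. (\<lambda>k. outer_fn q (r k) x) \<longlonglongrightarrow> outer_fn q 1 x"
      using AE_torus AE_summable_outer
      by eventually_elim (intro outer_fn_tendsto r less_imp_le[OF r(2)] r1, auto)
  qed (intro outer_fn_in_algebra norm_outer_fn_le r outer_fn_measurable; assumption)+
qed

lemma AE_norm_outer_fn:
  "AE x in torus_measure. cmod (outer_fn q 1 x) = 1 / ((1 - q) * cmod (snd x - complex_of_real q * fst x))"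
  using AE_torus AE_summable_outer by eventually_elim (intro norm_outer_fn_eq, auto)

end

section \<open>The function models\<close>

lemma bounded_L2_circle:
  assumes "f \<in> borel_measurable circle_measure" "\<And>z. cmod z = 1 \<Longrightarrow> cmod (f z) \<le> B"
  shows "f \<in> L2 circle_measure"
proof -
  have "(\<lambda>x. 1) \<in> L2 circle_measure" by (simp add: L2_def)
  moreover have "AE z in circle_measure. cmod (f z) \<le> B"
    using AE_circle by eventually_elim (use assms(2) in blast)
  ultimately show ?thesis using L2_mult[of "\<lambda>x. 1" circle_measure f B] assms(1) by simp
qed

lemma poisson_moment_antidiagonal:
  fixes q :: real
  assumes q: "0 < q" "q < 1"
  shows "(\<integral>x. tmono a b x * complex_of_real ((1 - q\<^sup>2) / (cmod (1 - complex_of_real q * tmono 1 (- 1) x))\<^sup>2) \<partial>torus_measure)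
    = (if a + b = 0 then complex_of_real (q ^ nat \<bar>a\<bar>) else 0)"
proof -
  have f1: "(\<lambda>k. complex_of_real (q ^ k) * (if a + int k * 1 = 0 \<and> b + int k * - 1 = 0 then 1 else 0))
    = (\<lambda>k. if k = nat (- a) then (if a + b = 0 \<and> a \<le> 0 then complex_of_real (q ^ nat \<bar>a\<bar>) else 0) else 0)"
    by (auto simp: fun_eq_iff)
  \<comment> \<open>The conjugate half of the kernel starts at exponent 1, hence the index
    \<open>nat a - 1\<close>; the guard a > 0 excludes the values at which natural subtraction would
    return 0 spuriously.\<close>
  have f2: "(\<lambda>k. complex_of_real (q ^ Suc k) * (if a - int (Suc k) * 1 = 0 \<and> b - int (Suc k) * - 1 = 0 then 1 else 0))
    = (\<lambda>k. if k = nat a - 1 then (if a + b = 0 \<and> a > 0 then complex_of_real (q ^ nat \<bar>a\<bar>) else 0) else 0)"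
  proof
    fix k
    show "complex_of_real (q ^ Suc k) * (if a - int (Suc k) * 1 = 0 \<and> b - int (Suc k) * - 1 = 0 then 1 else 0)
      = (if k = nat a - 1 then (if a + b = 0 \<and> a > 0 then complex_of_real (q ^ nat \<bar>a\<bar>) else 0) else 0)"
    proof (cases "a = int (Suc k)")
      case True
      then have "nat \<bar>a\<bar> = Suc k" "nat a - 1 = k" by auto
      then show ?thesis using True by auto
    qed auto
  qed
  have "(\<integral>x. tmono a b x * complex_of_real ((1 - q\<^sup>2) / (cmod (1 - complex_of_real q * tmono 1 (- 1) x))\<^sup>2) \<partial>torus_measure)
    = (\<Sum>k. complex_of_real (q ^ k) * (if a + int k * 1 = 0 \<and> b + int k * - 1 = 0 then 1 else 0))
      + (\<Sum>k. complex_of_real (q ^ Suc k) * (if a - int (Suc k) * 1 = 0 \<and> b - int (Suc k) * - 1 = 0 then 1 else 0))"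
    by (rule poisson_moment) (use q in auto)
  also have "\<dots> = (if a + b = 0 \<and> a \<le> 0 then complex_of_real (q ^ nat \<bar>a\<bar>) else 0)
      + (if a + b = 0 \<and> a > 0 then complex_of_real (q ^ nat \<bar>a\<bar>) else 0)"
    unfolding f1 f2
    using sums_unique[OF sums_single[of "nat (- a)" "\<lambda>_. if a + b = 0 \<and> a \<le> 0 then complex_of_real (q ^ nat \<bar>a\<bar>) else 0"]]
      sums_unique[OF sums_single[of "nat a - 1" "\<lambda>_. if a + b = 0 \<and> a > 0 then complex_of_real (q ^ nat \<bar>a\<bar>) else 0"]]
    by simp
  finally show ?thesis by auto
qed

text \<open>The common factor \<open>c\<close> covers two uses: it is 1 for plain monomials, and a
  multiple of \<phi> / (w - q z) for the model functions.\<close>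

lemma cnj_monomial_mult:
  assumes x: "x \<in> torus"
  shows "cnj (fst x ^ m * snd x ^ n * c) * (fst x ^ m' * snd x ^ n' * c)
    = tmono (int m' - int m) (int n' - int n) x * complex_of_real ((cmod c)\<^sup>2)"
proof -
  have "cnj (fst x ^ m * snd x ^ n * c) * (fst x ^ m' * snd x ^ n' * c)
      = cnj (tmono (int m) (int n) x) * tmono (int m') (int n') x * (c * cnj c)"
    by (simp add: tmono_nat mult_ac)
  also have "cnj (tmono (int m) (int n) x) * tmono (int m') (int n') x = tmono (int m' - int m) (int n' - int n) x"
    using tmono_add[OF x, of "- int m" "int m'" "- int n" "int n'"] cnj_tmono[OF x] by simp
  finally show ?thesis by (simp only: complex_norm_square)
qed

lemma inner_monomials:
  "l2inner torus_measure (\<lambda>x. fst x ^ m * snd x ^ n) (\<lambda>x. fst x ^ m' * snd x ^ n') = (if m = m' \<and> n = n' then 1 else 0)"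
proof -
  have "l2inner torus_measure (\<lambda>x. fst x ^ m * snd x ^ n) (\<lambda>x. fst x ^ m' * snd x ^ n')
      = integral\<^sup>L torus_measure (tmono (int m' - int m) (int n' - int n))"
    unfolding l2inner_def
    by (rule integral_torus_cong) (use cnj_monomial_mult[of _ m n 1 m' n'] in auto)
  then show ?thesis by (auto simp: torus_moment)
qed

section \<open>The model for eigenvalues of modulus strictly between 0 and 1\<close>

context
  fixes q :: real
  assumes q: "0 < q" "q < 1"
begin

definition kernels :: "(complex \<times> complex \<Rightarrow> complex) set" where
  "kernels = {(\<lambda>(z, w). z ^ j * cnj w / (1 - complex_of_real q * z * cnj w)) | j. True}"

lemma K_lambda_eq: "K_lambda q = L2_closure torus_measure (fspan kernels)"
  by (simp add: K_lambda_def kernels_def)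

text \<open>On the torus the generator cnj w / (1 - q z cnj w) is 1 / (w - q z).\<close>
definition pole :: "nat \<times> nat \<Rightarrow> complex \<times> complex \<Rightarrow> complex" where
  "pole p x = fst x ^ fst p * snd x ^ snd p / (snd x - complex_of_real q * fst x)"

lemma pole_measurable [measurable]: "pole p \<in> borel_measurable torus_measure"
  unfolding pole_def by measurable

lemma denominator_ge: "x \<in> torus \<Longrightarrow> 1 - q \<le> cmod (snd x - complex_of_real q * fst x)"
  using norm_triangle_ineq2[of "snd x" "complex_of_real q * fst x"] q by (simp add: torus_def norm_mult)

lemma denominator_nonzero: "x \<in> torus \<Longrightarrow> snd x - complex_of_real q * fst x \<noteq> 0"
  using denominator_ge[of x] q by auto

lemma pole_L2: "pole p \<in> L2 torus_measure"
proof (rule bounded_L2_torus[of _ "1 / (1 - q)"])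
  show "AE x in torus_measure. cmod (pole p x) \<le> 1 / (1 - q)"
    using AE_torus
  proof eventually_elim
    fix x assume "x \<in> torus"
    then show "cmod (pole p x) \<le> 1 / (1 - q)"
      using denominator_ge[of x] q torus_power[of x] by (simp add: pole_def norm_divide norm_mult frac_le del: norm_power)
  qed
qed simp

lemma kernel_eq_pole:
  assumes "x \<in> torus"
  shows "fst x ^ j * cnj (snd x) / (1 - complex_of_real q * fst x * cnj (snd x)) = pole (j, 0) x"
proof -
  have 1: "snd x * cnj (snd x) = 1" using complex_norm_square[of "snd x"] assms by (simp add: torus_def)
  have "1 - complex_of_real q * fst x * cnj (snd x) = (snd x - complex_of_real q * fst x) * cnj (snd x)"
    using 1 by (simp add: algebra_simps)
  moreover have "cnj (snd x) \<noteq> 0" using 1 by auto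
  ultimately show ?thesis by (simp add: pole_def)
qed

lemma kernelsE:
  assumes "k \<in> kernels"
  obtains j where "k \<in> borel_measurable torus_measure" "\<And>x. x \<in> torus \<Longrightarrow> k x = pole (j, 0) x"
proof -
  obtain j where k: "k = (\<lambda>x. fst x ^ j * cnj (snd x) / (1 - complex_of_real q * fst x * cnj (snd x)))"
    using assms by (auto simp: kernels_def case_prod_unfold)
  show ?thesis
    by (rule that[of j]) (use k kernel_eq_pole in auto)
qed

lemma kernels_L2: "kernels \<subseteq> L2 torus_measure"
proof
  fix k assume "k \<in> kernels"
  then obtain j where "k \<in> borel_measurable torus_measure" "\<And>x. x \<in> torus \<Longrightarrow> k x = pole (j, 0) x"
    by (rule kernelsE) blast
  then show "k \<in> L2 torus_measure" by (intro L2_AE_eq[OF pole_L2] AE_torusI)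
qed

text \<open>Expanding the geometric series, a kernel has only negative powers of w on the torus,
  whereas monomials have none.\<close>

lemma monomial_kernel_orthogonal:
  assumes "a \<in> monomials" "k \<in> kernels" shows "l2inner torus_measure a k = 0"
proof -
  obtain m n where a: "a = (\<lambda>x. fst x ^ m * snd x ^ n)" using assms(1) by (rule monomialsE)
  obtain j where k: "k \<in> borel_measurable torus_measure" "\<And>x. x \<in> torus \<Longrightarrow> k x = pole (j, 0) x"
    using assms(2) by (rule kernelsE) blast
  have "l2inner torus_measure a k
      = (\<integral>x. tmono (int j - int m) (- int n - 1) x / (1 - complex_of_real q * tmono 1 (- 1) x) \<partial>torus_measure)"
    unfolding l2inner_def
  proof (rule integral_torus_cong)
    fix x assume x: "x \<in> torus"
    have nz: "snd x \<noteq> 0" using torus_nonzero[OF x] by simp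
    have "1 - complex_of_real q * tmono 1 (- 1) x = (snd x - complex_of_real q * fst x) / snd x"
      using nz by (simp add: tmono_def field_simps)
    moreover have "tmono (int j - int m) (- int n - 1) x = cnj (a x) * fst x ^ j / snd x"
      using cnj_tmono[OF x, of "int m" "int n"] tmono_add[OF x, of "- int m" "int j" "- int n" "- 1"]
      by (simp add: a tmono_nat) (simp add: tmono_def power_int_minus divide_inverse)
    ultimately show "cnj (a x) * k x = tmono (int j - int m) (- int n - 1) x / (1 - complex_of_real q * tmono 1 (- 1) x)"
      using nz by (simp add: k(2)[OF x] pole_def)
  qed (use k in \<open>auto simp: a\<close>)
  also have "\<dots> = 0"
  proof -
    have "(\<lambda>k. complex_of_real (q ^ k) * (if (int j - int m) + int k * 1 = 0 \<and> (- int n - 1) + int k * - 1 = 0 then 1 else 0)) = (\<lambda>k. 0)"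
      by (auto simp: fun_eq_iff)
    then show ?thesis
      using sums_unique2[OF torus_geometric_moment[OF less_imp_le[OF q(1)] q(2), of "int j - int m" 1 "- int n - 1" "- 1"]] by simp
  qed
  finally show ?thesis .
qed

text \<open>Read forwards, it writes monomials in terms of poles; solved for
  \<open>pole (m, Suc n)\<close>, it builds all poles from monomials and kernels by induction on the
  power of w. Thus the two families have the same closed span.\<close>

lemma monomial_eq_pole:
  assumes "x \<in> torus"
  shows "fst x ^ m * snd x ^ n = pole (m, Suc n) x - complex_of_real q * pole (Suc m, n) x"
proof -
  have "fst x ^ m * snd x ^ Suc n - complex_of_real q * (fst x ^ Suc m * snd x ^ n)
      = fst x ^ m * snd x ^ n * (snd x - complex_of_real q * fst x)" by (simp add: algebra_simps)
  then show ?thesis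
    using denominator_nonzero[OF assms] unfolding pole_def fst_conv snd_conv times_divide_eq_right diff_divide_distrib[symmetric]
    by (metis nonzero_mult_div_cancel_right)
qed

abbreviation "model_space \<equiv> L2_closure torus_measure (fspan (monomials \<union> kernels))"

lemma generators_L2: "monomials \<union> kernels \<subseteq> L2 torus_measure"
  using monomials_L2 kernels_L2 by blast

lemma generator_in_model_space: "a \<in> monomials \<union> kernels \<Longrightarrow> a \<in> model_space"
  using generators_L2 by (intro L2_closure_base fspan_base) auto

lemma pole_in_model_space: "pole p \<in> model_space"
proof (cases p)
  case (Pair m n)
  have "pole (m, n) \<in> model_space"
  proof (induction n arbitrary: m)
    case 0
    let ?k = "\<lambda>x. fst x ^ m * cnj (snd x) / (1 - complex_of_real q * fst x * cnj (snd x))"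
    have "?k \<in> kernels" by (auto simp: kernels_def case_prod_unfold)
    then have "?k \<in> model_space" by (intro generator_in_model_space UnI2)
    then show ?case
      by (rule L2_closure_AE_eq[OF fspan_L2[OF generators_L2] _ pole_measurable])
        (rule AE_torusI, simp add: kernel_eq_pole)
  next
    case (Suc n)
    have "(\<lambda>x. fst x ^ m * snd x ^ n) \<in> model_space"
      by (intro generator_in_model_space UnI1 monomialsI)
    then have "(\<lambda>x. fst x ^ m * snd x ^ n + complex_of_real q * pole (Suc m, n) x) \<in> model_space"
      by (intro L2_closure_fspan_add[OF generators_L2] L2_closure_fspan_cmult[OF generators_L2] Suc)
    then show ?case
    proof (rule L2_closure_AE_eq[OF fspan_L2[OF generators_L2]])
      show "AE x in torus_measure. pole (m, Suc n) x = fst x ^ m * snd x ^ n + complex_of_real q * pole (Suc m, n) x"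
        by (rule AE_torusI) (simp add: monomial_eq_pole)
    qed simp
  qed
  then show ?thesis by (simp add: Pair)
qed

text \<open>The factors 1 - q and w - q z compensate exactly the modulus of
  \<open>outer_fn q 1\<close>; the zero on w = q z cancels the denominators of
  \<open>pole\<close>.\<close>

definition phi :: "complex \<times> complex \<Rightarrow> complex" where
  "phi x = complex_of_real (1 - q) * (snd x - complex_of_real q * fst x) * outer_fn q 1 x"

lemma phi_measurable [measurable]: "phi \<in> borel_measurable torus_measure"
  unfolding phi_def by measurable

lemma AE_norm_phi: "AE x in torus_measure. cmod (phi x) = 1"
  using AE_torus AE_norm_outer_fn[OF q]
proof eventually_elim
  fix x assume "x \<in> torus" "cmod (outer_fn q 1 x) = 1 / ((1 - q) * cmod (snd x - complex_of_real q * fst x))"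
  then show "cmod (phi x) = 1"
    using denominator_nonzero[of x] q by (simp add: phi_def norm_mult del: of_real_diff)
qed

lemma H2_bidisc_mult_polynomial:
  assumes p: "p \<in> fspan monomials" and f: "f \<in> H2_bidisc" shows "(\<lambda>x. p x * f x) \<in> H2_bidisc"
proof -
  obtain B where B: "\<forall>x\<in>torus. cmod (p x) \<le> B" using fspan_monomials_bounded[OF p] by blast
  show ?thesis
    unfolding H2_bidisc_eq
  proof (rule L2_closure_fspan_mult[OF monomials_L2 monomials_L2 fspan_monomials_measurable[OF p]])
    show "AE x in torus_measure. cmod (p x) \<le> B" using B by (intro AE_torusI) blast
    show "(\<lambda>x. p x * a x) \<in> L2_closure torus_measure (fspan monomials)" if "a \<in> monomials" for a
      using fspan_monomials_mult[OF p fspan_base[OF that]] fspan_L2[OF monomials_L2] by (intro L2_closure_base) auto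
  qed (use f in \<open>simp add: H2_bidisc_eq\<close>)
qed

lemma inner_phi: "inner_fn phi"
proof -
  have "(\<lambda>x. complex_of_real (1 - q) * (fst x ^ 0 * snd x ^ 1) + (- complex_of_real ((1 - q) * q)) * (fst x ^ 1 * snd x ^ 0)) \<in> fspan monomials"
    by (intro fspan_add fspan_cmult fspan_base monomialsI)
  from H2_bidisc_mult_polynomial[OF this outer_fn_H2[OF q]]
  have "phi \<in> H2_bidisc" by (simp add: phi_def[abs_def] algebra_simps)
  then show ?thesis using AE_norm_phi by (simp add: inner_fn_def)
qed

context
  fixes \<gamma> :: complex
  assumes \<gamma>: "cmod \<gamma> = 1"
begin

text \<open>The root normalises, so that the squared modulus is the Poisson kernel in z / w, of mean
  one. The power of \<gamma> carries the phase of the eigenvalue, so that \<gamma> z shifts the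
  first index.\<close>

definition model :: "nat \<times> nat \<Rightarrow> complex \<times> complex \<Rightarrow> complex" where
  "model p x = complex_of_real (sqrt (1 - q\<^sup>2)) * \<gamma> ^ fst p * (phi x * pole p x)"

abbreviation "model_range \<equiv> L2_closure torus_measure (fspan (range model))"

lemma sqrt_nonzero: "complex_of_real (sqrt (1 - q\<^sup>2)) \<noteq> 0" "q\<^sup>2 < 1"
  using q by (auto simp: power2_eq_1_iff abs_square_less_1)

lemma AE_norm_phi_le: "AE x in torus_measure. cmod (phi x) \<le> 1"
  using AE_norm_phi by eventually_elim simp

lemma phi_pole_L2: "(\<lambda>x. phi x * pole p x) \<in> L2 torus_measure"
  by (rule L2_mult[OF pole_L2 phi_measurable AE_norm_phi_le])

lemma model_L2: "range model \<subseteq> L2 torus_measure"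
  unfolding model_def using L2_cmult[OF phi_pole_L2] by blast

lemma model_measurable [measurable]: "model p \<in> borel_measurable torus_measure"
  using model_L2 L2D(1) by blast

lemma model_in_range: "model p \<in> model_range"
  using model_L2 by (intro L2_closure_base fspan_base) auto

lemma phi_pole_in_range: "(\<lambda>x. phi x * pole p x) \<in> model_range"
proof -
  have "(\<lambda>x. (1 / (complex_of_real (sqrt (1 - q\<^sup>2)) * \<gamma> ^ fst p)) * model p x) \<in> model_range"
    by (intro L2_closure_fspan_cmult[OF model_L2] model_in_range)
  moreover have "\<gamma> \<noteq> 0" using \<gamma> by auto
  ultimately show ?thesis using sqrt_nonzero by (simp add: model_def)
qed

text \<open>Multiplication by an inner function is isometric, with inverse multiplication by its
  conjugate; together with \<open>cnj_phi_model_range\<close> this identifies the two closed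
  spans.\<close>

lemma phi_model_space:
  assumes G: "G \<in> model_space" shows "(\<lambda>x. phi x * G x) \<in> model_range"
proof (rule L2_closure_fspan_mult[OF generators_L2 model_L2 phi_measurable AE_norm_phi_le _ G])
  fix a assume "a \<in> monomials \<union> kernels"
  then consider "a \<in> monomials" | "a \<in> kernels" by blast
  then show "(\<lambda>x. phi x * a x) \<in> model_range"
  proof cases
    case 1
    then obtain m n where a: "a = (\<lambda>x. fst x ^ m * snd x ^ n)" by (rule monomialsE)
    have "(\<lambda>x. phi x * pole (m, Suc n) x + (- complex_of_real q) * (phi x * pole (Suc m, n) x)) \<in> model_range"
      by (intro L2_closure_fspan_add[OF model_L2] L2_closure_fspan_cmult[OF model_L2] phi_pole_in_range)
    then show ?thesis
    proof (rule L2_closure_AE_eq[OF fspan_L2[OF model_L2]])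
      show "AE x in torus_measure. phi x * a x = phi x * pole (m, Suc n) x + (- complex_of_real q) * (phi x * pole (Suc m, n) x)"
        by (rule AE_torusI) (simp add: a monomial_eq_pole algebra_simps)
    qed (simp add: a)
  next
    case 2
    then obtain j where j: "a \<in> borel_measurable torus_measure" "\<And>x. x \<in> torus \<Longrightarrow> a x = pole (j, 0) x"
      by (rule kernelsE) blast
    show ?thesis
      by (rule L2_closure_AE_eq[OF fspan_L2[OF model_L2] phi_pole_in_range[of "(j, 0)"]])
        (use j in \<open>auto intro!: AE_torusI\<close>)
  qed
qed

lemma cnj_phi_model_range:
  assumes F: "F \<in> model_range" shows "(\<lambda>x. cnj (phi x) * F x) \<in> model_space"
proof (rule L2_closure_fspan_mult[OF model_L2 generators_L2 _ _ _ F])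
  show "AE x in torus_measure. cmod (cnj (phi x)) \<le> 1" using AE_norm_phi_le by simp
  fix a assume "a \<in> range model"
  then obtain p where a: "a = model p" by blast
  have "(\<lambda>x. (complex_of_real (sqrt (1 - q\<^sup>2)) * \<gamma> ^ fst p) * pole p x) \<in> model_space"
    by (intro L2_closure_fspan_cmult[OF generators_L2] pole_in_model_space)
  then show "(\<lambda>x. cnj (phi x) * a x) \<in> model_space"
  proof (rule L2_closure_AE_eq[OF fspan_L2[OF generators_L2]])
    show "AE x in torus_measure. cnj (phi x) * a x = complex_of_real (sqrt (1 - q\<^sup>2)) * \<gamma> ^ fst p * pole p x"
      using AE_norm_phi
    proof eventually_elim
      fix x assume "cmod (phi x) = 1"
      then have "phi x * cnj (phi x) = 1" using complex_norm_square[of "phi x"] by simp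
      then have "cnj (phi x) * (phi x * pole p x) = pole p x" by (metis mult.assoc mult.commute mult_1)
      then show "cnj (phi x) * a x = complex_of_real (sqrt (1 - q\<^sup>2)) * \<gamma> ^ fst p * pole p x"
        by (simp add: a model_def)
    qed
  qed (simp add: a)
qed simp

text \<open>Dividing by \<phi> leads into the closed span of monomials and kernels together, which
  by their orthogonality is the sum of the separate closures. The decomposition holds almost
  everywhere only, hence \<open>ae_in\<close>.\<close>

lemma model_range_in_S_lambda:
  assumes F: "F \<in> model_range" shows "ae_in torus_measure F (S_lambda phi q)"
proof -
  obtain f g where fg: "f \<in> H2_bidisc" "g \<in> K_lambda q" "AE x in torus_measure. cnj (phi x) * F x = f x + g x"
    using L2_closure_orthogonal_union[OF finite_torus_measure monomials_L2 kernels_L2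
        monomial_kernel_orthogonal cnj_phi_model_range[OF F]]
    unfolding H2_bidisc_eq K_lambda_eq by blast
  have "AE x in torus_measure. F x = phi x * (f x + g x)"
    using fg(3) AE_norm_phi
  proof eventually_elim
    fix x assume *: "cnj (phi x) * F x = f x + g x" "cmod (phi x) = 1"
    then have "phi x * cnj (phi x) = 1" using complex_norm_square[of "phi x"] by simp
    then show "F x = phi x * (f x + g x)" unfolding *(1)[symmetric] by (metis mult.assoc mult_1)
  qed
  moreover have "(\<lambda>x. phi x * (f x + g x)) \<in> S_lambda phi q"
    unfolding S_lambda_def by (rule CollectI) (intro exI[of _ f] exI[of _ g] conjI refl fg(1,2))
  ultimately show ?thesis unfolding ae_in_def by (rule bexI)
qed

lemma S_lambda_subset_range: "S_lambda phi q \<subseteq> model_range"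
proof
  fix F assume "F \<in> S_lambda phi q"
  then obtain f g where F: "F = (\<lambda>x. phi x * (f x + g x))" "f \<in> H2_bidisc" "g \<in> K_lambda q"
    unfolding S_lambda_def mem_Collect_eq by (elim exE conjE)
  have "f \<in> model_space"
    by (rule L2_closure_fspan_mono[OF monomials_L2 generators_L2 _ F(2)[unfolded H2_bidisc_eq]])
      (rule generator_in_model_space[OF UnI1])
  moreover have "g \<in> model_space"
    by (rule L2_closure_fspan_mono[OF kernels_L2 generators_L2 _ F(3)[unfolded K_lambda_eq]])
      (rule generator_in_model_space[OF UnI2])
  ultimately show "F \<in> model_range"
    unfolding F(1) by (intro phi_model_space L2_closure_fspan_add[OF generators_L2])
qed

text \<open>The zero of \<phi> on w = q z cancels the denominator of each generator, leaving a
  polynomial times \<open>outer_fn q 1\<close>.\<close>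

lemma model_range_subset_H2: "model_range \<subseteq> H2_bidisc"
proof
  fix F assume "F \<in> model_range"
  then show "F \<in> H2_bidisc"
    unfolding H2_bidisc_eq
  proof (rule L2_closure_fspan_mono[OF model_L2 monomials_L2, rotated])
    fix a assume "a \<in> range model"
    then obtain p where a: "a = model p" by blast
    define c where "c = complex_of_real (sqrt (1 - q\<^sup>2)) * \<gamma> ^ fst p * complex_of_real (1 - q)"
    have "(\<lambda>x. (c * (fst x ^ fst p * snd x ^ snd p)) * outer_fn q 1 x) \<in> H2_bidisc"
      by (intro H2_bidisc_mult_polynomial fspan_cmult fspan_base monomialsI outer_fn_H2 q)
    then show "a \<in> L2_closure torus_measure (fspan monomials)"
      unfolding H2_bidisc_eq
    proof (rule L2_closure_AE_eq[OF fspan_L2[OF monomials_L2]])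
      show "AE x in torus_measure. a x = c * (fst x ^ fst p * snd x ^ snd p) * outer_fn q 1 x"
        by (rule AE_torusI) (use denominator_nonzero in \<open>simp add: a model_def phi_def pole_def c_def\<close>)
    qed (simp add: a)
  qed
qed

lemma model_fst: "fst x * model p x = model (Suc (fst p), snd p) x / \<gamma>"
  and model_snd: "snd x * model p x = model (fst p, Suc (snd p)) x"
  using \<gamma> by (auto simp: model_def pole_def)

lemma model_range_invariant:
  assumes F: "F \<in> model_range"
  shows "(\<lambda>x. fst x * F x) \<in> model_range" "(\<lambda>x. snd x * F x) \<in> model_range"
proof -
  have fst: "(\<lambda>x. fst x * a x) \<in> model_range" if "a \<in> range model" for a
  proof -
    obtain p where a: "a = model p" using \<open>a \<in> range model\<close> by blast
    have "(\<lambda>x. (1 / \<gamma>) * model (Suc (fst p), snd p) x) \<in> model_range"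
      by (intro L2_closure_fspan_cmult[OF model_L2] model_in_range)
    then show ?thesis by (simp add: a model_fst)
  qed
  have snd: "(\<lambda>x. snd x * a x) \<in> model_range" if "a \<in> range model" for a
    using that model_in_range by (auto simp: model_snd)
  show "(\<lambda>x. fst x * F x) \<in> model_range"
    by (rule L2_closure_fspan_mult[OF model_L2 model_L2 _ _ fst F, of 1]) (auto intro!: AE_torusI simp: torus_def)
  show "(\<lambda>x. snd x * F x) \<in> model_range"
    by (rule L2_closure_fspan_mult[OF model_L2 model_L2 _ _ snd F, of 1]) (auto intro!: AE_torusI simp: torus_def)
qed

lemma S_lambda_closed: "L2_closed torus_measure (S_lambda phi q)"
  unfolding L2_closed_def
proof (intro conjI ballI impI)
  show "S_lambda phi q \<subseteq> L2 torus_measure" using S_lambda_subset_range L2_closureD by blast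
  fix f assume f: "f \<in> L2 torus_measure"
    "\<forall>e>0. \<exists>g\<in>S_lambda phi q. l2norm torus_measure (\<lambda>x. f x - g x) < e"
  have "f \<in> model_range"
    by (rule L2_closure_closed[OF fspan_L2[OF model_L2] f(1)]) (use f(2) S_lambda_subset_range in blast)
  then show "ae_in torus_measure f (S_lambda phi q)" by (rule model_range_in_S_lambda)
qed

lemma S_lambda_invariant:
  assumes "f \<in> S_lambda phi q"
  shows "ae_in torus_measure (Mz f) (S_lambda phi q)" "ae_in torus_measure (Mw f) (S_lambda phi q)"
  using model_range_invariant[of f] assms S_lambda_subset_range
  by (auto simp: Mz_def Mw_def intro!: model_range_in_S_lambda)

text \<open>Since \<phi> is unimodular it drops out of the inner product; (1 - q^2) / |w - q z|^2
  equals the Poisson kernel at q z / w because |w| = 1.\<close>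

lemma inner_model:
  "l2inner torus_measure (model (m, n)) (model (m', n')) =
    (if m' + n' = m + n then cnj \<gamma> ^ m * \<gamma> ^ m' * complex_of_real (q ^ nat \<bar>int m' - int m\<bar>) else 0)"
proof -
  have "l2inner torus_measure (model (m, n)) (model (m', n')) =
      (\<integral>x. (cnj \<gamma> ^ m * \<gamma> ^ m') * (tmono (int m' - int m) (int n' - int n) x
        * complex_of_real ((1 - q\<^sup>2) / (cmod (1 - complex_of_real q * tmono 1 (- 1) x))\<^sup>2)) \<partial>torus_measure)"
    unfolding l2inner_def
  proof (rule integral_cong_AE)
    show "AE x in torus_measure. cnj (model (m, n) x) * model (m', n') x =
      (cnj \<gamma> ^ m * \<gamma> ^ m') * (tmono (int m' - int m) (int n' - int n) x
        * complex_of_real ((1 - q\<^sup>2) / (cmod (1 - complex_of_real q * tmono 1 (- 1) x))\<^sup>2))"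
      using AE_torus AE_norm_phi
    proof eventually_elim
      fix x assume x: "x \<in> torus" "cmod (phi x) = 1"
      define c where "c = complex_of_real (sqrt (1 - q\<^sup>2)) * phi x / (snd x - complex_of_real q * fst x)"
      have eq: "model (m, n) x = \<gamma> ^ m * (fst x ^ m * snd x ^ n * c)" for m n
        by (simp add: model_def pole_def c_def mult_ac)
      have nz: "snd x \<noteq> 0" using torus_nonzero[OF x(1)] by simp
      have "1 - complex_of_real q * tmono 1 (- 1) x = (snd x - complex_of_real q * fst x) / snd x"
        using nz by (simp add: tmono_def field_simps)
      then have "cmod (snd x - complex_of_real q * fst x) = cmod (1 - complex_of_real q * tmono 1 (- 1) x)"
        using x(1) by (simp add: norm_divide torus_def)
      then have "cmod c = sqrt (1 - q\<^sup>2) / cmod (1 - complex_of_real q * tmono 1 (- 1) x)"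
        using sqrt_nonzero x(2) by (simp add: c_def norm_mult norm_divide)
      then have "(cmod c)\<^sup>2 = (1 - q\<^sup>2) / (cmod (1 - complex_of_real q * tmono 1 (- 1) x))\<^sup>2"
        using sqrt_nonzero by (simp add: power_divide)
      then show "cnj (model (m, n) x) * model (m', n') x =
        (cnj \<gamma> ^ m * \<gamma> ^ m') * (tmono (int m' - int m) (int n' - int n) x
          * complex_of_real ((1 - q\<^sup>2) / (cmod (1 - complex_of_real q * tmono 1 (- 1) x))\<^sup>2))"
      proof -
        have split: "cnj (\<gamma> ^ m * X) * (\<gamma> ^ m' * Y) = (cnj \<gamma> ^ m * \<gamma> ^ m') * (cnj X * Y)" for X Y
          by (simp add: mult_ac)
        show ?thesis
          unfolding eq split cnj_monomial_mult[OF x(1)] \<open>(cmod c)\<^sup>2 = _\<close> ..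

      qed
    qed
  qed measurable
  also have "\<dots> = (cnj \<gamma> ^ m * \<gamma> ^ m') * (\<integral>x. tmono (int m' - int m) (int n' - int n) x
        * complex_of_real ((1 - q\<^sup>2) / (cmod (1 - complex_of_real q * tmono 1 (- 1) x))\<^sup>2) \<partial>torus_measure)"
    by (rule integral_mult_right_zero)
  also have "\<dots> = (cnj \<gamma> ^ m * \<gamma> ^ m') * (if (int m' - int m) + (int n' - int n) = 0 then complex_of_real (q ^ nat \<bar>int m' - int m\<bar>) else 0)"
    unfolding poisson_moment_antidiagonal[OF q] ..
  finally show ?thesis by auto
qed

end

end


section \<open>Matching the cyclic subspaces with the function models\<close>

context normal_cross_pair
begin

text \<open>Reduces each model to exhibiting functions with Gram matrix \<open>gram \<mu>\<close>
  whose two indices are shifted by the two multipliers.\<close>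

lemma ueq_L2_cyclic:
  fixes M :: "'t measure" and u :: "nat \<times> nat \<Rightarrow> 't \<Rightarrow> complex"
  assumes e: "eigenpair \<mu> e" "norm e = 1" and M: "finite_measure M"
    and u: "\<And>p. u p \<in> L2 M" "\<And>p p'. l2inner M (u p) (u p') = gram \<mu> p p'"
    and \<tau>1: "\<tau>1 \<in> borel_measurable M" "AE t in M. cmod (\<tau>1 t) = 1" "\<And>m n t. \<tau>1 t * u (m, n) t = u (Suc m, n) t"
    and \<tau>2: "\<tau>2 \<in> borel_measurable M" "AE t in M. cmod (\<tau>2 t) = 1" "\<And>m n t. \<tau>2 t * u (m, n) t = u (m, Suc n) t"
    and K: "\<And>f. f \<in> L2_closure M (fspan (range u)) \<Longrightarrow> ae_in M f K" "K \<subseteq> L2_closure M (fspan (range u))"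
    and T: "\<And>f. T1 f = (\<lambda>t. \<tau>1 t * f t)" "\<And>f. T2 f = (\<lambda>t. \<tau>2 t * f t)"
  shows "ueq_L2 M V1 V2 (cyclic e) T1 T2 K"
proof -
  interpret finite_measure M by (rule M)
  interpret equal_gram M "orbit e" u
  proof
    show "l2inner M (u p) (u p') = cinner (orbit e p) (orbit e p')" for p p'
      using cinner_orbit[OF e(1) e(1), of "fst p" "snd p" "fst p'" "snd p'"] u(2)[of p p'] e(2)
      by (simp add: cinner_self_norm)
  qed (rule u)
  have \<tau>: "AE t in M. \<tau>1 t * u p t = u (Suc (fst p), snd p) t" "AE t in M. \<tau>2 t * u p t = u (fst p, Suc (snd p)) t" for p
    using \<tau>1(3)[of _ "fst p" "snd p"] \<tau>2(3)[of _ "fst p" "snd p"] by simp_all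
  show ?thesis
    unfolding cyclic_def
    by (rule ueq_L2_from_gram[where ?s1.0 = "\<lambda>p. (Suc (fst p), snd p)" and ?s2.0 = "\<lambda>p. (fst p, Suc (snd p))"
        and ?\<tau>1.0 = \<tau>1 and ?\<tau>2.0 = \<tau>2])
      (use iso1 iso2 orbit_V1 orbit_V2 \<tau>1(1,2) \<tau>2(1,2) \<tau> K T reducingD[OF reducing_cyclic[OF e(1)]]
        in \<open>simp_all add: cyclic_def\<close>)
qed

text \<open>For \<mu> = 0 the convention 0^0 = 1 makes \<open>gram\<close> the identity matrix,
  which is the Gram matrix of the monomials on the torus.\<close>

lemma ueq_bidisc:
  assumes e: "eigenpair 0 e" "norm e = 1"
  shows "ueq_L2 torus_measure V1 V2 (cyclic e) Mz Mw H2_bidisc"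
proof -
  let ?u = "\<lambda>p x. fst x ^ fst p * snd x ^ snd p :: complex"
  show ?thesis
  proof (rule ueq_L2_cyclic[OF e finite_torus_measure, where u = ?u and ?\<tau>1.0 = fst and ?\<tau>2.0 = snd])
    show "?u p \<in> L2 torus_measure" for p using monomialsI monomials_L2 by blast
    show "l2inner torus_measure (?u p) (?u p') = gram 0 p p'" for p p'
      unfolding inner_monomials by (cases p; cases p') (auto simp: gram_def power_0_left)
    show "ae_in torus_measure f H2_bidisc" if "f \<in> L2_closure torus_measure (fspan (range ?u))" for f
      using that by (auto simp: ae_in_def H2_bidisc_eq monomials_eq)
  qed (auto intro!: AE_torusI simp: torus_def Mz_def Mw_def H2_bidisc_eq monomials_eq fun_eq_iff)
qed

text \<open>The subtorus w = \<alpha> z. The eigenvalue is \<open>cnj \<alpha>\<close> since it is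
  the constant value of conj(w) z there.\<close>

lemma inner_circle_powers:
  assumes \<alpha>: "cmod \<alpha> = 1"
  shows "l2inner circle_measure (\<lambda>z. \<alpha> ^ n * z ^ (m + n)) (\<lambda>z. \<alpha> ^ n' * z ^ (m' + n')) = gram (cnj \<alpha>) (m, n) (m', n')"
proof -
  have "l2inner circle_measure (\<lambda>z. \<alpha> ^ n * z ^ (m + n)) (\<lambda>z. \<alpha> ^ n' * z ^ (m' + n'))
      = (\<integral>z. (cnj \<alpha> ^ n * \<alpha> ^ n') * z powi (int (m' + n') - int (m + n)) \<partial>circle_measure)"
    unfolding l2inner_def
  proof (rule integral_cong_AE)
    show "AE z in circle_measure. cnj (\<alpha> ^ n * z ^ (m + n)) * (\<alpha> ^ n' * z ^ (m' + n'))
      = (cnj \<alpha> ^ n * \<alpha> ^ n') * z powi (int (m' + n') - int (m + n))"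
      using AE_circle
    proof eventually_elim
      fix z :: complex assume z: "cmod z = 1"
      then have nz: "z \<noteq> 0" by auto
      have "cnj z = inverse z" using complex_div_cnj[of 1 z] z by (simp add: divide_inverse)
      then have "cnj z ^ (m + n) * z ^ (m' + n') = z ^ (m' + n') / z ^ (m + n)"
        by (simp only: power_inverse divide_inverse mult.commute)
      also have "\<dots> = z powi (int (m' + n') - int (m + n))"
        by (simp only: power_int_diff[OF disjI1[OF nz]] power_int_of_nat)
      finally have "cnj z ^ (m + n) * z ^ (m' + n') = z powi (int (m' + n') - int (m + n))" .
      then show "cnj (\<alpha> ^ n * z ^ (m + n)) * (\<alpha> ^ n' * z ^ (m' + n'))
        = (cnj \<alpha> ^ n * \<alpha> ^ n') * z powi (int (m' + n') - int (m + n))"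
        by (simp add: mult_ac)
    qed
  qed (auto simp: measurable_cong_sets[OF sets_circle_measure refl])
  also have "\<dots> = (cnj \<alpha> ^ n * \<alpha> ^ n') * (\<integral>z. z powi (int (m' + n') - int (m + n)) \<partial>circle_measure)"
    by (rule integral_mult_right_zero)
  also have "\<dots> = (if m' + n' = m + n then cnj \<alpha> ^ n * \<alpha> ^ n' else 0)"
    unfolding circle_moment by auto
  also have "\<dots> = gram (cnj \<alpha>) (m, n) (m', n')"
  proof (cases "m' + n' = m + n")
    case True
    have 1: "\<alpha> * cnj \<alpha> = 1" using complex_norm_square[of \<alpha>] \<alpha> by simp
    show ?thesis
    proof (cases "m \<le> m'")
      case True
      then have "n = n' + (m' - m)" using \<open>m' + n' = m + n\<close> by simp
      then have "cnj \<alpha> ^ n * \<alpha> ^ n' = (\<alpha> * cnj \<alpha>) ^ n' * cnj \<alpha> ^ (m' - m)"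
        by (simp add: power_add power_mult_distrib mult_ac)
      then show ?thesis using True \<open>m' + n' = m + n\<close> by (simp add: 1 gram_def)
    next
      case False
      then have "n' = n + (m - m')" using \<open>m' + n' = m + n\<close> by simp
      then have "cnj \<alpha> ^ n * \<alpha> ^ n' = (\<alpha> * cnj \<alpha>) ^ n * \<alpha> ^ (m - m')"
        by (simp add: power_add power_mult_distrib mult_ac)
      then show ?thesis using False \<open>m' + n' = m + n\<close> by (simp add: 1 gram_def)
    qed
  qed (simp add: gram_def)
  finally show ?thesis .
qed

lemma ueq_disc:
  assumes e: "eigenpair \<mu> e" "norm e = 1" and \<mu>: "cmod \<mu> = 1"
  shows "ueq_L2 circle_measure V1 V2 (cyclic e) (\<lambda>f z. z * f z) (\<lambda>f z. cnj \<mu> * z * f z) H2_disc"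
proof -
  define u where "u p z = cnj \<mu> ^ snd p * z ^ (fst p + snd p)" for p :: "nat \<times> nat" and z :: complex
  have um [measurable]: "u p \<in> borel_measurable circle_measure" for p
    by (simp add: u_def[abs_def] measurable_cong_sets[OF sets_circle_measure refl])
  have uL: "u p \<in> L2 circle_measure" for p
    by (rule bounded_L2_circle[of _ 1]) (use \<mu> in \<open>simp_all add: u_def norm_mult norm_power um\<close>)
  have rL: "range u \<subseteq> L2 circle_measure" using uL by blast
  have \<mu>0: "cnj \<mu> \<noteq> 0" using \<mu> by auto
  let ?P = "{(\<lambda>z. z ^ j) | j. True} :: (complex \<Rightarrow> complex) set"
  have PL: "?P \<subseteq> L2 circle_measure" using uL[of "(_, 0)"] by (auto simp: u_def[abs_def])
  have H: "f \<in> L2_closure circle_measure (fspan (range u)) \<longleftrightarrow> f \<in> H2_disc" for f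
  proof
    assume "f \<in> L2_closure circle_measure (fspan (range u))"
    then show "f \<in> H2_disc"
      unfolding H2_disc_def
    proof (rule L2_closure_fspan_mono[OF rL PL, rotated])
      fix a assume "a \<in> range u"
      then obtain p where a: "a = (\<lambda>z. cnj \<mu> ^ snd p * z ^ (fst p + snd p))" by (auto simp: u_def[abs_def])
      have "a \<in> fspan ?P" unfolding a by (intro fspan_cmult fspan_base) blast
      then show "a \<in> L2_closure circle_measure (fspan ?P)"
        using fspan_L2[OF PL] by (intro L2_closure_base) auto
    qed
  next
    assume "f \<in> H2_disc"
    then show "f \<in> L2_closure circle_measure (fspan (range u))"
      unfolding H2_disc_def
    proof (rule L2_closure_fspan_mono[OF PL rL, rotated])
      fix a :: "complex \<Rightarrow> complex" assume "a \<in> ?P"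
      then obtain j where "a = u (j, 0)" by (auto simp: u_def[abs_def])
      then show "a \<in> L2_closure circle_measure (fspan (range u))"
        using uL by (auto intro!: L2_closure_base fspan_base)
    qed
  qed
  show ?thesis
  proof (rule ueq_L2_cyclic[OF e finite_circle_measure, where u = u and ?\<tau>1.0 = "\<lambda>z. z" and ?\<tau>2.0 = "\<lambda>z. cnj \<mu> * z"])
    show "l2inner circle_measure (u p) (u p') = gram \<mu> p p'" for p p'
      using inner_circle_powers[of "cnj \<mu>" "snd p" "fst p" "snd p'" "fst p'"] \<mu>
      by (simp add: u_def[abs_def])
    show "AE z in circle_measure. cmod z = 1" by (rule AE_circle)
    show "AE z in circle_measure. cmod (cnj \<mu> * z) = 1"
      using AE_circle by eventually_elim (simp add: norm_mult \<mu>)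
    show "ae_in circle_measure f H2_disc" if "f \<in> L2_closure circle_measure (fspan (range u))" for f
      using that H by (auto simp: ae_in_def)
    show "H2_disc \<subseteq> L2_closure circle_measure (fspan (range u))" using H by blast
  qed (auto simp: uL u_def measurable_cong_sets[OF sets_circle_measure refl])
qed

text \<open>As \<gamma> is unimodular, its powers collapse to the difference of the exponents,
  conjugated when that difference is negative, matching the two branches of
  \<open>gram\<close>.\<close>

lemma inner_model_gram:
  assumes q: "0 < q" "q < 1" and \<gamma>: "cmod \<gamma> = 1"
  shows "l2inner torus_measure (model q \<gamma> p) (model q \<gamma> p') = gram (\<gamma> * complex_of_real q) p p'"
proof -
  obtain m n where p: "p = (m, n)" by (cases p)
  obtain m' n' where p': "p' = (m', n')" by (cases p')
  have 1: "\<gamma> * cnj \<gamma> = 1" using complex_norm_square[of \<gamma>] \<gamma> by simp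
  show ?thesis
  proof (cases "m \<le> m'")
    case True
    then obtain d where d: "m' = m + d" using le_Suc_ex by blast
    have "cnj \<gamma> ^ m * \<gamma> ^ m' = (\<gamma> * cnj \<gamma>) ^ m * \<gamma> ^ (m' - m)"
      by (simp add: d power_add power_mult_distrib mult_ac)
    moreover have "nat \<bar>int m' - int m\<bar> = m' - m" using True by simp
    ultimately show ?thesis
      unfolding p p' inner_model[OF q \<gamma>] using True by (simp add: gram_def 1 power_mult_distrib)
  next
    case False
    then obtain d where d: "m = m' + d" using le_Suc_ex nat_le_linear by blast
    have "cnj \<gamma> ^ m * \<gamma> ^ m' = (\<gamma> * cnj \<gamma>) ^ m' * cnj \<gamma> ^ (m - m')"
      by (simp add: d power_add power_mult_distrib mult_ac)
    moreover have "nat \<bar>int m' - int m\<bar> = m - m'" using False by simp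
    ultimately show ?thesis
      unfolding p p' inner_model[OF q \<gamma>] using False by (simp add: gram_def 1 power_mult_distrib)
  qed
qed

lemma ueq_S_lambda:
  assumes e: "eigenpair \<mu> e" "norm e = 1" and q: "0 < q" "q < 1" and \<gamma>: "cmod \<gamma> = 1" and \<mu>: "\<mu> = \<gamma> * complex_of_real q"
  shows "ueq_L2 torus_measure V1 V2 (cyclic e) (\<lambda>f. (\<lambda>x. \<gamma> * Mz f x)) Mw (S_lambda (phi q) q)"
proof (rule ueq_L2_cyclic[OF e finite_torus_measure, where u = "model q \<gamma>" and ?\<tau>1.0 = "\<lambda>x. \<gamma> * fst x" and ?\<tau>2.0 = snd])
  show "model q \<gamma> p \<in> L2 torus_measure" for p using model_L2[OF q \<gamma>] by blast
  show "l2inner torus_measure (model q \<gamma> p) (model q \<gamma> p') = gram \<mu> p p'" for p p'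
    unfolding \<mu> by (rule inner_model_gram[OF q \<gamma>])
  show "\<gamma> * fst x * model q \<gamma> (m, n) x = model q \<gamma> (Suc m, n) x" for m n x
    using model_fst[OF q \<gamma>, of x "(m, n)"] \<gamma> by (auto simp: mult.assoc)
  show "snd x * model q \<gamma> (m, n) x = model q \<gamma> (m, Suc n) x" for m n x
    using model_snd[OF q \<gamma>, of x "(m, n)"] by simp
  show "ae_in torus_measure f (S_lambda (phi q) q)" if "f \<in> L2_closure torus_measure (fspan (range (model q \<gamma>)))" for f
    by (rule model_range_in_S_lambda[OF q \<gamma> that])
  show "S_lambda (phi q) q \<subseteq> L2_closure torus_measure (fspan (range (model q \<gamma>)))"
    by (rule S_lambda_subset_range[OF q \<gamma>])
qed (auto intro!: AE_torusI simp: torus_def norm_mult \<gamma> Mz_def Mw_def mult.assoc)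

lemma cyclic_models:
  assumes e: "eigenpair \<mu> e" "norm e = 1"
  shows "ueq_L2 torus_measure V1 V2 (cyclic e) Mz Mw H2_bidisc \<or>
         (\<exists>\<alpha>. cmod \<alpha> = 1 \<and>
            ueq_L2 circle_measure V1 V2 (cyclic e) (\<lambda>f z. z * f z) (\<lambda>f z. \<alpha> * z * f z) H2_disc) \<or>
         (\<exists>lam \<gamma> \<phi>. 0 < lam \<and> lam < 1 \<and> cmod \<gamma> = 1 \<and> inner_fn \<phi> \<and>
            S_lambda \<phi> lam \<subseteq> H2_bidisc \<and> L2_closed torus_measure (S_lambda \<phi> lam) \<and>
            (\<forall>f\<in>S_lambda \<phi> lam. ae_in torus_measure (Mz f) (S_lambda \<phi> lam) \<and>
                                  ae_in torus_measure (Mw f) (S_lambda \<phi> lam)) \<and>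
            ueq_L2 torus_measure V1 V2 (cyclic e) (\<lambda>f. (\<lambda>x. \<gamma> * Mz f x)) Mw (S_lambda \<phi> lam))"
proof -
  consider "\<mu> = 0" | "cmod \<mu> = 1" | "0 < cmod \<mu>" "cmod \<mu> < 1"
    using eigenvalue_norm_le[OF e] by fastforce
  then show ?thesis
  proof cases
    case 1
    then show ?thesis using ueq_bidisc[of e] e by simp
  next
    case 2
    then have "cmod (cnj \<mu>) = 1" by simp
    then show ?thesis using ueq_disc[OF e 2] by (intro disjI2 disjI1 exI[of _ "cnj \<mu>"] conjI)
  next
    case 3
    define q where "q = cmod \<mu>"
    \<comment> \<open>The phase of the eigenvalue is moved onto the multiplier z, which leaves the
      positive parameter \<open>q\<close> for the kernel.\<close>
    define \<gamma> where "\<gamma> = \<mu> / complex_of_real q"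
    have q: "0 < q" "q < 1" using 3 by (simp_all add: q_def)
    have \<gamma>: "cmod \<gamma> = 1" using q by (simp add: \<gamma>_def norm_divide q_def)
    have \<mu>: "\<mu> = \<gamma> * complex_of_real q" using q by (simp add: \<gamma>_def)
    have sub: "S_lambda (phi q) q \<subseteq> H2_bidisc"
      using S_lambda_subset_range[OF q \<gamma>] model_range_subset_H2[OF q \<gamma>] by (rule order_trans)
    show ?thesis
      by (intro disjI2 exI[of _ q] exI[of _ \<gamma>] exI[of _ "phi q"] conjI ballI q \<gamma> inner_phi[OF q] sub
          S_lambda_closed[OF q \<gamma>] S_lambda_invariant[OF q \<gamma>] ueq_S_lambda[OF e q \<gamma> \<mu>])
  qed
qed

end

theorem theorem8p11:
  fixes V1 V2 :: "'a::{complex_inner, complete_space} \<Rightarrow> 'a"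
  assumes separable: "\<exists>D::'a set. countable D \<and> closure D = UNIV"
    and cnp: "compact_normal_pair V1 V2"
  shows "\<exists>H :: nat \<Rightarrow> 'a set.
     (\<forall>i. reducing V1 V2 (H i)) \<and>
     (\<forall>i j. i \<noteq> j \<longrightarrow> corth (H i) (H j)) \<and>
     closure (cspan (\<Union>i. H i)) = UNIV \<and>
     (\<forall>i. 1 \<le> i \<and> hdim (E1 V1 V2) < enat i \<longrightarrow> H i = {0}) \<and>
     shift_unitary_on V1 V2 (H 0) \<and>
     (\<forall>i. 1 \<le> i \<and> enat i \<le> hdim (E1 V1 V2) \<longrightarrow>
        irreducible_on V1 V2 (H i) \<and>
        (ueq_L2 torus_measure V1 V2 (H i) Mz Mw H2_bidisc \<or>
         (\<exists>\<alpha>. cmod \<alpha> = 1 \<and>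
            ueq_L2 circle_measure V1 V2 (H i) (\<lambda>f z. z * f z) (\<lambda>f z. \<alpha> * z * f z) H2_disc) \<or>
         (\<exists>lam \<gamma> \<phi>. 0 < lam \<and> lam < 1 \<and> cmod \<gamma> = 1 \<and> inner_fn \<phi> \<and>
            S_lambda \<phi> lam \<subseteq> H2_bidisc \<and> L2_closed torus_measure (S_lambda \<phi> lam) \<and>
            (\<forall>f\<in>S_lambda \<phi> lam. ae_in torus_measure (Mz f) (S_lambda \<phi> lam) \<and>
                                  ae_in torus_measure (Mw f) (S_lambda \<phi> lam)) \<and>
            ueq_L2 torus_measure V1 V2 (H i) (\<lambda>f. (\<lambda>x. \<gamma> * Mz f x)) Mw (S_lambda \<phi> lam))))"
proof -
  interpret normal_cross_pair V1 V2 by (rule compact_normal_pair_normal_cross_pair[OF cnp])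
  obtain D :: "'a set" where D: "countable D" "closure D = UNIV" using separable by blast
  have T: "compact_op T" and shift: "is_shift (V1 \<circ> V2)"
    using cnp by (simp_all add: compact_normal_pair_def BCL_pair_def)
  show ?thesis
  proof (rule cyclic_decomposition[OF T D shift])
    fix H e \<mu>
    assume H: "\<And>i. reducing V1 V2 (H i)" "\<And>i j. i \<noteq> j \<Longrightarrow> corth (H i) (H j)"
      "closure (cspan (\<Union>i. H i)) = UNIV" "\<And>i. 1 \<le> i \<Longrightarrow> hdim (E1 V1 V2) < enat i \<Longrightarrow> H i = {0}"
      "shift_unitary_on V1 V2 (H 0)"
      and e: "\<And>i. 1 \<le> i \<Longrightarrow> enat i \<le> hdim (E1 V1 V2) \<Longrightarrow>
        eigenpair (\<mu> i) (e i) \<and> norm (e i) = 1 \<and> H i = cyclic (e i)"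
    have H_eq: "H i = cyclic (e i)" and ei: "eigenpair (\<mu> i) (e i)" "norm (e i) = 1" "e i \<noteq> 0"
      if "1 \<le> i \<and> enat i \<le> hdim (E1 V1 V2)" for i
      using e[of i] that by auto
    show ?thesis
    proof (rule exI[of _ H], intro conjI allI impI)
      fix i assume i: "1 \<le> i \<and> enat i \<le> hdim (E1 V1 V2)"
      show "irreducible_on V1 V2 (H i)"
        unfolding H_eq[OF i] by (rule irreducible_on_cyclic[OF ei(1)[OF i] ei(3)[OF i]])
      show "ueq_L2 torus_measure V1 V2 (H i) Mz Mw H2_bidisc \<or>
         (\<exists>\<alpha>. cmod \<alpha> = 1 \<and>
            ueq_L2 circle_measure V1 V2 (H i) (\<lambda>f z. z * f z) (\<lambda>f z. \<alpha> * z * f z) H2_disc) \<or>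
         (\<exists>lam \<gamma> \<phi>. 0 < lam \<and> lam < 1 \<and> cmod \<gamma> = 1 \<and> inner_fn \<phi> \<and>
            S_lambda \<phi> lam \<subseteq> H2_bidisc \<and> L2_closed torus_measure (S_lambda \<phi> lam) \<and>
            (\<forall>f\<in>S_lambda \<phi> lam. ae_in torus_measure (Mz f) (S_lambda \<phi> lam) \<and>
                                  ae_in torus_measure (Mw f) (S_lambda \<phi> lam)) \<and>
            ueq_L2 torus_measure V1 V2 (H i) (\<lambda>f. (\<lambda>x. \<gamma> * Mz f x)) Mw (S_lambda \<phi> lam))"
        unfolding H_eq[OF i] by (rule cyclic_models[OF ei(1)[OF i] ei(2)[OF i]])
    qed (use H in auto)
  qed
qed

end
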